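(* Let $a\in(0,\tfrac12]$ and let $S_a\subset\mathbb{R}^2$ be the von Koch snowflake domain with parameter $a$. Then $S_a$ is a $c$-John domain with \[ c=\max\left\{2,\frac{4}{3(1-a)}\right\}, \] and $S_a$ is not a $c'$-John domain for any $c'<2$.
   Context: Von Koch snowflake domain: let $a\in(0,\tfrac12]$. Start with an equilateral triangle of side length $1$. Replace the middle $a$-th portion of each side (the centered subsegment whose length is $a$ times the length of the side) by the other two sides of the equilateral triangle erected outward on that subsegment. Continue inductively, applying the same replacement to every line segment of the resulting polygonal curve. The limit curve is the von Koch snowflake, and $S_a$ denotes the bounded domain bordered by it (equivalently, the increasing union of the interiors of the filled polygons obtained at the successive stages). John domain: for $c\ge1$, a domain $D$ is a $c$-John domain if there is a distinguished point $x_0\in D$ (the John center) such that any $x\in D$ can be connected to $x_0$ by a rectifiable curve $\gamma:[0,l]\to D$, parametrized by arclength, with $\gamma(0)=x$, $\gamma(l)=x_0$ and $\operatorname{dist}(\gamma(t),\partial D)\ge\frac1c t$ for every $0\le t\le l$. *)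

theory Defs
  imports "HOL-Analysis.Analysis"
begin

section \<open>John domains\<close>

text \<open>Length of \<open>\<gamma>\<close> restricted to \<open>{s..t}\<close>: supremum of the lengths of inscribed polygons, the
  subdivisions being sorted lists of parameters.\<close>

definition curve_length :: "(real \<Rightarrow> 'a::metric_space) \<Rightarrow> real \<Rightarrow> real \<Rightarrow> ennreal" where
  "curve_length \<gamma> s t =
     (SUP xs \<in> {xs. sorted xs \<and> set xs \<subseteq> {s..t}}.
        \<Sum>i<length xs - 1. ennreal (dist (\<gamma> (xs ! i)) (\<gamma> (xs ! Suc i))))"

text \<open>Since \<open>l\<close> is real, such a curve is automatically rectifiable, of length \<open>l\<close>.\<close>

definition arclength_parametrized :: "(real \<Rightarrow> 'a::metric_space) \<Rightarrow> real \<Rightarrow> bool" where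
  "arclength_parametrized \<gamma> l \<longleftrightarrow>
     0 \<le> l \<and> continuous_on {0..l} \<gamma> \<and> (\<forall>t\<in>{0..l}. curve_length \<gamma> 0 t = ennreal t)"

text \<open>The notion is only defined for \<open>c \<ge> 1\<close>; no set is a \<open>c\<close>-John domain for other \<open>c\<close>.
  A domain is a nonempty open connected set. Note that \<open>infdist\<close> to an empty frontier is \<open>0\<close>,
  which matters only for \<open>D = UNIV\<close>.\<close>

definition john_domain :: "real \<Rightarrow> 'a::euclidean_space set \<Rightarrow> bool" where
  "john_domain c D \<longleftrightarrow>
     1 \<le> c \<and> open D \<and> connected D \<and> D \<noteq> {} \<and>
     (\<exists>x0\<in>D. \<forall>x\<in>D. \<exists>\<gamma> l.
        arclength_parametrized \<gamma> l \<and> \<gamma> ` {0..l} \<subseteq> D \<and> \<gamma> 0 = x \<and> \<gamma> l = x0 \<and>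
        (\<forall>t\<in>{0..l}. infdist (\<gamma> t) (frontier D) \<ge> 1 / c * t))"


section \<open>The von Koch snowflake domain\<close>

text \<open>The plane is \<^typ>\<open>complex\<close>. A closed polygon is the list of its vertices in counterclockwise
  order, the first vertex being repeated at the end. Hence the outward side of an edge
  from \<open>p\<close> to \<open>q\<close> is its right-hand side, and the apex erected on its middle part \<open>[u, w]\<close> is obtained
  from \<open>w\<close> by rotating about \<open>u\<close> by the angle \<open>- \<pi> / 3\<close>; here \<open>w - u = a * (q - p)\<close>.\<close>

fun koch_refine :: "real \<Rightarrow> complex list \<Rightarrow> complex list" where
  "koch_refine a (p # q # ps) =
     (let u = p + of_real ((1 - a) / 2) * (q - p);
          w = p + of_real ((1 + a) / 2) * (q - p);
          v = u + cis (- pi / 3) * (w - u)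
      in p # u # v # w # koch_refine a (q # ps))"
| "koch_refine a [p] = [p]"
| "koch_refine a [] = []"

definition koch_vertices :: "real \<Rightarrow> nat \<Rightarrow> complex list" where
  "koch_vertices a n = (koch_refine a ^^ n) [0, 1, cis (pi / 3), 0]"

definition polygonal_curve :: "complex list \<Rightarrow> complex set" where
  "polygonal_curve ps = (\<Union>i<length ps - 1. closed_segment (ps ! i) (ps ! Suc i))"

text \<open>The filled polygon: the curve together with the points that it encloses.\<close>

definition filled_polygon :: "complex list \<Rightarrow> complex set" where
  "filled_polygon ps = polygonal_curve ps \<union> inside (polygonal_curve ps)"

definition koch_snowflake :: "real \<Rightarrow> complex set" where
  "koch_snowflake a = (\<Union>n. interior (filled_polygon (koch_vertices a n)))"

end

theory Submission
  imports Defs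
begin

text \<open>
  The snowflake is the increasing union of the interiors of \<open>F n\<close>, where \<open>F n\<close> consists of the
  closed triangle \<open>tri\<close> and of all closed bumps erected up to stage \<open>n\<close>. That \<open>F n\<close> is the filled
  polygon of stage \<open>n\<close> (\<open>filled_koch\<close>) means that its complement is connected, i.e. that
  the bumps enclose no pockets. By Janiszewski's theorem it is enough that bumps and flanks, added
  one after the other, always meet the previous ones in a connected set. This is where \<open>a \<le> 1/2\<close>
  enters: everything that grows on an edge stays in a trapezoid with base angles \<open>\<pi>/3\<close>, and the trapezoids on
  neighbouring edges have disjoint interiors. For \<open>a = 1/2\<close> neighbouring trapezoids are touched
  from both sides along their common leg, but at any finite stage in disjoint sets of radii
  (\<open>contact\<close>).

  John property. Each edge \<open>e\<close> of any stage carries inside \<open>F n\<close> an equilateral triangle \<open>E e\<close> with inradius \<open>r\<close>,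
  and each of the four edges that replace \<open>e\<close> has its triangle either in \<open>E e\<close> or equal to the bump
  on \<open>e\<close>. A curve starts in the triangle of some edge and climbs this tree up to the centroid of \<open>tri\<close>.
  Two states are propagated (\<open>edge_state\<close>): the curve has reached the centroid of \<open>E e\<close> with length at
  most \<open>c r\<close>, or the midpoint of \<open>e\<close> with length at most \<open>3/2 c a r\<close>. The second bound cannot be
  relaxed: the ball around the midpoint that touches the two sides of the bump on \<open>e\<close> has radius \<open>3/2 a r\<close>.
  In both states the curve is continued to the midpoint of the side of \<open>E e\<close> opposite to a vertex \<open>V\<close>
  at an end of \<open>e\<close>, with length at most \<open>3/2 c r\<close> (\<open>corner_step\<close>): from the centroid along the ray from \<open>V\<close>,
  on which the distance to the sides through \<open>V\<close> grows at half the speed of the curve, whence \<open>c \<ge> 2\<close>. One full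
  bump step turns a length \<open>T\<close> (in inradii, at the base midpoint) into \<open>a T + 2\<close>; the fixed point
  \<open>2 / (1 - a)\<close>, divided by \<open>3/2\<close>, is \<open>4 / (3 (1 - a))\<close>. For \<open>a \<ge> 1/3\<close> the straight continuation
  through the centroid is a little too long for the distance to \<open>e\<close> where the ray from \<open>V\<close> passes the end
  of the base of the bump. Therefore the corner at the centroid is cut by a chord (\<open>corner_step_big\<close>).

  Sharpness. At a vertex of \<open>tri\<close> the snowflake has a neck whose two ends are the points at distance
  \<open>(1 - a) / 2\<close> on the two sides. A curve from near the vertex to a far away centre crosses the neck
  at a point \<open>z\<close>, whose distance to the boundary is at most half of its distance to the vertex
  (\<open>cut_point\<close>), hence essentially at most half of the length of the curve up to \<open>z\<close>.
\<close>

section \<open>Triangular coordinates\<close>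

text \<open>Points are described by \<open>Re z\<close> and by \<open>ht z\<close>, the imaginary part in units of \<open>sqrt 3\<close>. In these
  coordinates all lines of the triangular lattice, the rotations by multiples of \<open>\<pi>/3\<close> and the
  reflections of the triangle have rational coefficients; only the norm,
  \<open>(Re z)\<^sup>2 + 3 (ht z)\<^sup>2\<close>, remembers the \<open>sqrt 3\<close>.\<close>

definition ht :: "complex \<Rightarrow> real" where "ht z = Im z / sqrt 3"

lemma Im_eq_ht: "Im z = sqrt 3 * ht z" by (simp add: ht_def)

lemma complex_eq_ht_iff: "z = w \<longleftrightarrow> Re z = Re w \<and> ht z = ht w"
  by (simp add: complex_eq_iff ht_def)

lemma ht_simps [simp]: "ht (z + w) = ht z + ht w" "ht (z - w) = ht z - ht w" "ht (- z) = - ht z"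
  "ht 0 = 0" "ht 1 = 0" "ht (of_real r) = 0" "ht (cnj z) = - ht z" "ht (r *\<^sub>R z) = r * ht z"
  "ht (Complex x (sqrt 3 * y)) = y"
  by (simp_all add: ht_def add_divide_distrib diff_divide_distrib)

lemma mult_ht: "Re (z * w) = Re z * Re w - 3 * ht z * ht w"
  "ht (z * w) = Re z * ht w + ht z * Re w"
proof -
  have "sqrt 3 * ht z * (sqrt 3 * ht w) = 3 * ht z * ht w" by simp
  then show "Re (z * w) = Re z * Re w - 3 * ht z * ht w"
    by (simp only: times_complex.simps Im_eq_ht)
  show "ht (z * w) = Re z * ht w + ht z * Re w" by (simp add: ht_def field_simps)
qed

(* Expanding products into real and imaginary parts would compete with mult_ht. *)
declare times_complex.simps [simp del]

lemma norm_ht: "(cmod z)\<^sup>2 = (Re z)\<^sup>2 + 3 * (ht z)\<^sup>2"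
  by (simp add: cmod_power2 Im_eq_ht power_mult_distrib)

lemma dist_ht: "(dist z w)\<^sup>2 = (Re z - Re w)\<^sup>2 + 3 * (ht z - ht w)\<^sup>2"
  by (simp add: dist_norm norm_ht)

lemma continuous_on_ht [continuous_intros]:
  "continuous_on S f \<Longrightarrow> continuous_on S (\<lambda>x. ht (f x))"
  unfolding ht_def by (intro continuous_intros) auto

definition tri_pt :: "real \<Rightarrow> real \<Rightarrow> complex" where
  "tri_pt x y = Complex x (sqrt 3 * y)"

lemma tri_pt_simps [simp]: "Re (tri_pt x y) = x" "ht (tri_pt x y) = y"
  by (simp_all add: tri_pt_def)

lemma cis_pi_3: "cis (pi / 3) = tri_pt (1/2) (1/2)" "cis (- pi / 3) = tri_pt (1/2) (-1/2)"
  by (simp_all add: complex_eq_iff tri_pt_def cos_60 sin_60)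

text \<open>The direct similarity that carries the reference edge from \<open>0\<close> to \<open>1\<close> to the edge from \<open>p\<close> to \<open>q\<close>. Outside of
  the polygon lies on the right, i.e. where \<open>ht\<close> is negative for the reference edge.\<close>

definition edge_map :: "complex \<Rightarrow> complex \<Rightarrow> complex \<Rightarrow> complex" where
  "edge_map p q z = p + (q - p) * z"

lemma edge_map_0 [simp]: "edge_map p q 0 = p" and edge_map_1 [simp]: "edge_map p q 1 = q"
  by (simp_all add: edge_map_def)

lemma edge_map_edge_map: "edge_map p q (edge_map r s z) = edge_map (edge_map p q r) (edge_map p q s) z"
  by (simp add: edge_map_def algebra_simps)

lemma edge_map_image_image:
  "edge_map p q ` edge_map r s ` X = edge_map (edge_map p q r) (edge_map p q s) ` X"
  by (simp add: image_image edge_map_edge_map)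

lemma edge_map_segment: "edge_map p q ` closed_segment 0 1 = closed_segment p q"
proof -
  have "edge_map p q ` closed_segment 0 1 = (\<lambda>x. p + x) ` (\<lambda>x. (q - p) * x) ` closed_segment 0 1"
    by (simp add: image_image edge_map_def)
  also have "\<dots> = closed_segment p q"
    by (simp add: closed_segment_linear_image[symmetric] closed_segment_translation[symmetric])
  finally show ?thesis .
qed

lemma inj_edge_map: "p \<noteq> q \<Longrightarrow> inj (edge_map p q)"
  by (auto simp: edge_map_def inj_on_def)

lemma edge_map_inverse: "p \<noteq> q \<Longrightarrow> edge_map p q ((z - p) / (q - p)) = z" "p \<noteq> q \<Longrightarrow> (edge_map p q z - p) / (q - p) = z"
  by (auto simp: edge_map_def)

lemma homeo_edge_map:
  assumes "p \<noteq> q" shows "homeomorphism UNIV UNIV (edge_map p q) (\<lambda>z. (z - p) / (q - p))"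
proof (rule homeomorphismI)
  show "continuous_on UNIV (edge_map p q)" "continuous_on UNIV (\<lambda>z. (z - p) / (q - p))"
    using assms by (auto simp: edge_map_def intro!: continuous_intros)
qed (use assms in \<open>auto simp: edge_map_inverse\<close>)

section \<open>The four edges that replace an edge\<close>

definition foot1 :: "real \<Rightarrow> complex" where "foot1 a = tri_pt ((1/2 - a/2)) 0"
definition apex :: "real \<Rightarrow> complex" where "apex a = tri_pt (1/2) (- (a / 2))"
definition foot2 :: "real \<Rightarrow> complex" where "foot2 a = tri_pt ((1/2 + a/2)) 0"

text \<open>The maps of the self-similar structure: the reference edge goes to the four edges that replace it.\<close>

definition "child1 a = edge_map 0 (foot1 a)"
definition "child2 a = edge_map (foot1 a) (apex a)"
definition "child3 a = edge_map (apex a) (foot2 a)"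
definition "child4 a = edge_map (foot2 a) 1"

lemmas child_defs = child1_def child2_def child3_def child4_def

lemma child_coords:
  "Re (child1 a z) = (1/2 - a/2) * Re z" "ht (child1 a z) = (1/2 - a/2) * ht z"
  "Re (child2 a z) = (1/2 - a/2) + a * (Re z + 3 * ht z) / 2" "ht (child2 a z) = a * (ht z - Re z) / 2"
  "Re (child3 a z) = 1 / 2 + a * (Re z - 3 * ht z) / 2" "ht (child3 a z) = - (a / 2) + a * (Re z + ht z) / 2"
  "Re (child4 a z) = (1/2 + a/2) + (1/2 - a/2) * Re z" "ht (child4 a z) = (1/2 - a/2) * ht z"
  by (simp_all add: child_defs edge_map_def mult_ht foot1_def apex_def foot2_def field_simps)

primrec flank_curve :: "real \<Rightarrow> nat \<Rightarrow> complex set" where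
  "flank_curve a 0 = closed_segment 0 1"
| "flank_curve a (Suc n) = child1 a ` flank_curve a n \<union> child2 a ` flank_curve a n
     \<union> child3 a ` flank_curve a n \<union> child4 a ` flank_curve a n"

lemma polygonal_curve_Cons:
  "polygonal_curve (p # q # ps) = closed_segment p q \<union> polygonal_curve (q # ps)"
proof -
  have "{..<Suc (length ps)} = insert 0 (Suc ` {..<length ps})"
    by (metis lessThan_Suc_eq_insert_0)
  then show ?thesis
    unfolding polygonal_curve_def by (simp)
qed

lemma polygonal_curve_single: "polygonal_curve [p] = {}"
  by (simp add: polygonal_curve_def)

lemma koch_refine_Cons_edge:
  "koch_refine a (p # q # ps) = p # edge_map p q (foot1 a) # edge_map p q (apex a) # edge_map p q (foot2 a)
     # koch_refine a (q # ps)"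
proof -
  have "foot1 a + cis (- pi / 3) * (foot2 a - foot1 a) = apex a"
    unfolding cis_pi_3 complex_eq_ht_iff by (simp add: mult_ht foot1_def foot2_def apex_def field_simps)
  then have 1: "apex a = foot1 a + cis (- pi / 3) * (foot2 a - foot1 a)" by simp
  have 2: "foot1 a = of_real ((1 - a) / 2)" "foot2 a = of_real ((1 + a) / 2)"
    by (simp_all add: complex_eq_iff foot1_def foot2_def tri_pt_def field_simps)
  have apx: "p + complex_of_real ((1 - a) / 2) * (q - p) + cis (- pi / 3) *
      (p + complex_of_real ((1 + a) / 2) * (q - p) - (p + complex_of_real ((1 - a) / 2) * (q - p)))
      = p + (q - p) * apex a" for p q
    unfolding 1 2 by (simp only: algebra_simps)
  show ?thesis
    unfolding koch_refine.simps Let_def edge_map_def apx 2 by (simp only: mult.commute)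
qed

lemma koch_refine_hd: "\<exists>rest. koch_refine a (q # ps) = q # rest"
  by (cases ps) (auto simp: Let_def)

text \<open>Refining \<open>n\<close> times a list of vertices acts independently on every edge, so the polygonal curves are
  unions of similar copies of one curve.\<close>

lemma polygonal_curve_refine:
  "polygonal_curve ((koch_refine a ^^ n) (p # q # ps)) =
     edge_map p q ` flank_curve a n \<union> polygonal_curve ((koch_refine a ^^ n) (q # ps))"
proof (induction n arbitrary: p q ps)
  case 0
  then show ?case by (simp add: polygonal_curve_Cons edge_map_segment)
next
  case (Suc n)
  obtain rest where r: "koch_refine a (q # ps) = q # rest" using koch_refine_hd by blast
  show ?case
    unfolding funpow_Suc_right o_apply koch_refine_Cons_edge r
    by (simp add: Suc.IH image_Un edge_map_image_image child_defs Un_ac)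
qed

lemma funpow_refine_single: "(koch_refine a ^^ n) [p] = [p]"
  by (induction n) auto

definition tri_top :: complex where "tri_top = tri_pt (1/2) (1/2)"

lemma polygonal_curve_koch_vertices:
  "polygonal_curve (koch_vertices a n) =
     edge_map 0 1 ` flank_curve a n \<union> edge_map 1 tri_top ` flank_curve a n \<union> edge_map tri_top 0 ` flank_curve a n"
  by (simp add: koch_vertices_def polygonal_curve_refine funpow_refine_single polygonal_curve_single
      cis_pi_3 tri_top_def Un_ac)

section \<open>The filled flank of an edge\<close>

text \<open>The equilateral triangle to the left of the reference edge, which also is the initial triangle of
  the construction, and the bump on the right.\<close>

definition tri :: "complex set" where
  "tri = {z. 0 \<le> ht z \<and> ht z \<le> Re z \<and> Re z \<le> 1 - ht z}"

definition bump :: "real \<Rightarrow> complex set" where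
  "bump a = {z. ht z \<le> 0 \<and> (1/2 - a/2) - ht z \<le> Re z \<and> Re z \<le> (1/2 + a/2) + ht z}"

lemma segment_01: "closed_segment 0 (1::complex) = {z. ht z = 0 \<and> 0 \<le> Re z \<and> Re z \<le> 1}"
proof -
  have "z \<in> closed_segment 0 1 \<longleftrightarrow> ht z = 0 \<and> 0 \<le> Re z \<and> Re z \<le> 1" for z :: complex
    unfolding closed_segment_def by (auto simp: complex_eq_ht_iff)
  then show ?thesis by blast
qed

text \<open>The reference edge together with everything that has been erected on it after \<open>n\<close> steps.\<close>

primrec flank :: "real \<Rightarrow> nat \<Rightarrow> complex set" where
  "flank a 0 = closed_segment 0 1"
| "flank a (Suc n) = bump a \<union> child1 a ` flank a n \<union> child2 a ` flank a n
     \<union> child3 a ` flank a n \<union> child4 a ` flank a n"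

lemma compact_convex_tri: "compact tri" "convex tri"
proof -
  have 1: "tri \<subseteq> cball 0 2"
  proof
    fix z assume "z \<in> tri"
    then have "\<bar>Re z\<bar> \<le> 1" "\<bar>ht z\<bar> \<le> 1/2" by (auto simp: tri_def)
    then have "(Re z)\<^sup>2 \<le> 1\<^sup>2" "(ht z)\<^sup>2 \<le> (1/2)\<^sup>2"
      by (metis abs_le_square_iff abs_one abs_numeral abs_divide)+
    then have "(cmod z)\<^sup>2 \<le> 2\<^sup>2" unfolding norm_ht by (simp add: power_divide)
    then have "cmod z \<le> 2" by (rule power2_le_imp_le) simp
    then show "z \<in> cball 0 2" by simp
  qed
  have "closed tri" unfolding tri_def
    by (intro closed_Collect_conj closed_Collect_le continuous_intros)
  with 1 show "compact tri" by (meson bounded_cball bounded_subset compact_eq_bounded_closed)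
  show "convex tri"
    unfolding convex_alt
  proof (intro ballI allI impI)
    fix x y :: complex and u :: real
    assume "x \<in> tri" "y \<in> tri" and u: "0 \<le> u \<and> u \<le> 1"
    then have h: "0 \<le> ht x" "ht x \<le> Re x" "Re x \<le> 1 - ht x" "0 \<le> ht y" "ht y \<le> Re y" "Re y \<le> 1 - ht y"
      by (auto simp: tri_def)
    have "0 \<le> (1 - u) * ht x + u * ht y" using h u by (intro add_nonneg_nonneg mult_nonneg_nonneg) auto
    moreover have "(1 - u) * ht x + u * ht y \<le> (1 - u) * Re x + u * Re y"
      using h u by (intro add_mono mult_left_mono) auto
    moreover have "(1 - u) * Re x + u * Re y \<le> (1-u) * (1 - ht x) + u * (1 - ht y)"
      using h u by (intro add_mono mult_left_mono) auto
    ultimately show "(1 - u) *\<^sub>R x + u *\<^sub>R y \<in> tri"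
      by (simp add: tri_def algebra_simps)
  qed
qed

locale koch_parameter =
  fixes a :: real
  assumes a_pos: "0 < a" and a_le_half: "a \<le> 1 / 2"

locale john_parameter = koch_parameter +
  fixes c :: real
  assumes c_def: "c = max 2 (4 / (3 * (1 - a)))"

context koch_parameter
begin

lemma bump_eq_child2: "bump a = child2 a ` tri"
proof
  show "child2 a ` tri \<subseteq> bump a"
  proof (rule image_subsetI)
    fix z assume "z \<in> tri"
    then have h: "0 \<le> ht z" "ht z \<le> Re z" "Re z \<le> 1 - ht z" by (auto simp: tri_def)
    have "a * ht z \<le> a * Re z" "0 \<le> a * ht z" "a * Re z \<le> a * (1 - ht z)" using h a_pos by auto
    then show "child2 a z \<in> bump a"
      by (simp add: bump_def child_coords field_simps)
  qed
  show "bump a \<subseteq> child2 a ` tri"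
  proof
    fix z assume h: "z \<in> bump a"
    define x where "x = (Re z - (1/2 - a/2) - 3 * ht z) / (2 * a)"
    define y where "y = (Re z - (1/2 - a/2) + ht z) / (2*a)"
    have "child2 a (tri_pt x y) = z"
      using a_pos by (simp add: complex_eq_ht_iff child_coords x_def y_def field_simps)
    moreover have "tri_pt x y \<in> tri"
    proof -
      have h: "ht z \<le> 0" "(1/2 - a/2) - ht z \<le> Re z" "Re z \<le> (1/2 + a/2) + ht z" using h by (auto simp: bump_def)
      have "0 \<le> y" unfolding y_def using h a_pos by simp
      moreover have "y \<le> x" unfolding x_def y_def using h a_pos by (intro divide_right_mono) auto
      moreover have "x + y = (2 * Re z - 1 + a - 2 * ht z) / (2 * a)"
        unfolding x_def y_def add_divide_distrib[symmetric] by (rule arg_cong2[where f="(/)"]) simp_all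
      moreover have "2 * Re z - 1 + a - 2 * ht z \<le> 1 * (2 * a)" using h(3) by (simp add: field_simps)
      ultimately have "x + y \<le> 1" using a_pos by (simp only: pos_divide_le_eq zero_less_mult_iff) simp
      show ?thesis using \<open>x + y \<le> 1\<close> \<open>y \<le> x\<close> \<open>0 \<le> y\<close> by (simp add: tri_def)
    qed
    ultimately show "z \<in> child2 a ` tri" by (metis imageI)
  qed
qed

lemma foot_apex_distinct: "0 \<noteq> foot1 a" "foot1 a \<noteq> apex a" "apex a \<noteq> foot2 a" "foot2 a \<noteq> 1"
  using a_pos a_le_half by (auto simp: complex_eq_ht_iff foot1_def apex_def foot2_def)

lemma compact_convex_bump: "compact (bump a)" "convex (bump a)"
proof -
  have "child2 a ` tri = (\<lambda>z. foot1 a + z) ` ((*) (apex a - foot1 a)) ` tri"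
    by (simp add: child2_def edge_map_def image_image)
  moreover have "compact (child2 a ` tri)" unfolding child2_def edge_map_def
    by (intro compact_continuous_image continuous_intros compact_convex_tri)
  moreover have "convex ((*) (apex a - foot1 a) ` tri)"
    by (intro convex_linear_image compact_convex_tri bounded_linear.linear bounded_linear_mult_right)
  ultimately show "compact (bump a)" "convex (bump a)"
    unfolding bump_eq_child2 by (simp_all add: convex_translation)
qed

end

text \<open>The reflection that exchanges the endpoints of the reference edge. It halves the number of cases:
  it exchanges the first child with the fourth and the second with the third.\<close>

definition flip :: "complex \<Rightarrow> complex" where "flip z = 1 - cnj z"

lemma flip_coords [simp]: "Re (flip z) = 1 - Re z" "ht (flip z) = ht z"
  by (simp_all add: flip_def)

lemma flip_flip [simp]: "flip (flip z) = z" by (simp add: flip_def)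

lemma flip_image_eqI: assumes "\<And>z. z \<in> X \<Longrightarrow> flip z \<in> X" shows "flip ` X = X"
  using assms by (auto intro!: image_eqI[where x = "flip z" for z])

lemma flip_child: "flip (child1 a z) = child4 a (flip z)" "flip (child2 a z) = child3 a (flip z)"
  "flip (child3 a z) = child2 a (flip z)" "flip (child4 a z) = child1 a (flip z)"
  by (simp_all add: complex_eq_ht_iff child_coords algebra_simps)
     (simp_all add: field_simps)

lemma flip_bump: "flip ` bump a = bump a"
proof -
  have "flip z \<in> bump a" if "z \<in> bump a" for z
    using that by (auto simp: bump_def field_simps)
  then show ?thesis by (rule flip_image_eqI)
qed

lemma flip_segment: "flip ` closed_segment 0 1 = closed_segment 0 1"
proof -
  have "flip z \<in> closed_segment 0 1" if "z \<in> closed_segment 0 1" for z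
    using that by (auto simp: segment_01)
  then show ?thesis by (rule flip_image_eqI)
qed

lemma flip_flank: "flip ` flank a n = flank a n"
proof (induction n)
  case 0 then show ?case by (simp add: flip_segment)
next
  case (Suc n)
  have *: "flip ` f ` flank a n = g ` flank a n" if "\<And>z. flip (f z) = g (flip z)" for f g
  proof -
    have "flip ` f ` flank a n = g ` flip ` flank a n" using that by (simp add: image_image)
    then show ?thesis by (simp only: Suc.IH)
  qed
  show ?case
    by (simp add: image_Un flip_bump *[of "child1 a" "child4 a"] *[of "child2 a" "child3 a"]
       *[of "child3 a" "child2 a"] *[of "child4 a" "child1 a"] flip_child Un_ac)
qed

section \<open>The trapezoid that contains a flank\<close>

text \<open>The depths, i.e. the values of \<open>- ht\<close>, at which a flank may meet the slanted legs of its trapezoid.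
  A leg is reached away from its foot only for \<open>a = 1/2\<close>, and then the admissible depths form the intervals
  \<open>[4\<^sup>-\<^sup>k / 8, 4\<^sup>-\<^sup>k / 4)\<close>. Invariance under the factor \<open>1/4\<close> reflects the self-similarity at the foot. That
  the intervals are half open, as their upper ends are approached only in the limit, makes
  them disjoint from their doubles.\<close>

definition contact :: "real \<Rightarrow> real \<Rightarrow> bool" where
  "contact a d \<longleftrightarrow> d = 0 \<or> (a = 1/2 \<and> (\<exists>k. 1/8/4^k \<le> d \<and> d < 1/4/4^k))"

text \<open>The trapezoid on the reference edge with base angles \<open>\<pi>/3\<close> and legs of length \<open>a\<close>, the points of the
  legs being restricted by \<open>contact\<close>.\<close>

definition envelope :: "real \<Rightarrow> complex set" where
  "envelope a = {z. ht z \<le> 0 \<and> - ht z \<le> a / 2 \<and> - ht z \<le> Re z \<and> - ht z \<le> 1 - Re z \<and>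
     (Re z = - ht z \<longrightarrow> contact a (- ht z)) \<and> (1 - Re z = - ht z \<longrightarrow> contact a (- ht z))}"

lemma flip_envelope: "flip z \<in> envelope a \<longleftrightarrow> z \<in> envelope a"
  by (auto simp: envelope_def)

lemma contact_0: "contact a 0" by (simp add: contact_def)

lemma contact_quarter: "contact a d \<Longrightarrow> contact a ((1/2 - a/2) * d)"
proof (cases "d = 0")
  case False
  assume "contact a d"
  with False obtain k where k: "a = 1/2" "1/8/4^k \<le> d" "d < 1/4/4^k" by (auto simp: contact_def)
  have "1/8/4^Suc k \<le> (1/2 - a/2) * d" "(1/2 - a/2) * d < 1/4/4^Suc k" using k
    by (simp_all add: k(1) del: divide_divide_eq_left) (simp_all add: field_simps)
  then show ?thesis using k unfolding contact_def by blast
qed (simp add: contact_0)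

lemma not_contact_quarter: "\<not> contact a (1/4)"
proof
  assume "contact a (1/4)"
  then obtain k where "(1/4::real) < 1/4/4^k" by (auto simp: contact_def)
  then have "(4::real)^k < 1" by (simp add: field_simps)
  moreover have "(1::real) \<le> 4^k" by simp
  ultimately show False by linarith
qed

text \<open>On the two sides of the line that bisects the angle between the first and the second child, the
  admissible depths are, in a common unit, a set and its double. Hence the children do not touch.\<close>

lemma not_contact_double: assumes "contact a d" "contact a (2 * d)" shows "d = 0"
proof (rule ccontr)
  assume "d \<noteq> 0"
  then obtain j k where j: "1/8/4^j \<le> d" "d < 1/4/4^j" and k: "1/8/4^k \<le> 2*d" "2*d < 1/4/(4::real)^k"
    using assms by (auto simp: contact_def)
  show False
  proof (cases "j \<le> k")
    case True
    then have "(4::real)^j \<le> 4^k" by simp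
    then have "(1::real)/4/4^k \<le> 1/4/4^j" by (intro divide_left_mono) auto
    moreover have "2 * (1/8/4^j) = (1::real)/4/4^j" by simp
    ultimately show False using j k by linarith
  next
    case False
    then have "(4::real)^Suc k \<le> 4^j" by (intro power_increasing) auto
    then have "(1::real)/4/4^j \<le> 1/4/4^Suc k" by (intro divide_left_mono) auto
    also have "\<dots> = 1/16/4^k" by simp
    finally have "2 * d < 1/8/4^k" using j by simp
    then show False using k by simp
  qed
qed

context koch_parameter
begin

text \<open>The condition \<open>2 a\<^sup>2 + a \<le> 1\<close>, i.e. \<open>a \<le> 1/2\<close>, says that the trapezoid on a side of the bump does
  not leave the trapezoid on the whole edge.\<close>

lemma a_sq: "2 * a * a \<le> 1 - a" "2 * a * a = 1 - a \<Longrightarrow> a = 1 / 2"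
proof -
  have "(1 - 2 * a) * (1 + a) \<ge> 0" using a_pos a_le_half by simp
  then show "2 * a * a \<le> 1 - a" by (simp add: algebra_simps)
  assume "2 * a * a = 1 - a"
  then have "(1 - 2 * a) * (1 + a) = 0" by (simp add: algebra_simps)
  then show "a = 1/2" using a_pos by auto
qed

lemma child1_envelope: "z \<in> envelope a \<Longrightarrow> child1 a z \<in> envelope a"
proof -
  assume z: "z \<in> envelope a"
  define l where "l = (1/2 - a/2)"
  have l: "0 < l" "l < 1/2" using a_pos a_le_half by (auto simp: l_def)
  have h: "ht z \<le> 0" "- ht z \<le> a / 2" "- ht z \<le> Re z" "- ht z \<le> 1 - Re z"
     "Re z = - ht z \<Longrightarrow> contact a (- ht z)" using z by (auto simp: envelope_def)
  have 1: "l * ht z \<le> 0" using h l by (simp add: mult_nonneg_nonpos)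
  have "l * - ht z \<le> 1 * (a/2)" using h l a_pos by (intro mult_mono) auto
  moreover have "l * - ht z \<le> l * Re z" using h l by (intro mult_left_mono) auto
  moreover have "l * - ht z \<le> l * (1 - Re z)" using h(4) l by (intro mult_left_mono) auto
  then have "- (l * ht z) < 1 - l * Re z" using l by (simp add: algebra_simps)
  moreover have "contact a (- (l * ht z))" if "l * Re z = - (l * ht z)"
  proof -
    have "l * (Re z + ht z) = 0" using that by (simp add: algebra_simps)
    then have "Re z = - ht z" using l by simp
    from contact_quarter[OF h(5)[OF this]] show ?thesis by (simp add: l_def)
  qed
  ultimately show ?thesis using 1 unfolding envelope_def mem_Collect_eq child_coords l_def[symmetric]
    by auto
qed

text \<open>The trapezoid on a side of the bump reaches a leg of the large trapezoid only for \<open>a = 1/2\<close>, with its top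
  side; the far corner of this top side, at depth \<open>1/4\<close>, would have to be a
  contact point itself.\<close>

lemma child2_envelope: "z \<in> envelope a \<Longrightarrow> child2 a z \<in> envelope a"
proof -
  assume z: "z \<in> envelope a"
  define x d where "x = Re z" and "d = - ht z"
  have h: "0 \<le> d" "d \<le> a / 2" "d \<le> x" "d \<le> 1 - x"
     "x = d \<Longrightarrow> contact a d" "1 - x = d \<Longrightarrow> contact a d" using z by (auto simp: envelope_def x_def d_def)
  define X D where "X = (1/2 - a/2) + a * (x - 3 * d) / 2" and "D = a * (d + x) / 2"
  have XD: "Re (child2 a z) = X" "ht (child2 a z) = - D"
    by (simp_all add: child_coords X_def D_def x_def d_def field_simps)
  have "0 \<le> D" using h a_pos by (simp add: D_def)
  moreover have "D \<le> a / 2" using h a_pos by (simp add: D_def)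
  moreover have XmD: "X - D = (1/2 - a/2) - 2 * a * d" by (simp add: X_def D_def field_simps)
  have ad: "a * d \<le> a * (a / 2)" using h a_pos by (intro mult_left_mono) auto
  then have "D \<le> X" using XmD a_sq(1) by simp
  moreover have "D < 1 - X"
  proof -
    have "X + D = (1/2 - a/2) + a * (x - d)" by (simp add: X_def D_def field_simps)
    also have "\<dots> \<le> (1/2 - a/2) + a * 1" using h a_pos by (intro add_left_mono mult_left_mono) auto
    finally show ?thesis using a_le_half by simp
  qed
  moreover have "contact a D" if eq: "X = D"
  proof -
    have e: "2 * a * d = (1/2 - a/2)" using XmD eq by simp
    then have "2 * a * a = 1 - a" using ad a_sq(1) by simp
    then have a: "a = 1/2" by (rule a_sq(2))
    with e have d: "d = 1/4" by simp
    then have x: "1/4 \<le> x" "x \<noteq> 3/4" "x \<le> 3/4" using h not_contact_quarter[of a] unfolding d by auto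
    have "1/8/4^0 \<le> D \<and> D < 1/4/4^(0::nat)" using x by (simp add: D_def a d)
    then show ?thesis using a unfolding contact_def by blast
  qed
  ultimately show ?thesis unfolding envelope_def mem_Collect_eq XD by auto
qed

lemma child_envelope:
  assumes "z \<in> envelope a"
  shows "child1 a z \<in> envelope a" "child2 a z \<in> envelope a" "child3 a z \<in> envelope a" "child4 a z \<in> envelope a"
proof -
  have "flip z \<in> envelope a" using assms by (simp add: flip_envelope)
  then have "flip (child3 a z) \<in> envelope a" "flip (child4 a z) \<in> envelope a"
    unfolding flip_child by (simp_all add: child1_envelope child2_envelope)
  with assms show "child1 a z \<in> envelope a" "child2 a z \<in> envelope a" "child3 a z \<in> envelope a" "child4 a z \<in> envelope a"
    by (simp_all only: flip_envelope child1_envelope child2_envelope)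
qed

lemma bump_envelope: "bump a \<subseteq> envelope a"
  using a_pos a_le_half by (auto simp: bump_def envelope_def)

lemma segment_envelope: "closed_segment 0 1 \<subseteq> envelope a"
  using a_pos by (auto simp: segment_01 envelope_def contact_0)

lemma flank_envelope: "flank a n \<subseteq> envelope a"
proof (induction n)
  case (Suc n)
  then show ?case using bump_envelope child_envelope by auto
qed (simp add: segment_envelope)

lemma zero_one_flank_curve: "0 \<in> flank_curve a n" "1 \<in> flank_curve a n"
proof (induction n)
  case (Suc n)
  have "0 = child1 a 0" "1 = child4 a 1" by (simp_all add: child_defs)
  then show "0 \<in> flank_curve a (Suc n)" "1 \<in> flank_curve a (Suc n)"
    unfolding flank_curve.simps using Suc by blast+
qed auto

lemma flank_curve_subset: "flank_curve a n \<subseteq> flank a n"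
  by (induction n) auto

lemma segment_subset_flank: "closed_segment 0 1 \<subseteq> flank a n"
proof (induction n)
  case (Suc n)
  show ?case
  proof
    fix z :: complex assume "z \<in> closed_segment 0 1"
    then have z: "ht z = 0" "0 \<le> Re z" "Re z \<le> 1" by (auto simp: segment_01)
    have c1: "z \<in> child1 a ` closed_segment 0 1" if "Re z \<le> (1/2 - a/2)"
    proof -
      have "z = child1 a (tri_pt (Re z / ((1/2 - a/2))) 0)" using z a_le_half by (simp add: complex_eq_ht_iff child_coords)
      moreover have "tri_pt (Re z / ((1/2 - a/2))) 0 \<in> closed_segment 0 1" using z that a_le_half by (simp add: segment_01)
      ultimately show ?thesis by blast
    qed
    have c4: "z \<in> child4 a ` closed_segment 0 1" if "(1/2 + a/2) \<le> Re z"
    proof -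
      have "z = child4 a (tri_pt ((Re z - (1/2 + a/2)) / ((1/2 - a/2))) 0)" using z a_le_half by (simp add: complex_eq_ht_iff child_coords)
      moreover have "tri_pt ((Re z - (1/2 + a/2)) / ((1/2 - a/2))) 0 \<in> closed_segment 0 1"
        using z that a_le_half by (simp add: segment_01 divide_le_eq)
      ultimately show ?thesis by blast
    qed
    have "z \<in> bump a" if "(1/2 - a/2) \<le> Re z" "Re z \<le> (1/2 + a/2)" using that z by (simp add: bump_def)
    moreover have "child1 a ` closed_segment 0 1 \<subseteq> flank a (Suc n)" "child4 a ` closed_segment 0 1 \<subseteq> flank a (Suc n)"
      "bump a \<subseteq> flank a (Suc n)" using Suc by auto
    ultimately show "z \<in> flank a (Suc n)" using c1 c4 by (meson linear subsetD)
  qed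
qed simp

lemma flank_mono_Suc: "flank a n \<subseteq> flank a (Suc n)"
proof (induction n)
  case 0
  show ?case using segment_subset_flank[of "Suc 0"] by simp
next
  case (Suc n)
  have "bump a \<union> child1 a ` X \<union> child2 a ` X \<union> child3 a ` X \<union> child4 a ` X
      \<subseteq> bump a \<union> child1 a ` Y \<union> child2 a ` Y \<union> child3 a ` Y \<union> child4 a ` Y" if "X \<subseteq> Y" for X Y
    using that by (intro Un_mono image_mono order_refl)
  from this[OF Suc] show ?case by (simp only: flank.simps(2)[symmetric])
qed

lemma flank_mono: "m \<le> n \<Longrightarrow> flank a m \<subseteq> flank a n"
  using lift_Suc_mono_le[of "flank a"] flank_mono_Suc by blast

lemma compact_flank: "compact (flank a n)"
  by (induction n) (auto intro!: compact_Un compact_continuous_image continuous_intros compact_convex_bump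
     simp: child_defs edge_map_def)

section \<open>Intersections of the pieces of a flank\<close>

lemma child1_side: "z \<in> child1 a ` envelope a \<Longrightarrow> ht z \<le> 0 \<and> Re z - ht z \<le> (1/2 - a/2)"
proof -
  assume "z \<in> child1 a ` envelope a"
  then obtain y where y: "z = child1 a y" "y \<in> envelope a" by auto
  then have "ht y \<le> 0" "Re y - ht y \<le> 1" by (auto simp: envelope_def)
  then have "(1/2 - a/2) * ht y \<le> 0" "(1/2 - a/2) * (Re y - ht y) \<le> (1/2 - a/2) * 1" using a_le_half
    by (auto intro!: mult_left_mono simp: mult_le_0_iff)
  then show ?thesis by (simp add: y child_coords right_diff_distrib)
qed

lemma child2_side: "z \<in> child2 a ` envelope a \<Longrightarrow> ht z \<le> 0 \<and> (1/2 - a/2) \<le> Re z - ht z \<and> Re z + ht z \<le> (1/2 - a/2)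
   \<and> Re z \<le> 1 / 2 \<and> (Re z = 1 / 2 \<longrightarrow> z = apex a) \<and>  (Re z + ht z = (1/2 - a/2) \<longrightarrow> z \<in> child2 a ` closed_segment 0 1)"
proof -
  assume "z \<in> child2 a ` envelope a"
  then obtain y where y: "z = child2 a y" "y \<in> envelope a" by auto
  then have h: "ht y \<le> 0" "- ht y \<le> Re y" "Re y - ht y \<le> 1" by (auto simp: envelope_def)
  have 1: "0 \<le> a * (Re y + ht y)" "a * ht y \<le> 0" "a * (ht y - Re y) \<le> 0" using h a_pos by (auto simp: mult_le_0_iff)
  have 2: "a * (Re y + 3 * ht y) \<le> a * 1" using h a_pos by (intro mult_left_mono) auto
  have 3: "z = apex a" if "Re z = 1 / 2"
  proof -
    have "a * (Re y + 3 * ht y) = a * 1" using that by (simp add: y child_coords field_simps)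
    then have "Re y + 3 * ht y = 1" using a_pos by simp
    then have "ht y = 0" "Re y = 1" using h by auto
    then show ?thesis using a_pos by (simp add: y complex_eq_ht_iff child_coords apex_def field_simps)
  qed
  have 4: "z \<in> child2 a ` closed_segment 0 1" if "Re z + ht z = (1/2 - a/2)"
  proof -
    have "2 * a * ht y = 0" using that by (simp add: y child_coords field_simps)
    then have "ht y = 0" using a_pos by simp
    then have "y \<in> closed_segment 0 1" using h by (simp add: segment_01)
    then show ?thesis by (simp add: y)
  qed
  show ?thesis using 1 2 3 4 by (simp add: y child_coords field_simps)
qed

text \<open>The two children lie on different sides of the line that bisects the angle at their common vertex, so
  that a common point lies on a leg of either trapezoid.\<close>

lemma child12_Int: assumes "z \<in> child1 a ` envelope a" "z \<in> child2 a ` envelope a" shows "z = foot1 a"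
proof -
  obtain y where y: "z = child1 a y" "y \<in> envelope a" using assms(1) by auto
  obtain w where w: "z = child2 a w" "w \<in> envelope a" using assms(2) by auto
  have z: "Re z - ht z = (1/2 - a/2)" using child1_side[OF assms(1)] child2_side[OF assms(2)] by simp
  have "(1 - a) * (1 - Re y + ht y) = 0" using z by (simp add: y child_coords field_simps)
  then have e1: "1 - Re y = - ht y" using a_le_half by auto
  then have c1: "contact a (- ht y)" using y by (auto simp: envelope_def)
  have "2 * a * (Re w + ht w) = 0" using z by (simp add: w child_coords field_simps)
  then have e2: "Re w = - ht w" using a_pos by auto
  then have c2: "contact a (- ht w)" using w by (auto simp: envelope_def)
  have "(1/2 - a/2) * ht y = a * (ht w - Re w) / 2" using y(1) w(1) by (metis child_coords(2) child_coords(4))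
  then have e3: "(1 - a) * ht y = 2 * a * ht w" using e2 by (simp add: field_simps)
  have "ht y = 0"
  proof (cases "a = 1/2")
    case True
    then have "- ht y = 2 * (- ht w)" using e3 unfolding True by simp
    then have "- ht w = 0" using not_contact_double[of a "- ht w"] c1 c2 by simp
    then show ?thesis using e3 a_le_half by simp
  next
    case False
    then show ?thesis using c1 by (simp add: contact_def)
  qed
  then show ?thesis using e1 by (simp add: y complex_eq_ht_iff child_coords foot1_def)
qed

end

section \<open>Filling polygons\<close>

text \<open>Janiszewski's theorem, in the form in which it is iterated below.\<close>

lemma connected_Compl_Un:
  fixes A B :: "complex set"
  assumes "compact A" "compact B" "connected (- A)" "connected (- B)" "connected (A \<inter> B)"
  shows "connected (- (A \<union> B))"
proof -
  have "connected_component (- (A \<union> B)) x y" if "x \<in> - (A \<union> B)" "y \<in> - (A \<union> B)" for x y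
    using assms that
    by (intro Janiszewski) (auto simp: connected_iff_connected_component compact_imp_closed)
  then show ?thesis by (simp add: connected_iff_connected_component)
qed

text \<open>The conditions say that \<open>R\<close> is bounded by a part of the curve and has no holes. The complement of \<open>R\<close> is
  unbounded and connected, so it belongs to the outer component of the complement of the curve;
  conversely a component of that complement which meets \<open>R\<close> cannot leave \<open>R\<close>.\<close>

lemma filled_polygon_eq:
  fixes R :: "complex set"
  assumes "compact R" "connected (- R)" "polygonal_curve ps \<subseteq> R" "R - polygonal_curve ps \<subseteq> interior R"
  shows "filled_polygon ps = R"
proof -
  define \<Gamma> where "\<Gamma> = polygonal_curve ps"
  have G: "\<Gamma> \<subseteq> R" "R - \<Gamma> \<subseteq> interior R" using assms by (auto simp: \<Gamma>_def)
  have "inside \<Gamma> \<subseteq> R"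
  proof
    fix z assume z: "z \<in> inside \<Gamma>"
    show "z \<in> R"
    proof (rule ccontr)
      assume "z \<notin> R"
      then have "- R \<subseteq> connected_component_set (- \<Gamma>) z"
        using assms(2) G(1) by (intro connected_component_maximal) auto
      moreover have "bounded (connected_component_set (- \<Gamma>) z)" using z by (simp add: inside_def)
      ultimately have "bounded (- R)" by (rule bounded_subset[rotated])
      moreover have "bounded R" using assms(1) by (rule compact_imp_bounded)
      ultimately have "bounded (UNIV :: complex set)" by (metis Compl_partition bounded_Un)
      then show False by simp
    qed
  qed
  moreover have "R - \<Gamma> \<subseteq> inside \<Gamma>"
  proof
    fix z assume z: "z \<in> R - \<Gamma>"
    let ?C = "connected_component_set (- \<Gamma>) z"
    have "?C \<subseteq> R"
    proof (rule ccontr)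
      assume "\<not> ?C \<subseteq> R"
      moreover have "z \<in> ?C" using z by simp
      ultimately have "?C \<inter> frontier R \<noteq> {}"
        using z by (intro connected_Int_frontier connected_connected_component) blast+
      moreover have "?C \<subseteq> - \<Gamma>" by (rule connected_component_subset)
      moreover have "frontier R \<subseteq> \<Gamma>"
        using G(2) assms(1) by (auto simp: frontier_def compact_imp_closed)
      ultimately show False by blast
    qed
    then have "bounded ?C" using assms(1) bounded_subset compact_imp_bounded by blast
    then show "z \<in> inside \<Gamma>" using z by (simp add: inside_def)
  qed
  ultimately show ?thesis using G(1) unfolding filled_polygon_def \<Gamma>_def by blast
qed

lemma Un2_Int_eqI:
  assumes "S \<subseteq> D" "S \<subseteq> A" "\<And>z. z \<in> D \<Longrightarrow> z \<in> A \<Longrightarrow> z \<in> S" "\<And>z. z \<in> D1 \<Longrightarrow> z \<in> A \<Longrightarrow> z \<in> S"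
  shows "(D \<union> D1) \<inter> A = S"
  using assms by blast

lemma Un3_Int_eqI:
  assumes "S \<subseteq> D" "S \<subseteq> A" "\<And>z. z \<in> D \<Longrightarrow> z \<in> A \<Longrightarrow> z \<in> S" "\<And>z. z \<in> D1 \<Longrightarrow> z \<in> A \<Longrightarrow> z \<in> S"
    "\<And>z. z \<in> D2 \<Longrightarrow> z \<in> A \<Longrightarrow> z \<in> S"
  shows "(D \<union> D1 \<union> D2) \<inter> A = S"
  using assms by blast

lemma bij_edge_map: "p \<noteq> q \<Longrightarrow> bij (edge_map p q)"
  by (rule bijI') (auto simp: edge_map_def, metis edge_map_def edge_map_inverse(1))

lemma continuous_on_edge_map [continuous_intros]: "continuous_on S (edge_map p q)"
  unfolding edge_map_def by (intro continuous_intros)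

lemma connected_Compl_edge_map:
  assumes "p \<noteq> q" "connected (- A)" shows "connected (- edge_map p q ` A)"
  using assms by (simp add: bij_edge_map bij_image_Compl_eq[symmetric] connected_continuous_image continuous_on_edge_map)

lemma interior_edge_map:
  assumes "p \<noteq> q" "y \<in> interior A" "edge_map p q ` A \<subseteq> B" shows "edge_map p q y \<in> interior B"
proof -
  have "open (edge_map p q ` interior A)"
    using homeomorphism_imp_open_map[OF homeo_edge_map[OF assms(1)], of "interior A"] by simp
  moreover have "edge_map p q ` interior A \<subseteq> B" using assms(3) interior_subset by blast
  ultimately show ?thesis using assms(2) by (meson image_eqI interiorI)
qed

lemma mem_flip_image: "z \<in> flip ` X \<longleftrightarrow> flip z \<in> X"
  by (auto intro: image_eqI[where x = "flip z"])

lemma flip_tri: "flip ` tri = tri"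
  by (rule flip_image_eqI) (auto simp: tri_def)

lemma interior_tri: "0 < ht z \<Longrightarrow> ht z < Re z \<Longrightarrow> Re z < 1 - ht z \<Longrightarrow> z \<in> interior tri"
proof -
  assume "0 < ht z" "ht z < Re z" "Re z < 1 - ht z"
  moreover have "open {z. 0 < ht z \<and> ht z < Re z \<and> Re z < 1 - ht z}"
    by (intro open_Collect_conj open_Collect_less continuous_intros)
  moreover have "{z. 0 < ht z \<and> ht z < Re z \<and> Re z < 1 - ht z} \<subseteq> tri" by (auto simp: tri_def)
  ultimately show ?thesis by (intro interiorI[of "{z. 0 < ht z \<and> ht z < Re z \<and> Re z < 1 - ht z}"]) auto
qed

context koch_parameter
begin

lemma child34_flip:
  assumes "flip ` X = X"
  shows "child3 a ` X = flip ` child2 a ` X" "child4 a ` X = flip ` child1 a ` X"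
proof -
  have "flip ` child2 a ` X = child3 a ` flip ` X" "flip ` child1 a ` X = child4 a ` flip ` X"
    unfolding image_image flip_child by (rule refl)+
  then show "child3 a ` X = flip ` child2 a ` X" "child4 a ` X = flip ` child1 a ` X" unfolding assms by simp_all
qed

lemma bump_eq_child3: "bump a = child3 a ` tri"
proof -
  have "child3 a ` tri = flip ` bump a" unfolding child34_flip(1)[OF flip_tri] bump_eq_child2 ..
  then show ?thesis by (simp only: flip_bump)
qed

lemma flip_envelope_image: "flip ` envelope a = envelope a"
  by (rule flip_image_eqI) (simp add: flip_envelope)

lemma flip_apex: "flip (apex a) = apex a" "flip (foot1 a) = foot2 a" "flip (foot2 a) = foot1 a"
  by (simp_all add: complex_eq_ht_iff apex_def foot1_def foot2_def)

lemma child4_side: "z \<in> child4 a ` envelope a \<Longrightarrow> ht z \<le> 0 \<and> 1 - Re z - ht z \<le> (1/2 - a/2)"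
  using child1_side[of "flip z"] unfolding child34_flip[OF flip_envelope_image] mem_flip_image by simp

lemma child3_side: "z \<in> child3 a ` envelope a \<Longrightarrow> ht z \<le> 0 \<and> 1/2 - a/2 \<le> 1 - Re z - ht z \<and> 1 - Re z + ht z \<le> 1/2 - a/2
   \<and> 1 / 2 \<le> Re z \<and> (Re z = 1 / 2 \<longrightarrow> z = apex a) \<and>  (1 - Re z + ht z = 1/2 - a/2 \<longrightarrow> z \<in> child3 a ` closed_segment 0 1)"
proof -
  assume "z \<in> child3 a ` envelope a"
  then have "flip z \<in> child2 a ` envelope a" unfolding child34_flip[OF flip_envelope_image] mem_flip_image .
  note h = child2_side[OF this, unfolded flip_coords]
  have "z = apex a" if "Re z = 1 / 2"
  proof -
    have "flip z = apex a" using h that by linarith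
    from arg_cong[OF this, of flip] show ?thesis by (simp add: flip_apex)
  qed
  moreover have "z \<in> child3 a ` closed_segment 0 1" if "1 - Re z + ht z = 1/2 - a/2"
  proof -
    have "flip z \<in> child2 a ` closed_segment 0 1" using h that by blast
    then show ?thesis unfolding child34_flip[OF flip_segment] mem_flip_image .
  qed
  moreover have "1 / 2 \<le> Re z" using h by linarith
  ultimately show ?thesis using h by blast
qed

lemma child34_Int: assumes "z \<in> child3 a ` envelope a" "z \<in> child4 a ` envelope a" shows "z = foot2 a"
proof -
  have "flip z \<in> child1 a ` envelope a" "flip z \<in> child2 a ` envelope a"
    using assms unfolding child34_flip[OF flip_envelope_image] mem_flip_image by blast+
  from arg_cong[OF child12_Int[OF this], of flip] show ?thesis by (simp add: flip_apex)
qed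

lemma child_env_subset: "child1 a ` flank a n \<subseteq> child1 a ` envelope a" "child2 a ` flank a n \<subseteq> child2 a ` envelope a"
   "child3 a ` flank a n \<subseteq> child3 a ` envelope a" "child4 a ` flank a n \<subseteq> child4 a ` envelope a"
  using flank_envelope by (auto intro: image_mono)

lemma zero_one_flank: "0 \<in> flank a n" "1 \<in> flank a n"
  using segment_subset_flank[of n] by auto

lemma segment_subset_tri: "closed_segment 0 1 \<subseteq> tri" by (auto simp: segment_01 tri_def)

lemma child_segment_bump: "child2 a ` closed_segment 0 1 \<subseteq> bump a" "child3 a ` closed_segment 0 1 \<subseteq> bump a"
proof -
  show "child2 a ` closed_segment 0 1 \<subseteq> bump a"
    unfolding bump_eq_child2 by (intro image_mono segment_subset_tri)
  show "child3 a ` closed_segment 0 1 \<subseteq> bump a"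
    unfolding bump_eq_child3 by (intro image_mono segment_subset_tri)
qed

lemma connected_segment_image: "connected (child2 a ` closed_segment 0 1)" "connected (child3 a ` closed_segment 0 1)"
  unfolding child_defs edge_map_segment by auto

lemma foot_mem: "foot1 a \<in> bump a" "foot1 a \<in> child1 a ` flank a n" "foot1 a \<in> child2 a ` closed_segment 0 1"
   "apex a \<in> child3 a ` closed_segment 0 1" "foot2 a \<in> bump a" "foot2 a \<in> child3 a ` flank a n"  "foot2 a \<in> child4 a ` flank a n"
proof -
  show "foot1 a \<in> bump a" "foot2 a \<in> bump a" using a_pos by (auto simp: foot1_def foot2_def bump_def)
  have *: "child1 a 1 = foot1 a" "child2 a 0 = foot1 a" "child3 a 0 = apex a" "child3 a 1 = foot2 a" "child4 a 0 = foot2 a"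
    by (simp_all add: child_defs)
  show "foot1 a \<in> child1 a ` flank a n" using *(1) zero_one_flank by (metis imageI)
  show "foot2 a \<in> child3 a ` flank a n" using *(4) zero_one_flank by (metis imageI)
  show "foot2 a \<in> child4 a ` flank a n" using *(5) zero_one_flank by (metis imageI)
  show "foot1 a \<in> child2 a ` closed_segment 0 1" using *(2) ends_in_segment(1) by (metis imageI)
  show "apex a \<in> child3 a ` closed_segment 0 1" using *(3) ends_in_segment(1) by (metis imageI)
qed

text \<open>The bump and the flanks of the four children are added one by one; what is new meets what was there
  in a vertex or in a side of the bump.\<close>

lemma connected_Compl_flank: "connected (- flank a n)"
proof (induction n)
  case 0
  show ?case by (simp add: connected_complement_bounded_convex bounded_closed_segment)
next
  case (Suc n)
  let ?D = "bump a" and ?A1 = "child1 a ` flank a n" and ?A2 = "child2 a ` flank a n"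
    and ?A3 = "child3 a ` flank a n" and ?A4 = "child4 a ` flank a n"
  note fad = foot_apex_distinct
  have con: "connected (- ?A1)" "connected (- ?A2)" "connected (- ?A3)" "connected (- ?A4)"
    using Suc fad by (simp_all add: child_defs connected_Compl_edge_map)
  have com: "compact ?A1" "compact ?A2" "compact ?A3" "compact ?A4" "compact ?D"
    using compact_flank[of n] compact_convex_bump unfolding child_defs
    by (auto intro!: compact_continuous_image continuous_on_edge_map)
  have D: "connected (- ?D)"
    using compact_convex_bump by (intro connected_complement_bounded_convex compact_imp_bounded) auto
  have i1: "?D \<inter> ?A1 = {foot1 a}"
  proof -
    have "z = foot1 a" if "z \<in> ?D" "z \<in> ?A1" for z
      using child1_side[of z] that child_env_subset[of n]
      by (auto simp: bump_def complex_eq_ht_iff foot1_def)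
    then show ?thesis using foot_mem by blast
  qed
  have seg: "child2 a ` closed_segment 0 1 \<subseteq> ?A2" "child3 a ` closed_segment 0 1 \<subseteq> ?A3"
    using segment_subset_flank by (auto intro: image_mono)
  have i2: "(?D \<union> ?A1) \<inter> ?A2 = child2 a ` closed_segment 0 1"
  proof -
    have 1: "z \<in> child2 a ` closed_segment 0 1" if "z \<in> ?D" "z \<in> ?A2" for z
      using child2_side[of z] that child_env_subset[of n] by (auto simp: bump_def)
    have 2: "z = foot1 a" if "z \<in> ?A1" "z \<in> ?A2" for z
      using child12_Int that child_env_subset[of n] by blast
    show ?thesis
    proof (rule Un2_Int_eqI[OF child_segment_bump(1) seg(1)])
      show "z \<in> child2 a ` closed_segment 0 1" if "z \<in> ?A1" "z \<in> ?A2" for z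
        using 2[OF that] foot_mem(3) by simp
    qed (rule 1)
  qed
  have i3: "(?D \<union> ?A1 \<union> ?A2) \<inter> ?A3 = child3 a ` closed_segment 0 1"
  proof -
    have 1: "z \<in> child3 a ` closed_segment 0 1" if "z \<in> ?D" "z \<in> ?A3" for z
      using child3_side[of z] that child_env_subset[of n] by (auto simp: bump_def)
    have 2: False if "z \<in> ?A1" "z \<in> ?A3" for z
    proof -
      have "z \<in> child1 a ` envelope a" "z \<in> child3 a ` envelope a" using that child_env_subset[of n] by auto
      with child3_side[of z] child1_side[of z] a_pos show False by auto
    qed
    have 3: "z = apex a" if "z \<in> ?A2" "z \<in> ?A3" for z
    proof -
      have "z \<in> child2 a ` envelope a" "z \<in> child3 a ` envelope a" using that child_env_subset[of n] by auto
      with child3_side[of z] child2_side[of z] a_pos show ?thesis by auto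
    qed
    show ?thesis
    proof (rule Un3_Int_eqI[OF child_segment_bump(2) seg(2)])
      show "z \<in> child3 a ` closed_segment 0 1" if "z \<in> ?A1" "z \<in> ?A3" for z
        using 2[OF that] by simp
      show "z \<in> child3 a ` closed_segment 0 1" if "z \<in> ?A2" "z \<in> ?A3" for z
        using 3[OF that] foot_mem(4) by simp
    qed (rule 1)
  qed
  have i4: "(?D \<union> ?A1 \<union> ?A2 \<union> ?A3) \<inter> ?A4 = {foot2 a}"
  proof -
    have 1: "z = foot2 a" if "z \<in> ?D" "z \<in> ?A4" for z
      using child4_side[of z] that child_env_subset[of n]
      by (auto simp: bump_def complex_eq_ht_iff foot2_def)
    have 2: False if "z \<in> ?A1" "z \<in> ?A4" for z
    proof -
      have "z \<in> child1 a ` envelope a" "z \<in> child4 a ` envelope a" using that child_env_subset[of n] by auto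
      with child4_side[of z] child1_side[of z] a_pos show False by auto
    qed
    have 3: False if "z \<in> ?A2" "z \<in> ?A4" for z
    proof -
      have "z \<in> child2 a ` envelope a" "z \<in> child4 a ` envelope a" using that child_env_subset[of n] by auto
      with child4_side[of z] child2_side[of z] a_pos show False by auto
    qed
    have 4: "z = foot2 a" if "z \<in> ?A3" "z \<in> ?A4" for z
      using child34_Int that child_env_subset[of n] by blast
    show ?thesis
    proof (intro subset_antisym subsetI)
      fix z assume "z \<in> (?D \<union> ?A1 \<union> ?A2 \<union> ?A3) \<inter> ?A4"
      then have "z \<in> ?A4" "z \<in> ?D \<or> z \<in> ?A1 \<or> z \<in> ?A2 \<or> z \<in> ?A3" by simp_all
      then have "z = foot2 a" using 1 2 3 4 by metis
      then show "z \<in> {foot2 a}" by simp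
    qed (use foot_mem in simp)
  qed
  have "connected (- (?D \<union> ?A1))"
    by (rule connected_Compl_Un) (simp_all only: com con D i1 connected_sing)
  then have "connected (- (?D \<union> ?A1 \<union> ?A2))"
    by (rule connected_Compl_Un[rotated 2]) (simp_all only: compact_Un com con i2 connected_segment_image)
  then have "connected (- (?D \<union> ?A1 \<union> ?A2 \<union> ?A3))"
    by (rule connected_Compl_Un[rotated 2]) (simp_all only: compact_Un com con i3 connected_segment_image)
  then have "connected (- (?D \<union> ?A1 \<union> ?A2 \<union> ?A3 \<union> ?A4))"
    by (rule connected_Compl_Un[rotated 2]) (simp_all only: compact_Un com con i4 connected_sing)
  then show ?case by simp
qed

text \<open>The base of a bump becomes interior, since the triangle on its other side belongs to the region as well.\<close>

lemma interior_rhomb: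
  assumes "z \<in> bump a" "1/2 - a/2 < Re z + ht z" "Re z < 1/2 + a/2 + ht z"
  shows "z \<in> interior (tri \<union> bump a)"
proof -
  let ?U = "{z. 1/2 - a/2 < Re z + ht z \<and> Re z < 1/2 + a/2 + ht z \<and> ht z < Re z \<and> Re z < 1 - ht z}"
  have "open ?U" by (intro open_Collect_conj open_Collect_less continuous_intros)
  moreover have "?U \<subseteq> tri \<union> bump a" by (auto simp: tri_def bump_def)
  moreover have "z \<in> ?U" using assms a_pos a_le_half by (auto simp: bump_def)
  ultimately show ?thesis by (intro interiorI)
qed

lemma child2_segment: "z \<in> bump a \<Longrightarrow> Re z + ht z = 1/2 - a/2 \<Longrightarrow> z \<in> child2 a ` closed_segment 0 1"
proof -
  assume z: "z \<in> bump a" "Re z + ht z = 1/2 - a/2"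
  obtain y where y: "z = child2 a y" "y \<in> tri" using z(1) bump_eq_child2 by auto
  have "2 * a * ht y = 0" using z(2) by (simp add: y child_coords field_simps)
  then have "ht y = 0" using a_pos by simp
  then have "y \<in> closed_segment 0 1" using y(2) by (simp add: segment_01 tri_def)
  then show ?thesis by (simp add: y)
qed

lemma child3_segment: "z \<in> bump a \<Longrightarrow> Re z = 1/2 + a/2 + ht z \<Longrightarrow> z \<in> child3 a ` closed_segment 0 1"
proof -
  assume z: "z \<in> bump a" "Re z = 1/2 + a/2 + ht z"
  then have "flip z \<in> bump a" using flip_bump by blast
  then have "flip z \<in> child2 a ` closed_segment 0 1" using z by (intro child2_segment) auto
  then show ?thesis unfolding child34_flip[OF flip_segment] mem_flip_image .
qed

lemma child_tri: "child1 a ` tri \<subseteq> tri" "child4 a ` tri \<subseteq> tri"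
proof -
  have "child1 a z \<in> tri" if "z \<in> tri" for z
  proof -
    have "0 \<le> ht z" "0 \<le> Re z - ht z" "Re z + ht z \<le> 1" using that by (auto simp: tri_def)
    moreover from this have "(1/2 - a/2) * (Re z + ht z) \<le> 1 * 1" using a_pos a_le_half by (intro mult_mono) auto
    ultimately have "0 \<le> (1/2 - a/2) * ht z" "0 \<le> (1/2 - a/2) * (Re z - ht z)" "(1/2 - a/2) * (Re z + ht z) \<le> 1"
      using a_le_half by (auto intro!: mult_nonneg_nonneg)
    then show ?thesis unfolding tri_def mem_Collect_eq child_coords right_diff_distrib distrib_left by linarith
  qed
  then show 1: "child1 a ` tri \<subseteq> tri" by auto
  then show "child4 a ` tri \<subseteq> tri" unfolding child34_flip[OF flip_tri] by (subst (2) flip_tri[symmetric]) (rule image_mono)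
qed

text \<open>The frontier of the triangle with its flank is contained in the flank curve and the two other sides of
  the triangle. The induction needs the triangle to the left: a former edge is no longer on
  the frontier because it is approached from both sides.\<close>

lemma tri_flank_interior:
  assumes "z \<in> tri \<union> flank a n" "z \<notin> flank_curve a n"
    "\<not> (z \<in> tri \<and> (Re z = ht z \<or> Re z = 1 - ht z))"
  shows "z \<in> interior (tri \<union> flank a n)"
  using assms
proof (induction n arbitrary: z)
  case 0
  have "tri \<union> flank a 0 = tri" using segment_subset_tri by auto
  moreover have "z \<in> tri" using 0 segment_subset_tri by auto
  moreover from this have "ht z \<noteq> 0" using 0 by (auto simp: segment_01 tri_def)
  ultimately show ?case using 0(3) interior_tri[of z] by (auto simp: tri_def)
next
  case (Suc n)
  let ?R = "tri \<union> flank a (Suc n)"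
  have IH: "y \<in> interior (tri \<union> flank a n)" if y: "y \<in> flank a n" "y \<notin> flank_curve a n" for y
  proof (rule Suc.IH)
    show "\<not> (y \<in> tri \<and> (Re y = ht y \<or> Re y = 1 - ht y))"
    proof
      assume h: "y \<in> tri \<and> (Re y = ht y \<or> Re y = 1 - ht y)"
      have "y \<in> envelope a" using y flank_envelope by auto
      then have "ht y = 0" using h by (auto simp: tri_def envelope_def)
      then have "y = 0 \<or> y = 1" using h by (auto simp: complex_eq_ht_iff)
      then show False using y zero_one_flank_curve by auto
    qed
  qed (use y in auto)
  have sub: "child1 a ` (tri \<union> flank a n) \<subseteq> ?R" "child2 a ` (tri \<union> flank a n) \<subseteq> ?R"
     "child3 a ` (tri \<union> flank a n) \<subseteq> ?R" "child4 a ` (tri \<union> flank a n) \<subseteq> ?R"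
    using child_tri bump_eq_child2 bump_eq_child3 by auto
  have child: "z \<in> interior ?R" if f: "f = edge_map p q" "p \<noteq> q" "f ` (tri \<union> flank a n) \<subseteq> ?R"
     "f ` flank_curve a n \<subseteq> flank_curve a (Suc n)" and z: "z \<in> f ` flank a n" for f p q
  proof -
    obtain y where y: "z = f y" "y \<in> flank a n" using z by auto
    then have "y \<notin> flank_curve a n" using Suc.prems(2) f(4) by auto
    from IH[OF y(2) this] show ?thesis using interior_edge_map[OF f(2)] f by (auto simp: y(1))
  qed
  note fad = foot_apex_distinct
  have c: "z \<in> interior ?R" if "z \<in> child1 a ` flank a n \<union> child2 a ` flank a n \<union> child3 a ` flank a n \<union> child4 a ` flank a n"
    using that child[OF child1_def fad(1) sub(1)] child[OF child2_def fad(2) sub(2)]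
       child[OF child3_def fad(3) sub(3)] child[OF child4_def fad(4) sub(4)] by auto
  have seg: "child2 a ` closed_segment 0 1 \<subseteq> child2 a ` flank a n" "child3 a ` closed_segment 0 1 \<subseteq> child3 a ` flank a n"
    using segment_subset_flank by (auto intro: image_mono)
  have b: "z \<in> interior ?R" if "z \<in> bump a"
  proof (cases "Re z + ht z = 1/2 - a/2 \<or> Re z = 1/2 + a/2 + ht z")
    case True
    then show ?thesis using c seg child2_segment[OF that] child3_segment[OF that] by blast
  next
    case False
    then have "z \<in> interior (tri \<union> bump a)" using that by (intro interior_rhomb) (auto simp: bump_def)
    then show ?thesis using interior_mono[of "tri \<union> bump a" ?R] by auto
  qed
  have fl: "z \<in> interior ?R" if "z \<in> flank a (Suc n)" using that b c by auto
  show ?case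
  proof (cases "z \<in> flank a (Suc n)")
    case False
    then have z: "z \<in> tri" using Suc.prems by auto
    have "ht z \<noteq> 0"
    proof
      assume "ht z = 0"
      then have "z \<in> closed_segment 0 1" using z by (auto simp: tri_def segment_01)
      then show False using False segment_subset_flank by blast
    qed
    then have "z \<in> interior tri" using z Suc.prems(3) by (intro interior_tri) (auto simp: tri_def)
    then show ?thesis using interior_mono[of tri ?R] by auto
  qed (rule fl)
qed

end

section \<open>The filled stages\<close>

text \<open>The maps \<open>edge_map 1 tri_top\<close> and \<open>edge_map tri_top 0\<close> are the rotations of the initial triangle onto itself.\<close>

definition koch_region :: "real \<Rightarrow> nat \<Rightarrow> complex set" where
  "koch_region a n = tri \<union> flank a n \<union> edge_map 1 tri_top ` flank a n \<union> edge_map tri_top 0 ` flank a n"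

lemma rot_coords: "Re (edge_map 1 tri_top z) = 1 - Re z / 2 - 3 * ht z / 2" "ht (edge_map 1 tri_top z) = Re z / 2 - ht z / 2"
  "Re (edge_map tri_top 0 z) = 1/2 - Re z / 2 + 3 * ht z / 2" "ht (edge_map tri_top 0 z) = 1/2 - Re z / 2 - ht z / 2"
  by (simp_all add: edge_map_def mult_ht tri_top_def field_simps)

lemma rot_distinct: "1 \<noteq> tri_top" "tri_top \<noteq> 0" by (auto simp: complex_eq_ht_iff tri_top_def)

lemma rot_rot: "edge_map 1 tri_top (edge_map 1 tri_top z) = edge_map tri_top 0 z" "edge_map 1 tri_top (edge_map tri_top 0 z) = z"
  by (simp_all add: complex_eq_ht_iff rot_coords field_simps)

lemma rot_tri: "edge_map 1 tri_top ` tri = tri" "edge_map tri_top 0 ` tri = tri"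
proof -
  have 1: "edge_map 1 tri_top ` tri \<subseteq> tri" by (auto simp: tri_def rot_coords)
  then have 2: "edge_map tri_top 0 ` tri \<subseteq> tri" by (auto simp: rot_rot(1)[symmetric])
  have "z \<in> edge_map 1 tri_top ` tri" if "z \<in> tri" for z
    using 2 that rot_rot(2)[of z] by (intro image_eqI[where x = "edge_map tri_top 0 z"]) auto
  with 1 show 3: "edge_map 1 tri_top ` tri = tri" by blast
  have "edge_map tri_top 0 ` tri = edge_map 1 tri_top ` edge_map 1 tri_top ` tri" by (simp add: image_image rot_rot)
  then show "edge_map tri_top 0 ` tri = tri" by (simp only: 3)
qed

context koch_parameter
begin

lemma rot_Int: 
  "z \<in> envelope a \<Longrightarrow> z \<in> edge_map 1 tri_top ` envelope a \<Longrightarrow> z = 1"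
  "z \<in> envelope a \<Longrightarrow> z \<in> edge_map tri_top 0 ` envelope a \<Longrightarrow> z = 0"
  "z \<in> edge_map 1 tri_top ` envelope a \<Longrightarrow> z \<in> edge_map tri_top 0 ` envelope a \<Longrightarrow> z = tri_top"
proof -
  show 1: "z = 1" if z: "z \<in> envelope a" "z \<in> edge_map 1 tri_top ` envelope a" for z
  proof -
    obtain y where y: "z = edge_map 1 tri_top y" "y \<in> envelope a" using z by auto
    have "Re y \<le> ht y" using z(1) by (auto simp: envelope_def y rot_coords)
    then have "y = 0" using y(2) by (auto simp: envelope_def complex_eq_ht_iff)
    then show ?thesis by (simp add: y)
  qed
  show "z = 0" if z: "z \<in> envelope a" "z \<in> edge_map tri_top 0 ` envelope a" for z
  proof -
    obtain y where y: "z = edge_map tri_top 0 y" "y \<in> envelope a" using z by auto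
    have "1 - Re y - ht y \<le> 0" using z(1) by (auto simp: envelope_def y rot_coords)
    then have "y = 1" using y(2) by (auto simp: envelope_def complex_eq_ht_iff)
    then show ?thesis by (simp add: y)
  qed
  show "z = tri_top" if z: "z \<in> edge_map 1 tri_top ` envelope a" "z \<in> edge_map tri_top 0 ` envelope a" for z
  proof -
    obtain y where y: "z = edge_map 1 tri_top y" "y \<in> envelope a" using z by auto
    obtain x where x: "z = edge_map 1 tri_top (edge_map 1 tri_top x)" "x \<in> envelope a" using z by (auto simp: rot_rot)
    have "y = edge_map 1 tri_top x" using x(1) y(1) inj_edge_map[OF rot_distinct(1)] by (simp add: inj_eq)
    then have "y = 1" using 1 x y by blast
    then show ?thesis by (simp add: y)
  qed
qed

lemma compact_koch_region: "compact (koch_region a n)"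
  unfolding koch_region_def using compact_flank[of n] compact_convex_tri
  by (intro compact_Un compact_continuous_image continuous_on_edge_map) auto

lemma connected_Compl_koch_region: "connected (- koch_region a n)"
proof -
  let ?G = "flank a n" and ?r1 = "edge_map 1 tri_top" and ?r2 = "edge_map tri_top 0"
  have env: "?G \<subseteq> envelope a" by (rule flank_envelope)
  have seg: "closed_segment 0 1 \<subseteq> ?G" by (rule segment_subset_flank)
  have i1: "tri \<inter> ?G = closed_segment 0 1"
  proof -
    have "z \<in> closed_segment 0 1" if "z \<in> tri" "z \<in> ?G" for z
    proof -
      have "z \<in> envelope a" using that env by blast
      then show ?thesis using that by (auto simp: tri_def segment_01 envelope_def)
    qed
    then show ?thesis using seg segment_subset_tri by (intro subset_antisym Int_greatest) auto
  qed
  have t: "tri \<inter> ?r1 ` ?G = ?r1 ` closed_segment 0 1" "tri \<inter> ?r2 ` ?G = ?r2 ` closed_segment 0 1"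
    unfolding i1[symmetric] by (simp_all add: image_Int inj_edge_map rot_distinct rot_tri)
  have m: "1 \<in> ?r1 ` closed_segment 0 1" "0 \<in> ?r2 ` closed_segment 0 1" "tri_top \<in> ?r2 ` closed_segment 0 1"
    unfolding edge_map_segment by auto
  have ts: "?r1 ` closed_segment 0 1 \<subseteq> tri" "?r2 ` closed_segment 0 1 \<subseteq> tri"
    "?r1 ` closed_segment 0 1 \<subseteq> ?r1 ` ?G" "?r2 ` closed_segment 0 1 \<subseteq> ?r2 ` ?G"
    using t seg by (auto intro: image_mono)
  have e: "z \<in> ?G \<Longrightarrow> z \<in> envelope a" "z \<in> ?r1 ` ?G \<Longrightarrow> z \<in> ?r1 ` envelope a" "z \<in> ?r2 ` ?G \<Longrightarrow> z \<in> ?r2 ` envelope a" for z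
    using env by blast+
  have i2: "(tri \<union> ?G) \<inter> ?r1 ` ?G = ?r1 ` closed_segment 0 1"
  proof (rule Un2_Int_eqI[OF ts(1,3)])
    show "z \<in> ?r1 ` closed_segment 0 1" if "z \<in> tri" "z \<in> ?r1 ` ?G" for z using that t by blast
    show "z \<in> ?r1 ` closed_segment 0 1" if "z \<in> ?G" "z \<in> ?r1 ` ?G" for z
      using rot_Int(1)[OF e(1)[OF that(1)] e(2)[OF that(2)]] m(1) by simp
  qed
  have i3: "(tri \<union> ?G \<union> ?r1 ` ?G) \<inter> ?r2 ` ?G = ?r2 ` closed_segment 0 1"
  proof (rule Un3_Int_eqI[OF ts(2,4)])
    show "z \<in> ?r2 ` closed_segment 0 1" if "z \<in> tri" "z \<in> ?r2 ` ?G" for z using that t by blast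
    show "z \<in> ?r2 ` closed_segment 0 1" if "z \<in> ?G" "z \<in> ?r2 ` ?G" for z
      using rot_Int(2)[OF e(1)[OF that(1)] e(3)[OF that(2)]] m(2) by simp
    show "z \<in> ?r2 ` closed_segment 0 1" if "z \<in> ?r1 ` ?G" "z \<in> ?r2 ` ?G" for z
      using rot_Int(3)[OF e(2)[OF that(1)] e(3)[OF that(2)]] m(3) by simp
  qed
  have com: "compact tri" "compact ?G" "compact (?r1 ` ?G)" "compact (?r2 ` ?G)"
    using compact_flank[of n] compact_convex_tri
    by (auto intro!: compact_continuous_image continuous_on_edge_map)
  have con: "connected (- tri)" "connected (- ?G)" "connected (- ?r1 ` ?G)" "connected (- ?r2 ` ?G)"
    using compact_convex_tri connected_Compl_flank[of n] rot_distinct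
    by (auto intro!: connected_Compl_edge_map connected_complement_bounded_convex compact_imp_bounded)
  have cs: "connected (?r1 ` closed_segment 0 1)" "connected (?r2 ` closed_segment 0 1)" "connected (closed_segment 0 (1::complex))"
    unfolding edge_map_segment by auto
  have "connected (- (tri \<union> ?G))"
    by (rule connected_Compl_Un) (simp_all only: com con i1 cs)
  then have "connected (- (tri \<union> ?G \<union> ?r1 ` ?G))"
    by (rule connected_Compl_Un[rotated 2]) (simp_all only: compact_Un com con i2 cs)
  then have "connected (- (tri \<union> ?G \<union> ?r1 ` ?G \<union> ?r2 ` ?G))"
    by (rule connected_Compl_Un[rotated 2]) (simp_all only: compact_Un com con i3 cs)
  then show ?thesis by (simp add: koch_region_def)
qed

lemma filled_koch: "filled_polygon (koch_vertices a n) = koch_region a n"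
proof (rule filled_polygon_eq[OF compact_koch_region connected_Compl_koch_region])
  let ?G = "flank a n" and ?K = "flank_curve a n" and ?r1 = "edge_map 1 tri_top" and ?r2 = "edge_map tri_top 0"
  have "edge_map 0 1 = (\<lambda>z. z)" by (rule ext) (simp add: edge_map_def)
  then have id: "edge_map 0 1 ` ?K = ?K" by simp
  have curve: "polygonal_curve (koch_vertices a n) = ?K \<union> ?r1 ` ?K \<union> ?r2 ` ?K"
    unfolding polygonal_curve_koch_vertices id ..
  have KG: "?K \<subseteq> ?G" by (rule flank_curve_subset)
  have "?K \<union> ?r1 ` ?K \<union> ?r2 ` ?K \<subseteq> ?G \<union> ?r1 ` ?G \<union> ?r2 ` ?G"
    by (intro Un_mono image_mono KG)
  also have "\<dots> \<subseteq> koch_region a n" unfolding koch_region_def by auto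
  finally show "polygonal_curve (koch_vertices a n) \<subseteq> koch_region a n"
    unfolding curve .
  have int: "y \<in> interior (tri \<union> ?G)" if y: "y \<in> ?G" "y \<notin> ?K" for y
  proof (rule tri_flank_interior)
    show "\<not> (y \<in> tri \<and> (Re y = ht y \<or> Re y = 1 - ht y))"
    proof
      assume h: "y \<in> tri \<and> (Re y = ht y \<or> Re y = 1 - ht y)"
      have "y \<in> envelope a" using y flank_envelope by auto
      then have "ht y = 0" using h by (auto simp: tri_def envelope_def)
      then have "y = 0 \<or> y = 1" using h by (auto simp: complex_eq_ht_iff)
      then show False using y zero_one_flank_curve by auto
    qed
  qed (use y in auto)
  have sub: "?r1 ` (tri \<union> ?G) \<subseteq> koch_region a n" "?r2 ` (tri \<union> ?G) \<subseteq> koch_region a n"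
    unfolding image_Un rot_tri koch_region_def by (simp_all add: le_supI1 le_supI2)
  have isub: "interior (tri \<union> ?G) \<subseteq> interior (koch_region a n)" "interior tri \<subseteq> interior (koch_region a n)"
    unfolding koch_region_def by (rule interior_mono, simp add: le_supI1)+
  show "koch_region a n - polygonal_curve (koch_vertices a n) \<subseteq> interior (koch_region a n)"
  proof
    fix z assume z: "z \<in> koch_region a n - polygonal_curve (koch_vertices a n)"
    have 1: "z \<in> interior (koch_region a n)" if "z \<in> ?G"
      using int[OF that] z isub(1) unfolding curve by blast
    have 2: "z \<in> interior (koch_region a n)" if h: "z \<in> edge_map p q ` ?G" "p \<noteq> q" "z \<notin> edge_map p q ` ?K"
      "edge_map p q ` (tri \<union> ?G) \<subseteq> koch_region a n" for p q
    proof -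
      obtain y where y: "z = edge_map p q y" "y \<in> ?G" using h by auto
      then have "y \<notin> ?K" using h by auto
      from int[OF y(2) this] show ?thesis using interior_edge_map[OF h(2) _ h(4)] y(1) by auto
    qed
    have nK: "z \<notin> ?K" "z \<notin> ?r1 ` ?K" "z \<notin> ?r2 ` ?K" using z by (auto simp: curve)
    note 3 = 2[OF _ rot_distinct(1) nK(2) sub(1)] 2[OF _ rot_distinct(2) nK(3) sub(2)]
    show "z \<in> interior (koch_region a n)"
    proof (cases "z \<in> ?G \<union> ?r1 ` ?G \<union> ?r2 ` ?G")
      case True then show ?thesis using 1 3 by (elim UnE)
    next
      case False
      then have zt: "z \<in> tri" using z by (auto simp: koch_region_def)
      have seg: "closed_segment 0 1 \<subseteq> ?G" by (rule segment_subset_flank)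
      have "ht z \<noteq> 0"
      proof
        assume "ht z = 0"
        then have "z \<in> closed_segment 0 1" using zt by (auto simp: tri_def segment_01)
        then show False using False seg by blast
      qed
      moreover have "Re z \<noteq> 1 - ht z"
      proof
        assume h: "Re z = 1 - ht z"
        then have "z = ?r1 (tri_pt (2 * ht z) 0)" by (simp add: complex_eq_ht_iff rot_coords)
        moreover have "tri_pt (2 * ht z) 0 \<in> closed_segment 0 1" using zt h by (auto simp: tri_def segment_01)
        ultimately show False using False seg by blast
      qed
      moreover have "Re z \<noteq> ht z"
      proof
        assume h: "Re z = ht z"
        then have "z = ?r2 (tri_pt (1 - 2 * ht z) 0)" by (simp add: complex_eq_ht_iff rot_coords field_simps)
        moreover have "tri_pt (1 - 2 * ht z) 0 \<in> closed_segment 0 1" using zt h by (auto simp: tri_def segment_01)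
        ultimately show False using False seg by blast
      qed
      ultimately have "z \<in> interior tri" using zt by (intro interior_tri) (auto simp: tri_def)
      then show ?thesis using isub(2) by blast
    qed
  qed
qed

lemma koch_snowflake_eq: "koch_snowflake a = (\<Union>n. interior (koch_region a n))"
  by (simp add: koch_snowflake_def filled_koch)

lemma koch_region_mono: "m \<le> n \<Longrightarrow> koch_region a m \<subseteq> koch_region a n"
  using flank_mono[of m n] unfolding koch_region_def by (intro Un_mono image_mono order_refl)

end

section \<open>Curves parametrized by arc length\<close>

definition inscribed_length :: "(real \<Rightarrow> 'a::metric_space) \<Rightarrow> real list \<Rightarrow> ennreal" where
  "inscribed_length \<gamma> xs = (\<Sum>i<length xs - 1. ennreal (dist (\<gamma> (xs ! i)) (\<gamma> (xs ! Suc i))))"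

lemma curve_length_alt:
  "curve_length \<gamma> s t = (SUP xs \<in> {xs. sorted xs \<and> set xs \<subseteq> {s..t}}. inscribed_length \<gamma> xs)"
  by (simp add: curve_length_def inscribed_length_def)

lemma inscribed_length_append2:
  "inscribed_length \<gamma> xs + ennreal (dist (\<gamma> s) (\<gamma> t)) \<le> inscribed_length \<gamma> (xs @ [s, t])"
proof -
  let ?ys = "xs @ [s, t]"
  let ?f = "\<lambda>i. ennreal (dist (\<gamma> (?ys ! i)) (\<gamma> (?ys ! Suc i)))"
  have "inscribed_length \<gamma> xs = (\<Sum>i<length xs - 1. ?f i)"
    unfolding inscribed_length_def by (rule sum.cong) (auto simp: nth_append)
  moreover have "?f (length xs) = ennreal (dist (\<gamma> s) (\<gamma> t))" by (simp add: nth_append)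
  ultimately have "inscribed_length \<gamma> xs + ennreal (dist (\<gamma> s) (\<gamma> t)) = (\<Sum>i\<in>insert (length xs) {..<length xs - 1}. ?f i)"
    by (subst sum.insert) (auto simp del: sum_ennreal simp: add.commute)
  also have "\<dots> \<le> (\<Sum>i<length ?ys - 1. ?f i)"
    by (rule sum_mono2) auto
  finally show ?thesis by (simp add: inscribed_length_def)
qed

text \<open>An inscribed polygon is prolonged by one chord.\<close>

lemma curve_length_add_dist_le:
  assumes "0 \<le> s" "s \<le> t"
  shows "curve_length \<gamma> 0 s + ennreal (dist (\<gamma> s) (\<gamma> t)) \<le> curve_length \<gamma> 0 t"
proof -
  let ?I = "\<lambda>s::real. {xs. sorted xs \<and> set xs \<subseteq> {0..s}}"
  have ne: "?I s \<noteq> {}" by (auto intro!: exI[of _ "[]"])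
  have "curve_length \<gamma> 0 s + ennreal (dist (\<gamma> s) (\<gamma> t)) =
      (SUP xs \<in> ?I s. inscribed_length \<gamma> xs + ennreal (dist (\<gamma> s) (\<gamma> t)))"
    unfolding curve_length_alt by (rule ennreal_SUP_add_left[symmetric, OF ne])
  also have "\<dots> \<le> curve_length \<gamma> 0 t"
    unfolding curve_length_alt
  proof (rule SUP_least)
    fix xs assume xs: "xs \<in> ?I s"
    have "xs @ [s, t] \<in> ?I t" using xs assms by (auto simp: sorted_append)
    then have "inscribed_length \<gamma> (xs @ [s, t]) \<le> (SUP xs \<in> ?I t. inscribed_length \<gamma> xs)" by (rule SUP_upper)
    then show "inscribed_length \<gamma> xs + ennreal (dist (\<gamma> s) (\<gamma> t)) \<le> (SUP xs \<in> ?I t. inscribed_length \<gamma> xs)"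
      using inscribed_length_append2 order_trans by blast
  qed
  finally show ?thesis .
qed

lemma arclength_lipschitz:
  assumes "arclength_parametrized \<gamma> l" "0 \<le> s" "s \<le> t" "t \<le> l"
  shows "dist (\<gamma> s) (\<gamma> t) \<le> t - s"
proof -
  have "ennreal s + ennreal (dist (\<gamma> s) (\<gamma> t)) \<le> ennreal t"
    using curve_length_add_dist_le[of s t \<gamma>] assms by (simp add: arclength_parametrized_def)
  then have "ennreal (s + dist (\<gamma> s) (\<gamma> t)) \<le> ennreal t" using assms by simp
  then have "s + dist (\<gamma> s) (\<gamma> t) \<le> t" by (subst (asm) ennreal_le_iff) (use assms in auto)
  then show ?thesis by simp
qed

lemma curve_length_le_lipschitz:
  assumes "0 \<le> t" "\<And>u v. 0 \<le> u \<Longrightarrow> u \<le> v \<Longrightarrow> v \<le> t \<Longrightarrow> dist (\<gamma> u) (\<gamma> v) \<le> v - u"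
  shows "curve_length \<gamma> 0 t \<le> ennreal t"
  unfolding curve_length_alt
proof (rule SUP_least)
  fix xs assume xs: "xs \<in> {xs. sorted xs \<and> set xs \<subseteq> {0..t}}"
  show "inscribed_length \<gamma> xs \<le> ennreal t"
  proof (cases "xs = []")
    case True
    then show ?thesis by (simp add: inscribed_length_def)
  next
    case False
    have in_t: "xs ! i \<in> {0..t}" if "i < length xs" for i using xs that nth_mem by blast
    have "inscribed_length \<gamma> xs \<le> (\<Sum>i<length xs - 1. ennreal (xs ! Suc i - xs ! i))"
      unfolding inscribed_length_def
    proof (rule sum_mono)
      fix i assume i: "i \<in> {..<length xs - 1}"
      then have "xs ! i \<le> xs ! Suc i" using xs by (auto simp: sorted_iff_nth_mono)
      then show "ennreal (dist (\<gamma> (xs ! i)) (\<gamma> (xs ! Suc i))) \<le> ennreal (xs ! Suc i - xs ! i)"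
        using in_t[of i] in_t[of "Suc i"] i by (intro ennreal_leI assms(2)) auto
    qed
    also have "\<dots> = ennreal (\<Sum>i<length xs - 1. xs ! Suc i - xs ! i)"
      using xs by (intro sum_ennreal) (auto simp: sorted_iff_nth_mono)
    also have "(\<Sum>i<length xs - 1. xs ! Suc i - xs ! i) = xs ! (length xs - 1) - xs ! 0"
      by (rule sum_lessThan_telescope)
    also have "ennreal \<dots> \<le> ennreal t"
      using in_t[of 0] in_t[of "length xs - 1"] False by (intro ennreal_leI) auto
    finally show ?thesis .
  qed
qed

lemma curve_length_cong:
  assumes "\<And>u. 0 \<le> u \<Longrightarrow> u \<le> t \<Longrightarrow> \<gamma> u = \<gamma>' u"
  shows "curve_length \<gamma> 0 t = curve_length \<gamma>' 0 t"
  unfolding curve_length_alt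
proof (rule SUP_cong)
  fix xs assume xs: "xs \<in> {xs. sorted xs \<and> set xs \<subseteq> {0..t}}"
  have "\<gamma> (xs ! i) = \<gamma>' (xs ! i)" if "i < length xs" for i
  proof -
    have "xs ! i \<in> {0..t}" using xs nth_mem[OF that] by blast
    then show ?thesis using assms by simp
  qed
  then show "inscribed_length \<gamma> xs = inscribed_length \<gamma>' xs"
    unfolding inscribed_length_def by (intro sum.cong) auto
qed simp

text \<open>A John curve in progress: the carrot condition is stated with balls in \<open>S\<close>, which does not refer to the frontier
  and is stable under prolongation. The bound \<open>T\<close> only has to dominate the length.\<close>

definition reaches :: "real \<Rightarrow> 'a::real_normed_vector set \<Rightarrow> 'a \<Rightarrow> 'a \<Rightarrow> real \<Rightarrow> bool" where
  "reaches c S x y T \<longleftrightarrow> (\<exists>\<gamma> l. arclength_parametrized \<gamma> l \<and> \<gamma> ` {0..l} \<subseteq> S \<and> \<gamma> 0 = x \<and> \<gamma> l = y \<and> l \<le> T \<and>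
     (\<forall>t\<in>{0..l}. ball (\<gamma> t) (t / c) \<subseteq> S))"

lemma reaches_refl: "x \<in> S \<Longrightarrow> 0 \<le> T \<Longrightarrow> reaches c S x x T"
proof -
  assume x: "x \<in> S" "0 \<le> T"
  have "curve_length (\<lambda>_. x) 0 0 \<le> ennreal 0" by (rule curve_length_le_lipschitz) auto
  then have "arclength_parametrized (\<lambda>_. x) 0" by (simp add: arclength_parametrized_def)
  then show ?thesis unfolding reaches_def using x by (intro exI[of _ "\<lambda>_. x"] exI[of _ 0]) auto
qed

lemma reaches_mono: "reaches c S x y T \<Longrightarrow> T \<le> T' \<Longrightarrow> reaches c S x y T'"
  unfolding reaches_def using order_trans by blast

lemma arclength_append_segment:
  fixes \<gamma> :: "real \<Rightarrow> 'a::real_normed_vector"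
  assumes \<gamma>: "arclength_parametrized \<gamma> l" and e: "norm e = 1" and d: "0 \<le> d"
  defines "\<delta> \<equiv> \<lambda>t. if t \<le> l then \<gamma> t else \<gamma> l + (t - l) *\<^sub>R e"
  shows "arclength_parametrized \<delta> (l + d)"
proof -
  have l: "0 \<le> l" and cont: "continuous_on {0..l} \<gamma>" and len: "\<And>t. t \<in> {0..l} \<Longrightarrow> curve_length \<gamma> 0 t = ennreal t"
    using \<gamma> by (auto simp: arclength_parametrized_def)
  have "continuous_on ({0..l} \<union> {l..l+d}) \<delta>"
    unfolding \<delta>_def by (rule continuous_on_If) (auto intro!: continuous_intros cont)
  moreover have "{0..l} \<union> {l..l+d} = {0..l+d}" using l d by auto
  ultimately have c: "continuous_on {0..l+d} \<delta>" by simp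
  have lip: "dist (\<delta> u) (\<delta> v) \<le> v - u" if uv: "0 \<le> u" "u \<le> v" for u v
  proof (cases "v \<le> l")
    case True
    then show ?thesis using arclength_lipschitz[OF \<gamma>, of u v] uv by (simp add: \<delta>_def)
  next
    case v: False
    show ?thesis
    proof (cases "u \<le> l")
      case True
      have "dist (\<delta> u) (\<delta> v) \<le> dist (\<gamma> u) (\<gamma> l) + dist (\<gamma> l) (\<gamma> l + (v - l) *\<^sub>R e)"
        using v True by (simp add: \<delta>_def dist_triangle)
      also have "dist (\<gamma> l) (\<gamma> l + (v - l) *\<^sub>R e) = v - l" using v e by (simp add: dist_norm)
      finally show ?thesis using arclength_lipschitz[OF \<gamma>, of u l] uv True by simp
    next
      case False
      have "\<delta> u - \<delta> v = (u - v) *\<^sub>R e" using v False by (simp add: \<delta>_def scaleR_left_diff_distrib)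
      then show ?thesis using e uv by (simp add: dist_norm)
    qed
  qed
  have "curve_length \<delta> 0 t = ennreal t" if t: "t \<in> {0..l+d}" for t
  proof (cases "t \<le> l")
    case True
    have "curve_length \<delta> 0 t = curve_length \<gamma> 0 t" using True by (intro curve_length_cong) (simp add: \<delta>_def)
    then show ?thesis using len True t by simp
  next
    case False
    have "curve_length \<delta> 0 l = curve_length \<gamma> 0 l" by (intro curve_length_cong) (simp add: \<delta>_def)
    then have "curve_length \<delta> 0 l = ennreal l" using len l by simp
    moreover have "dist (\<delta> l) (\<delta> t) = t - l" using False e by (simp add: \<delta>_def dist_norm)
    ultimately have "ennreal l + ennreal (t - l) \<le> curve_length \<delta> 0 t"
      using curve_length_add_dist_le[of l t \<delta>] l False by simp
    then have "ennreal t \<le> curve_length \<delta> 0 t" using l False by (simp add: ennreal_plus[symmetric] del: ennreal_plus)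
    moreover have "curve_length \<delta> 0 t \<le> ennreal t" using t lip by (intro curve_length_le_lipschitz) auto
    ultimately show ?thesis by (rule antisym[rotated])
  qed
  then show ?thesis using c l d by (simp add: arclength_parametrized_def)
qed

text \<open>Since the radii are required for the bound \<open>T\<close> in place of the actual length, segments can be appended
  without knowing the curve.\<close>

lemma reaches_segment:
  assumes r: "reaches c S x y T" and c: "0 < c"
    and b: "\<And>s. 0 \<le> s \<Longrightarrow> s \<le> 1 \<Longrightarrow> ball (y + s *\<^sub>R (z - y)) ((T + s * dist y z) / c) \<subseteq> S"
    and T': "T + dist y z \<le> T'"
  shows "reaches c S x z T'"
proof (cases "y = z")
  case True
  then show ?thesis using reaches_mono[OF r] T' by simp
next
  case False
  define d where "d = dist y z"
  have d: "0 < d" using False by (simp add: d_def)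
  define e where "e = (z - y) /\<^sub>R d"
  have e: "norm e = 1" "d *\<^sub>R e = z - y" using d False by (simp_all add: e_def d_def dist_norm norm_minus_commute)
  obtain \<gamma> l where \<gamma>: "arclength_parametrized \<gamma> l" "\<gamma> ` {0..l} \<subseteq> S" "\<gamma> 0 = x" "\<gamma> l = y" "l \<le> T"
     "\<And>t. t \<in> {0..l} \<Longrightarrow> ball (\<gamma> t) (t / c) \<subseteq> S" using r unfolding reaches_def by auto
  have l: "0 \<le> l" using \<gamma>(1) by (simp add: arclength_parametrized_def)
  define \<delta> where "\<delta> = (\<lambda>t. if t \<le> l then \<gamma> t else \<gamma> l + (t - l) *\<^sub>R e)"
  have ball: "ball (\<delta> t) (t / c) \<subseteq> S" if t: "t \<in> {0..l+d}" for t
  proof (cases "t \<le> l")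
    case True then show ?thesis using \<gamma>(6)[of t] t by (simp add: \<delta>_def)
  next
    case False
    define s where "s = (t - l) / d"
    have s: "0 \<le> s" "s \<le> 1" "s * d = t - l" using False t d by (auto simp: s_def)
    have "\<delta> t = y + s *\<^sub>R (z - y)" using False s(3) by (simp add: \<delta>_def \<gamma>(4) e(2)[symmetric])
    moreover have "t / c \<le> (T + s * dist y z) / c"
      using c \<gamma>(5) s(3) unfolding d_def[symmetric] by (intro divide_right_mono) auto
    ultimately show ?thesis using b[OF s(1,2)] subset_ball order_trans by metis
  qed
  have "\<delta> t \<in> S" if t: "t \<in> {0..l+d}" for t
  proof (cases "t \<le> l")
    case True then show ?thesis using \<gamma>(2) t by (auto simp: \<delta>_def)
  next
    case False
    then have "0 < t / c" using c l by simp
    then show ?thesis using ball[OF t] by (meson centre_in_ball subsetD)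
  qed
  then have im: "\<delta> ` {0..l+d} \<subseteq> S" by auto
  have "arclength_parametrized \<delta> (l + d)"
    unfolding \<delta>_def using \<gamma>(1) e(1) d by (intro arclength_append_segment) auto
  moreover have "\<delta> 0 = x" "\<delta> (l + d) = z" using l d \<gamma> e by (auto simp: \<delta>_def)
  moreover have "l + d \<le> T'" using T' \<gamma>(5) by (simp add: d_def)
  ultimately show ?thesis unfolding reaches_def using im ball by blast
qed

lemma infdist_frontier_ge:
  assumes "frontier S \<noteq> {}" "open S" "ball p r \<subseteq> S"
  shows "r \<le> infdist p (frontier S)"
  unfolding infdist_notempty[OF assms(1)]
proof (rule cINF_greatest[OF assms(1)])
  fix y assume "y \<in> frontier S"
  then have "y \<notin> S" using assms(2) by (simp add: frontier_def interior_open)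
  then have "y \<notin> ball p r" using assms(3) by blast
  then show "r \<le> dist p y" by simp
qed

text \<open>A segment that leaves \<open>S\<close> meets its frontier.\<close>

lemma infdist_frontier_le:
  fixes z u :: "'a::euclidean_space"
  assumes "z \<in> S" "u \<notin> S"
  shows "infdist z (frontier S) \<le> dist z u"
proof -
  have "closed_segment z u \<inter> frontier S \<noteq> {}"
    using assms by (intro connected_Int_frontier) auto
  then obtain w where w: "w \<in> closed_segment z u" "w \<in> frontier S" by auto
  have "infdist z (frontier S) \<le> dist z w" using w by (intro infdist_le)
  also have "\<dots> \<le> dist z u" using w by (metis dist_in_closed_segment dist_commute)
  finally show ?thesis .
qed

lemma john_domainI:
  fixes S :: "'a::euclidean_space set"
  assumes "1 \<le> c" "open S" "bounded S" "x0 \<in> S" and r: "\<And>x. x \<in> S \<Longrightarrow> \<exists>T. reaches c S x x0 T"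
  shows "john_domain c S"
proof -
  have "S \<noteq> UNIV" using assms(3) by auto
  then have fr: "frontier S \<noteq> {}" using assms(4) frontier_not_empty by blast
  have path: "\<exists>\<gamma> l. arclength_parametrized \<gamma> l \<and> \<gamma> ` {0..l} \<subseteq> S \<and> \<gamma> 0 = x \<and> \<gamma> l = x0 \<and>
        (\<forall>t\<in>{0..l}. infdist (\<gamma> t) (frontier S) \<ge> 1 / c * t)" if x: "x \<in> S" for x
  proof -
    obtain T where "reaches c S x x0 T" using r[OF x] by auto
    then obtain \<gamma> l where \<gamma>: "arclength_parametrized \<gamma> l" "\<gamma> ` {0..l} \<subseteq> S" "\<gamma> 0 = x" "\<gamma> l = x0"
       "\<And>t. t \<in> {0..l} \<Longrightarrow> ball (\<gamma> t) (t / c) \<subseteq> S" unfolding reaches_def by blast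
    have "infdist (\<gamma> t) (frontier S) \<ge> 1 / c * t" if "t \<in> {0..l}" for t
      using infdist_frontier_ge[OF fr assms(2) \<gamma>(5)[OF that]] by simp
    with \<gamma> show ?thesis by blast
  qed
  have "connected_component S x x0" if x: "x \<in> S" for x
  proof -
    obtain \<gamma> l where \<gamma>: "arclength_parametrized \<gamma> l" "\<gamma> ` {0..l} \<subseteq> S" "\<gamma> 0 = x" "\<gamma> l = x0" using path[OF x] by blast
    have "connected (\<gamma> ` {0..l})" using \<gamma>(1) by (intro connected_continuous_image) (auto simp: arclength_parametrized_def)
    moreover have "x \<in> \<gamma> ` {0..l}" "x0 \<in> \<gamma> ` {0..l}" using \<gamma> by (auto simp: arclength_parametrized_def image_iff intro: bexI[of _ 0] bexI[of _ l])
    ultimately show ?thesis using \<gamma>(2) unfolding connected_component_def by blast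
  qed
  then have "connected S"
    by (meson connected_component_sym connected_component_trans connected_iff_connected_component)
  moreover have "S \<noteq> {}" using assms(4) by auto
  ultimately show ?thesis unfolding john_domain_def
    by (intro conjI bexI[OF _ assms(4)] ballI assms(1,2)) (simp_all only: path not_False_eq_True)
qed

section \<open>Similarities and inradius units\<close>

text \<open>Similarities of either orientation: the reflected edges are needed to treat both
  ends of an edge alike.\<close>

definition similarity :: "real \<Rightarrow> (complex \<Rightarrow> complex) \<Rightarrow> bool" where
  "similarity k f \<longleftrightarrow> 0 < k \<and> surj f \<and> (\<forall>x y. dist (f x) (f y) = k * dist x y)
     \<and> (\<forall>x y s. f (x + s *\<^sub>R (y - x)) = f x + s *\<^sub>R (f y - f x))"

lemma similarity_comp: "similarity k f \<Longrightarrow> similarity j g \<Longrightarrow> similarity (k * j) (f \<circ> g)"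
  unfolding similarity_def using comp_surj[of g f] by (simp add: mult.assoc)

lemma similarity_edge_map: "p \<noteq> q \<Longrightarrow> similarity (cmod (q - p)) (edge_map p q)"
proof -
  assume pq: "p \<noteq> q"
  have "dist (edge_map p q x) (edge_map p q y) = cmod (q - p) * dist x y" for x y
  proof -
    have "edge_map p q x - edge_map p q y = (q - p) * (x - y)" by (simp add: edge_map_def algebra_simps)
    then show ?thesis by (simp add: dist_norm norm_mult)
  qed
  moreover have "edge_map p q (x + s *\<^sub>R (y - x)) = edge_map p q x + s *\<^sub>R (edge_map p q y - edge_map p q x)" for x y s
    by (simp add: edge_map_def algebra_simps)
  ultimately show ?thesis using pq bij_is_surj[OF bij_edge_map[OF pq]] by (simp add: similarity_def)
qed

lemma similarity_flip: "similarity 1 flip"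
proof -
  have "surj flip" by (metis flip_flip surjI)
  moreover have "dist (flip x) (flip y) = dist x y" for x y
  proof -
    have "flip x - flip y = - cnj (x - y)" by (simp add: flip_def)
    then show ?thesis by (simp add: dist_norm del: complex_cnj_diff)
  qed
  moreover have "flip (x + s *\<^sub>R (y - x)) = flip x + s *\<^sub>R (flip y - flip x)" for x y s
    by (simp add: complex_eq_ht_iff algebra_simps)
  ultimately show ?thesis by (simp add: similarity_def)
qed

lemma similarity_ball: "similarity k f \<Longrightarrow> ball (f p) (k * r) = f ` ball p r"
proof
  assume s: "similarity k f"
  then have k: "0 < k" "\<And>x y. dist (f x) (f y) = k * dist x y" "surj f" by (auto simp: similarity_def)
  show "f ` ball p r \<subseteq> ball (f p) (k * r)" using k by auto
  show "ball (f p) (k * r) \<subseteq> f ` ball p r"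
  proof
    fix w assume w: "w \<in> ball (f p) (k * r)"
    obtain z where z: "w = f z" using k(3) by (metis surjD)
    have "z \<in> ball p r" using w k by (simp add: z)
    then show "w \<in> f ` ball p r" by (simp add: z)
  qed
qed

text \<open>Coordinates adapted to the triangle on the reference edge: the edge is \<open>- 1 \<le> \<xi> \<le> 1\<close>, \<open>y\<close> is the
  distance to the edge in units of the inradius, the centroid is \<open>(0, 1)\<close> and the third
  vertex \<open>(0, 3)\<close>. Squared distances are \<open>3 \<xi>\<^sup>2 + y\<^sup>2\<close> in these units.\<close>

definition mesh_pt :: "real \<Rightarrow> real \<Rightarrow> complex" where
  "mesh_pt \<xi> y = tri_pt (1/2 + \<xi>/2) (y / 6)"

lemma mesh_pt_coords [simp]: "Re (mesh_pt \<xi> y) = 1/2 + \<xi>/2" "ht (mesh_pt \<xi> y) = y / 6"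
  by (simp_all add: mesh_pt_def)

lemma mesh_pt_eq: "z = mesh_pt (2 * Re z - 1) (6 * ht z)"
  by (simp add: complex_eq_ht_iff field_simps)

definition inradius :: real where "inradius = sqrt 3 / 6"

lemma inradius_pos: "0 < inradius" by (simp add: inradius_def)

lemma inradius_sq: "inradius\<^sup>2 = 1 / 12" by (simp add: inradius_def power_divide)

lemma dist_mesh_pt: "(dist (mesh_pt \<xi> y) (mesh_pt \<xi>' y'))\<^sup>2 = inradius\<^sup>2 * (3 * (\<xi> - \<xi>')\<^sup>2 + (y - y')\<^sup>2)"
  unfolding dist_ht inradius_sq by (simp add: power2_eq_square field_simps)

lemma mesh_pt_segment: "mesh_pt \<xi>0 y0 + s *\<^sub>R (mesh_pt \<xi>1 y1 - mesh_pt \<xi>0 y0) = mesh_pt (\<xi>0 + s * (\<xi>1 - \<xi>0)) (y0 + s * (y1 - y0))"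
  by (simp add: complex_eq_ht_iff field_simps)

section \<open>Edges framed by earlier and later bumps\<close>

text \<open>Balls have to lie in one filled stage, since the snowflake is the union of the interiors of
  the stages, which a priori might be smaller than the interior of the union.\<close>

definition in_stage :: "real \<Rightarrow> complex set \<Rightarrow> bool" where
  "in_stage a X \<longleftrightarrow> (\<exists>n. X \<subseteq> koch_region a n)"

lemma in_stage_subset: "in_stage a X \<Longrightarrow> Y \<subseteq> X \<Longrightarrow> in_stage a Y"
  unfolding in_stage_def by blast

text \<open>The reflection of the triangle that fixes the vertex \<open>0\<close>; it exchanges the reference edge with the other
  side through \<open>0\<close>.\<close>

definition mirror :: "complex \<Rightarrow> complex" where "mirror z = tri_top * cnj z"

lemma mirror_coords: "Re (mirror z) = Re z / 2 + 3 * ht z / 2" "ht (mirror z) = Re z / 2 - ht z / 2"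
  by (simp_all add: mirror_def mult_ht tri_top_def)

lemma mirror_mirror [simp]: "mirror (mirror z) = z" by (simp add: complex_eq_ht_iff mirror_coords field_simps)

text \<open>The part of the snowflake seen from an edge: the triangle on its left, the flank on its right,
  and on the two other sides of the triangle smaller and smaller bumps that accumulate at the endpoints of the
  edge. These other sides need not be edges of the polygon. The scaled bumps are what makes the notion hereditary: the
  side of a child's triangle at an endpoint of the edge is an initial piece of the side
  of the parent's triangle.\<close>

definition framed :: "real \<Rightarrow> (complex \<Rightarrow> complex) \<Rightarrow> bool" where
  "framed a f \<longleftrightarrow> in_stage a (f ` tri) \<and> (\<forall>n. in_stage a (f ` flank a n)) \<and>
     (\<forall>k. in_stage a ((\<lambda>z. f (mirror ((1/2 - a/2) ^ k *\<^sub>R z))) ` bump a)) \<and>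
     (\<forall>k. in_stage a ((\<lambda>z. f (flip (mirror ((1/2 - a/2) ^ k *\<^sub>R z)))) ` bump a))"

lemma framed_flip: "framed a f \<Longrightarrow> framed a (f \<circ> flip)"
  unfolding framed_def image_comp[symmetric] flip_tri flip_flank by simp

lemma child1_scale: "child1 a z = (1/2 - a/2) *\<^sub>R z"
  by (simp add: complex_eq_ht_iff child_coords)

lemma child2_flip_mirror: "child2 a (flip (mirror z)) = child3 a z"
  by (simp add: complex_eq_ht_iff child_coords mirror_coords field_simps)

lemma child34_comp: "child3 a = flip \<circ> child2 a \<circ> flip" "child4 a = flip \<circ> child1 a \<circ> flip"
   "child2 a = flip \<circ> child3 a \<circ> flip" "child1 a = flip \<circ> child4 a \<circ> flip"
  by (rule ext, simp add: flip_child)+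

context koch_parameter
begin

lemma in_stage_Un: "in_stage a X \<Longrightarrow> in_stage a Y \<Longrightarrow> in_stage a (X \<union> Y)"
proof -
  assume "in_stage a X" "in_stage a Y"
  then obtain m n where "X \<subseteq> koch_region a m" "Y \<subseteq> koch_region a n" unfolding in_stage_def by blast
  moreover have "koch_region a m \<subseteq> koch_region a (max m n)" "koch_region a n \<subseteq> koch_region a (max m n)"
    by (simp_all add: koch_region_mono)
  ultimately show ?thesis unfolding in_stage_def by (intro exI[of _ "max m n"]) blast
qed

lemma open_in_stage: "open U \<Longrightarrow> in_stage a U \<Longrightarrow> U \<subseteq> koch_snowflake a"
  unfolding in_stage_def koch_snowflake_eq using interior_maximal by blast

lemma bump_bounds: "z \<in> bump a \<Longrightarrow> ht z \<le> 0 \<and> - ht z \<le> a / 2 \<and> 0 \<le> Re z \<and> Re z - ht z \<le> 1 \<and> Re z \<le> 1"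
  using a_le_half by (simp add: bump_def)

lemma pow_bounds: "0 \<le> (1/2 - a/2) ^ k" "(1/2 - a/2) ^ k \<le> 1"
  using a_pos a_le_half by (simp_all add: power_le_one)

lemma scaled_bump_flank: "z \<in> bump a \<Longrightarrow> (1/2 - a/2) ^ k *\<^sub>R z \<in> flank a (Suc k)"
proof (induction k)
  case (Suc k)
  have "(1/2 - a/2) ^ Suc k *\<^sub>R z = child1 a ((1/2 - a/2) ^ k *\<^sub>R z)" by (simp add: child1_scale)
  then show ?case using Suc unfolding flank.simps(2)[of a "Suc k"] by blast
qed simp

text \<open>At the new vertex the scaled bumps point into the triangle of the parent, and at the old vertex they are those of
  the parent, one scale down.\<close>

lemma framed_child1:
  assumes "framed a f" shows "framed a (f \<circ> child1 a)"
  unfolding framed_def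
proof (intro conjI allI)
  have t: "in_stage a (f ` tri)" and fl: "\<And>n. in_stage a (f ` flank a n)"
    and w: "\<And>k. in_stage a ((\<lambda>z. f (mirror ((1/2 - a/2) ^ k *\<^sub>R z))) ` bump a)" using assms by (auto simp: framed_def)
  show "in_stage a ((f \<circ> child1 a) ` tri)"
    unfolding image_comp[symmetric] by (rule in_stage_subset[OF t]) (intro image_mono child_tri)
  show "in_stage a ((f \<circ> child1 a) ` flank a n)" for n
    unfolding image_comp[symmetric] by (rule in_stage_subset[OF fl[of "Suc n"]], rule image_mono) auto
  show "in_stage a ((\<lambda>z. (f \<circ> child1 a) (mirror ((1/2 - a/2) ^ k *\<^sub>R z))) ` bump a)" for k
  proof -
    have "(f \<circ> child1 a) (mirror ((1/2 - a/2) ^ k *\<^sub>R z)) = f (mirror ((1/2 - a/2) ^ Suc k *\<^sub>R z))" for z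
    proof -
      have "child1 a (mirror ((1/2 - a/2) ^ k *\<^sub>R z)) = mirror ((1/2 - a/2) ^ Suc k *\<^sub>R z)"
        by (simp add: complex_eq_ht_iff child_coords mirror_coords distrib_left right_diff_distrib mult.assoc)
      then show ?thesis by simp
    qed
    then show ?thesis using w[of "Suc k"] by simp
  qed
  show "in_stage a ((\<lambda>z. (f \<circ> child1 a) (flip (mirror ((1/2 - a/2) ^ k *\<^sub>R z)))) ` bump a)" for k
  proof (rule in_stage_subset[OF t], rule image_subsetI)
    fix z assume z: "z \<in> bump a"
    define \<mu> where "\<mu> = (1/2 - a/2) ^ k"
    define l where "l = 1/2 - a/2"
    note m = pow_bounds[of k, folded \<mu>_def]
    have l: "0 \<le> l" "l \<le> 1/2" using a_pos a_le_half by (auto simp: l_def)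
    define x h where "x = \<mu> * Re z" and "h = - (\<mu> * ht z)"
    have 0: "\<mu> * - ht z \<le> 1 * (1/2)" "\<mu> * (Re z - ht z) \<le> 1 * 1" using m bump_bounds[OF z] a_le_half by (intro mult_mono; simp)+
    have hx: "0 \<le> h" "h \<le> 1/2" "0 \<le> x" "x + h \<le> 1"
      using 0 m bump_bounds[OF z] unfolding x_def h_def by (auto simp: mult_nonneg_nonpos right_diff_distrib)
    have "child1 a (flip (mirror (\<mu> *\<^sub>R z))) \<in> tri"
    proof -
      have 1: "0 \<le> l * (x / 2 + h / 2)" "0 \<le> l * (1 - x + h)" using l hx by (auto intro!: mult_nonneg_nonneg)
      have 2: "l * (1 + 2 * h) \<le> 1/2 * 2" using l hx by (intro mult_mono) auto
      show ?thesis
        unfolding tri_def mem_Collect_eq child_coords flip_coords mirror_coords l_def[symmetric]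
        using 1 2 by (simp add: x_def h_def field_simps)
    qed
    then show "(f \<circ> child1 a) (flip (mirror ((1/2 - a/2) ^ k *\<^sub>R z))) \<in> f ` tri" by (simp add: \<mu>_def)
  qed
qed

text \<open>At the foot of the bump the scaled bumps are reflected across the base, hence lie in the
  triangle of the parent; at the apex they are bumps on the neighbouring edge.\<close>

lemma framed_child2:
  assumes "framed a f" shows "framed a (f \<circ> child2 a)"
  unfolding framed_def
proof (intro conjI allI)
  have t: "in_stage a (f ` tri)" and fl: "\<And>n. in_stage a (f ` flank a n)" using assms by (auto simp: framed_def)
  show "in_stage a ((f \<circ> child2 a) ` tri)"
    unfolding image_comp[symmetric] bump_eq_child2[symmetric]
    by (rule in_stage_subset[OF fl[of "Suc 0"]], rule image_mono) auto
  show "in_stage a ((f \<circ> child2 a) ` flank a n)" for n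
    unfolding image_comp[symmetric] by (rule in_stage_subset[OF fl[of "Suc n"]], rule image_mono) auto
  show "in_stage a ((\<lambda>z. (f \<circ> child2 a) (mirror ((1/2 - a/2) ^ k *\<^sub>R z))) ` bump a)" for k
  proof (rule in_stage_subset[OF t], rule image_subsetI)
    fix z assume z: "z \<in> bump a"
    define \<mu> where "\<mu> = (1/2 - a/2) ^ k"
    note m = pow_bounds[of k, folded \<mu>_def]
    define x h where "x = \<mu> * Re z" and "h = - (\<mu> * ht z)"
    have 0: "\<mu> * (Re z - ht z) \<le> 1 * 1" using m bump_bounds[OF z] a_le_half by (intro mult_mono; simp)+
    have hx: "0 \<le> h" "0 \<le> x" "x + h \<le> 1"
      using 0 m bump_bounds[OF z] unfolding x_def h_def by (auto simp: mult_nonneg_nonpos right_diff_distrib)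
    have c: "Re (child2 a (mirror (\<mu> *\<^sub>R z))) = 1/2 - a/2 + a * x" "ht (child2 a (mirror (\<mu> *\<^sub>R z))) = a * h"
      by (simp_all add: child_coords mirror_coords x_def h_def field_simps)
    have 1: "0 \<le> a * h" "0 \<le> a * x" "a * (x + h) \<le> a * 1" using a_pos hx by auto
    have "a * h \<le> 1/2 - a/2 + a * x"
    proof -
      have "- ht z \<le> Re z" using z a_le_half by (simp add: bump_def)
      then have "h \<le> x" unfolding h_def x_def using mult_left_mono[OF _ m(1), of "- ht z" "Re z"] by simp
      then have "a * h \<le> a * x" using a_pos by simp
      then show ?thesis using a_le_half by simp
    qed
    then have "child2 a (mirror (\<mu> *\<^sub>R z)) \<in> tri"
      unfolding tri_def mem_Collect_eq c using 1 a_le_half by (simp add: distrib_left)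
    then show "(f \<circ> child2 a) (mirror ((1/2 - a/2) ^ k *\<^sub>R z)) \<in> f ` tri" by (simp add: \<mu>_def)
  qed
  show "in_stage a ((\<lambda>z. (f \<circ> child2 a) (flip (mirror ((1/2 - a/2) ^ k *\<^sub>R z)))) ` bump a)" for k
  proof (rule in_stage_subset[OF fl[of "Suc (Suc k)"]], rule image_subsetI)
    fix z assume "z \<in> bump a"
    then have "child3 a ((1/2 - a/2) ^ k *\<^sub>R z) \<in> flank a (Suc (Suc k))"
      using scaled_bump_flank unfolding flank.simps(2)[of a "Suc k"] by blast
    then show "(f \<circ> child2 a) (flip (mirror ((1/2 - a/2) ^ k *\<^sub>R z))) \<in> f ` flank a (Suc (Suc k))"
      by (simp add: child2_flip_mirror)
  qed
qed

lemma framed_child3: "framed a f \<Longrightarrow> framed a (f \<circ> child3 a)"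
  using framed_flip[OF framed_child2[OF framed_flip]] by (simp add: child34_comp(1) comp_assoc)

lemma framed_id: "framed a (\<lambda>z. z)"
  unfolding framed_def
proof (intro conjI allI)
  have sub: "tri \<subseteq> koch_region a n" "flank a n \<subseteq> koch_region a n" "edge_map 1 tri_top ` flank a n \<subseteq> koch_region a n"
    "edge_map tri_top 0 ` flank a n \<subseteq> koch_region a n" for n
    unfolding koch_region_def by blast+
  show "in_stage a ((\<lambda>z. z) ` tri)" "in_stage a ((\<lambda>z. z) ` flank a n)" for n
    unfolding in_stage_def image_ident using sub by blast+
  have r: "mirror z = edge_map tri_top 0 (flip z)" "flip (mirror z) = edge_map 1 tri_top z" for z
    by (simp_all add: complex_eq_ht_iff mirror_coords rot_coords field_simps)
  have "mirror ((1/2 - a/2) ^ k *\<^sub>R z) \<in> koch_region a (Suc k)" "flip (mirror ((1/2 - a/2) ^ k *\<^sub>R z)) \<in> koch_region a (Suc k)"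
    if "z \<in> bump a" for z k
  proof -
    have 1: "(1/2 - a/2) ^ k *\<^sub>R z \<in> flank a (Suc k)" by (rule scaled_bump_flank[OF that])
    then have "flip ((1/2 - a/2) ^ k *\<^sub>R z) \<in> flank a (Suc k)" using flip_flank[of a "Suc k"] by blast
    then show "mirror ((1/2 - a/2) ^ k *\<^sub>R z) \<in> koch_region a (Suc k)"
      unfolding r by (rule subsetD[OF sub(4) imageI])
    show "flip (mirror ((1/2 - a/2) ^ k *\<^sub>R z)) \<in> koch_region a (Suc k)"
      unfolding r(2) by (rule subsetD[OF sub(3) imageI[OF 1]])
  qed
  then show "in_stage a ((\<lambda>z. mirror ((1/2 - a/2) ^ k *\<^sub>R z)) ` bump a)" "in_stage a ((\<lambda>z. flip (mirror ((1/2 - a/2) ^ k *\<^sub>R z))) ` bump a)" for k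
    unfolding in_stage_def image_subset_iff by metis+
qed

lemma rot_koch_region: "edge_map 1 tri_top ` koch_region a n \<subseteq> koch_region a n" "edge_map tri_top 0 ` koch_region a n \<subseteq> koch_region a n"
proof -
  have "edge_map 1 tri_top ` koch_region a n = tri \<union> edge_map 1 tri_top ` flank a n \<union> edge_map tri_top 0 ` flank a n \<union> flank a n"
    unfolding koch_region_def image_Un rot_tri by (simp add: image_image rot_rot)
  then show 1: "edge_map 1 tri_top ` koch_region a n \<subseteq> koch_region a n" unfolding koch_region_def by blast
  have "edge_map tri_top 0 ` koch_region a n = edge_map 1 tri_top ` edge_map 1 tri_top ` koch_region a n" by (simp add: image_image rot_rot)
  then show "edge_map tri_top 0 ` koch_region a n \<subseteq> koch_region a n" using 1 by blast
qed

lemma framed_rot: "framed a (edge_map 1 tri_top)" "framed a (edge_map tri_top 0)"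
proof -
  have st: "in_stage a (h ` X)" if "\<And>n. h ` koch_region a n \<subseteq> koch_region a n" "in_stage a X" for h X
    using that unfolding in_stage_def by (meson image_mono order_trans)
  have "framed a h" if h: "\<And>n. h ` koch_region a n \<subseteq> koch_region a n" for h
    unfolding framed_def
  proof (intro conjI allI)
    show "in_stage a (h ` tri)" "in_stage a (h ` flank a n)" for n
      using framed_id by (auto intro!: st[OF h] simp: framed_def)
    show "in_stage a ((\<lambda>z. h (mirror ((1/2 - a/2) ^ k *\<^sub>R z))) ` bump a)" for k
      using st[OF h, of "(\<lambda>z. mirror ((1/2 - a/2) ^ k *\<^sub>R z)) ` bump a"] framed_id by (simp add: framed_def image_image)
    show "in_stage a ((\<lambda>z. h (flip (mirror ((1/2 - a/2) ^ k *\<^sub>R z)))) ` bump a)" for k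
      using st[OF h, of "(\<lambda>z. flip (mirror ((1/2 - a/2) ^ k *\<^sub>R z))) ` bump a"] framed_id by (simp add: framed_def image_image)
  qed
  then show "framed a (edge_map 1 tri_top)" "framed a (edge_map tri_top 0)" using rot_koch_region by blast+
qed

end

section \<open>Balls inside a triangle with bumps\<close>

lemma mesh_linear_bounds:
  fixes X Y \<rho> :: real
  assumes "3 * X\<^sup>2 + Y\<^sup>2 < \<rho>\<^sup>2" "0 < \<rho>"
  shows "\<bar>Y\<bar> < \<rho>" "\<bar>3 * X + Y\<bar> < 2 * \<rho>" "\<bar>3 * X - Y\<bar> < 2 * \<rho>"
proof -
  have "\<bar>Y\<bar>\<^sup>2 < \<rho>\<^sup>2" unfolding power2_abs using assms(1) zero_le_power2[of X] by linarith
  then show "\<bar>Y\<bar> < \<rho>" by (rule power2_less_imp_less) (use assms in simp)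
  have 1: "(3 * X + Y)\<^sup>2 = 4 * (3 * X\<^sup>2 + Y\<^sup>2) - 3 * (X - Y)\<^sup>2" "(3 * X - Y)\<^sup>2 = 4 * (3 * X\<^sup>2 + Y\<^sup>2) - 3 * (X + Y)\<^sup>2"
    by (simp_all add: power2_eq_square algebra_simps)
  have 2: "(2 * \<rho>)\<^sup>2 = 4 * \<rho>\<^sup>2" by (simp add: power2_eq_square)
  have 3: "4 * S - 3 * D < 4 * r" if "S < r" "0 \<le> D" for S D r :: real using that by linarith
  have "\<bar>3 * X + Y\<bar>\<^sup>2 < (2 * \<rho>)\<^sup>2" unfolding power2_abs 1 2 by (rule 3[OF assms(1)]) simp
  then show "\<bar>3 * X + Y\<bar> < 2 * \<rho>" by (rule power2_less_imp_less) (use assms in simp)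
  have "\<bar>3 * X - Y\<bar>\<^sup>2 < (2 * \<rho>)\<^sup>2" unfolding power2_abs 1 2 by (rule 3[OF assms(1)]) simp
  then show "\<bar>3 * X - Y\<bar> < 2 * \<rho>" by (rule power2_less_imp_less) (use assms in simp)
qed

lemma mesh_pt_tri: "mesh_pt \<xi> y \<in> tri \<longleftrightarrow> 0 \<le> y \<and> y \<le> 3 * (1 + \<xi>) \<and> y \<le> 3 * (1 - \<xi>)"
  by (auto simp: tri_def)

lemma mesh_pt_bump: "mesh_pt \<xi> y \<in> bump a \<longleftrightarrow> y \<le> 0 \<and> - y \<le> 3 * (a - \<xi>) \<and> - y \<le> 3 * (a + \<xi>)"
proof -
  have "1/2 - a/2 - y / 6 \<le> 1/2 + \<xi>/2 \<longleftrightarrow> - y \<le> 3 * (a + \<xi>)" by (rule iffI) (simp_all add: algebra_simps)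
  moreover have "1/2 + \<xi>/2 \<le> 1/2 + a/2 + y / 6 \<longleftrightarrow> - y \<le> 3 * (a - \<xi>)" by (rule iffI) (simp_all add: algebra_simps)
  ultimately show ?thesis by (auto simp: bump_def)
qed

text \<open>The triangle on the reference edge and its reflection in the side opposite to the vertex \<open>0\<close>.\<close>

definition rhomb :: "complex set" where
  "rhomb = {z. 0 \<le> ht z \<and> ht z \<le> 1/2 \<and> ht z \<le> Re z \<and> Re z - 1 \<le> ht z}"

lemma mesh_pt_rhomb: "mesh_pt \<xi> y \<in> rhomb \<longleftrightarrow> 0 \<le> y \<and> y \<le> 3 \<and> y \<le> 3 * (1 + \<xi>) \<and> 3 * (\<xi> - 1) \<le> y"
proof -
  have "1/2 + \<xi>/2 - 1 \<le> y / 6 \<longleftrightarrow> 3 * (\<xi> - 1) \<le> y" by (rule iffI) (simp_all add: algebra_simps)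
  then show ?thesis by (auto simp: rhomb_def)
qed

lemma mirror_mesh_pt: "mirror (mesh_pt \<xi> y) = mesh_pt ((\<xi> + y - 1) / 2) ((3 + 3 * \<xi> - y) / 2)"
  by (simp add: complex_eq_ht_iff mirror_coords field_simps)

lemma flip_mesh_pt: "flip (mesh_pt \<xi> y) = mesh_pt (- \<xi>) y"
  by (simp add: complex_eq_ht_iff field_simps)

lemma ball_in_tri:
  fixes \<rho> :: real
  assumes "\<rho> \<le> y0" "2 * \<rho> \<le> 3 * (1 + \<xi>0) - y0" "2 * \<rho> \<le> 3 * (1 - \<xi>0) - y0"
    "0 < \<rho>" "3 * (\<xi> - \<xi>0)\<^sup>2 + (y - y0)\<^sup>2 < \<rho>\<^sup>2"
  shows "mesh_pt \<xi> y \<in> tri"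
  using mesh_linear_bounds[OF assms(5,4)] assms(1-3) unfolding mesh_pt_tri by (simp add: abs_if split: if_splits)

text \<open>The part of the ball below the reference edge stays in the bump. Three criteria follow:
  the ball does not reach the edge; its centre lies on the axis of the bump and it stays clear of the sides; or
  it stays clear of the end of the base.\<close>

definition bump_below :: "real \<Rightarrow> real \<Rightarrow> real \<Rightarrow> real \<Rightarrow> bool" where
  "bump_below a \<rho> \<xi>0 y0 \<longleftrightarrow> (\<forall>\<xi> y. y < 0 \<longrightarrow> 3 * (\<xi> - \<xi>0)\<^sup>2 + (y - y0)\<^sup>2 < \<rho>\<^sup>2 \<longrightarrow> mesh_pt \<xi> y \<in> bump a)"

lemma bump_below_high: "0 < \<rho> \<Longrightarrow> \<rho> \<le> y0 \<Longrightarrow> bump_below a \<rho> \<xi>0 y0"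
  unfolding bump_below_def using mesh_linear_bounds(1)[of "\<xi> - \<xi>0" "y - y0" \<rho> for \<xi> y] by fastforce

lemma bump_below_axis:
  assumes "0 < \<rho>" "2 * \<rho> - y0 \<le> 3 * a" shows "bump_below a \<rho> 0 y0"
  unfolding bump_below_def mesh_pt_bump
proof (intro allI impI)
  fix \<xi> y :: real assume "y < 0" "3 * (\<xi> - 0)\<^sup>2 + (y - y0)\<^sup>2 < \<rho>\<^sup>2"
  with mesh_linear_bounds[OF this(2) assms(1)] assms(2) show "y \<le> 0 \<and> - y \<le> 3 * (a - \<xi>) \<and> - y \<le> 3 * (a + \<xi>)"
    by (simp add: abs_if split: if_splits)
qed

text \<open>The points of the lower half plane beyond a side of the bump form a wedge, whose vertex is an end of the
  base. The centre lies in the normal cone of the wedge at this vertex, which therefore is the point of the wedge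
  nearest to the centre.\<close>

lemma bump_below_corner:
  assumes "0 \<le> \<xi>0" "\<xi>0 \<le> a" "\<xi>0 + a \<le> y0" "\<rho>\<^sup>2 \<le> 3 * (a - \<xi>0)\<^sup>2 + y0\<^sup>2"
  shows "bump_below a \<rho> \<xi>0 y0"
  unfolding bump_below_def mesh_pt_bump
proof (intro allI impI)
  fix \<xi> y :: real assume y: "y < 0" and d: "3 * (\<xi> - \<xi>0)\<^sup>2 + (y - y0)\<^sup>2 < \<rho>\<^sup>2"
  have "- y \<le> 3 * (a - \<xi>)"
  proof (rule ccontr)
    assume n: "\<not> ?thesis"
    define \<delta> e where "\<delta> = \<xi> - a" and "e = a - \<xi>0"
    have 1: "0 \<le> e * (3 * \<delta> - y)" using n assms by (intro mult_nonneg_nonneg) (auto simp: \<delta>_def e_def)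
    have 2: "0 \<le> (y0 - e) * (- y)" using y assms by (intro mult_nonneg_nonneg) (auto simp: e_def)
    have "3 * (\<xi> - \<xi>0)\<^sup>2 + (y - y0)\<^sup>2 = 3 * e\<^sup>2 + y0\<^sup>2 + 3 * \<delta>\<^sup>2 + y\<^sup>2 + 2 * (e * (3 * \<delta> - y)) + 2 * ((y0 - e) * (- y))"
      by (simp add: \<delta>_def e_def power2_eq_square algebra_simps)
    moreover have "0 \<le> \<delta>\<^sup>2" "0 \<le> y\<^sup>2" by simp_all
    ultimately show False using 1 2 d assms(4) unfolding e_def[symmetric] by linarith
  qed
  moreover have "- y \<le> 3 * (a + \<xi>)"
  proof (rule ccontr)
    assume n: "\<not> ?thesis"
    define \<delta> e where "\<delta> = \<xi> + a" and "e = a + \<xi>0"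
    have 1: "0 \<le> e * (- 3 * \<delta> - y)" using n assms by (intro mult_nonneg_nonneg) (auto simp: \<delta>_def e_def)
    have 2: "0 \<le> (y0 - e) * (- y)" using y assms by (intro mult_nonneg_nonneg) (auto simp: e_def)
    have "3 * (\<xi> - \<xi>0)\<^sup>2 + (y - y0)\<^sup>2 = 3 * e\<^sup>2 + y0\<^sup>2 + 3 * \<delta>\<^sup>2 + y\<^sup>2 + 2 * (e * (- 3 * \<delta> - y)) + 2 * ((y0 - e) * (- y))"
      by (simp add: \<delta>_def e_def power2_eq_square algebra_simps)
    moreover have "0 \<le> \<delta>\<^sup>2" "0 \<le> y\<^sup>2" by simp_all
    moreover have "(a - \<xi>0)\<^sup>2 \<le> e\<^sup>2" unfolding e_def using assms by (intro power_mono) auto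
    ultimately show False using 1 2 d assms(4) by linarith
  qed
  ultimately show "y \<le> 0 \<and> - y \<le> 3 * (a - \<xi>) \<and> - y \<le> 3 * (a + \<xi>)" using y by simp
qed

text \<open>Reflection in the bisector at \<open>0\<close> takes points above the bisector nearer to every point below it.
  Thus the bump on the other side through \<open>0\<close> is dealt with by the bump on the reference edge.\<close>

lemma mirror_closer:
  fixes y y0 \<xi> \<xi>0 :: real
  assumes "y0 \<le> 1 + \<xi>0" "1 + \<xi> \<le> y"
  shows "3 * ((\<xi> + y - 1) / 2 - \<xi>0)\<^sup>2 + ((3 + 3 * \<xi> - y) / 2 - y0)\<^sup>2 \<le> 3 * (\<xi> - \<xi>0)\<^sup>2 + (y - y0)\<^sup>2"
proof -
  have "3 * ((\<xi> + y - 1) / 2 - \<xi>0)\<^sup>2 + ((3 + 3 * \<xi> - y) / 2 - y0)\<^sup>2 =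
     3 * (\<xi> - \<xi>0)\<^sup>2 + (y - y0)\<^sup>2 - 3 * ((y - 1 - \<xi>) * (1 + \<xi>0 - y0))"
    by (simp add: power2_eq_square field_simps)
  moreover have "0 \<le> (y - 1 - \<xi>) * (1 + \<xi>0 - y0)" using assms by (intro mult_nonneg_nonneg) auto
  ultimately show ?thesis by linarith
qed

lemma mirror_bump_beyond:
  assumes b: "bump_below a \<rho> \<xi>0 y0" and "y0 \<le> 1 + \<xi>0" "3 * (\<xi> - \<xi>0)\<^sup>2 + (y - y0)\<^sup>2 < \<rho>\<^sup>2" "3 * (1 + \<xi>) < y" "0 \<le> y"
  shows "mesh_pt \<xi> y \<in> mirror ` bump a"
proof -
  have "mirror (mesh_pt \<xi> y) \<in> bump a"
    unfolding mirror_mesh_pt using b mirror_closer[of y0 \<xi>0 \<xi> y] assms unfolding bump_below_def by auto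
  then have "mirror (mirror (mesh_pt \<xi> y)) \<in> mirror ` bump a" by (rule imageI)
  then show ?thesis by simp
qed

lemma ball_in_rhomb:
  fixes \<rho> :: real
  assumes b: "bump_below a \<rho> \<xi>0 y0" and "y0 \<le> 1 + \<xi>0" "\<rho> \<le> 3 - y0" "2 * \<rho> \<le> y0 + 3 - 3 * \<xi>0"
    "0 < \<rho>" and d: "3 * (\<xi> - \<xi>0)\<^sup>2 + (y - y0)\<^sup>2 < \<rho>\<^sup>2"
  shows "mesh_pt \<xi> y \<in> rhomb \<union> bump a \<union> mirror ` bump a"
proof -
  consider "y < 0" | "0 \<le> y" "3 * (1 + \<xi>) < y" | "0 \<le> y" "y \<le> 3 * (1 + \<xi>)" by linarith
  then show ?thesis
  proof cases
    case 1 then show ?thesis using b d by (auto simp: bump_below_def)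
  next
    case 2 then show ?thesis using mirror_bump_beyond[OF b assms(2) d] by auto
  next
    case 3
    have "y \<le> 3" "3 * (\<xi> - 1) \<le> y"
      using mesh_linear_bounds[OF d assms(5)] assms(3,4) by (simp_all add: abs_if split: if_splits)
    then show ?thesis using 3 by (auto simp: mesh_pt_rhomb)
  qed
qed

lemma ball_in_star:
  fixes \<rho> :: real
  assumes b: "bump_below a \<rho> 0 y0" and "y0 \<le> 1" and d: "3 * (\<xi> - 0)\<^sup>2 + (y - y0)\<^sup>2 < \<rho>\<^sup>2"
  shows "mesh_pt \<xi> y \<in> tri \<union> bump a \<union> mirror ` bump a \<union> flip ` mirror ` bump a"
proof -
  consider "y < 0" | "0 \<le> y" "3 * (1 + \<xi>) < y" | "0 \<le> y" "3 * (1 - \<xi>) < y" | "mesh_pt \<xi> y \<in> tri" unfolding mesh_pt_tri by linarith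
  then show ?thesis
  proof cases
    case 1 then show ?thesis using b d by (auto simp: bump_below_def)
  next
    case 2 then show ?thesis using mirror_bump_beyond[OF b _ d] assms(2) by auto
  next
    case 3
    have "mesh_pt (- \<xi>) y \<in> mirror ` bump a"
      using mirror_bump_beyond[OF b, of "- \<xi>" y] 3 d assms(2) by simp
    then have "flip (mesh_pt (- \<xi>) y) \<in> flip ` mirror ` bump a" by (rule imageI)
    then show ?thesis by (simp add: flip_mesh_pt)
  qed auto
qed

section \<open>Inequalities for the cut corner\<close>

lemma quadratic_nonneg:
  fixes A B C x :: real
  assumes "0 < A" "B\<^sup>2 \<le> 4 * A * C" shows "0 \<le> A * x\<^sup>2 + B * x + C"
proof -
  have "4 * A * (A * x\<^sup>2 + B * x + C) = (2 * A * x + B)\<^sup>2 + (4 * A * C - B\<^sup>2)"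
    by (simp add: power2_eq_square algebra_simps)
  also have "\<dots> \<ge> 0" using assms by simp
  finally show ?thesis using assms(1) by (simp add: zero_le_mult_iff)
qed

text \<open>On the chord that cuts the corner, the ball avoids the end of the base of the bump. The bound by a
  linear function of \<open>a\<close> and \<open>q\<close> is tight at \<open>a = 1/3\<close>, and makes the claim quadratic in \<open>a\<close>.\<close>

lemma cut_inequality:
  fixes a q :: real
  assumes "1/3 \<le> a" "a \<le> 1/2" "0 \<le> q" "q \<le> 1"
  shows "(3/2 * a + 3/4 * (1 - a) * (3/4 + q * (7/16)))\<^sup>2 \<le> 3 * (a - q / 8)\<^sup>2 + (3/4 + q * (3/8))\<^sup>2"
proof -
  have "(1 - a) * q \<le> 2/3 * q" using assms by (intro mult_right_mono) auto
  moreover have "3/2 * a + 3/4 * (1 - a) * (3/4 + q * (7/16)) = 9/16 + 15/16 * a + 21/64 * ((1 - a) * q)"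
    by (simp add: field_simps)
  ultimately have "3/2 * a + 3/4 * (1 - a) * (3/4 + q * (7/16)) \<le> 9/16 + 15/16 * a + 7/32 * q"
    by linarith
  moreover have "0 \<le> 3/2 * a + 3/4 * (1 - a) * (3/4 + q * (7/16))" using assms by (intro add_nonneg_nonneg mult_nonneg_nonneg) auto
  ultimately have "(3/2 * a + 3/4 * (1 - a) * (3/4 + q * (7/16)))\<^sup>2 \<le> (9/16 + 15/16 * a + 7/32 * q)\<^sup>2" by (intro power_mono)
  also have "\<dots> \<le> 3 * (a - q / 8)\<^sup>2 + (3/4 + q * (3/8))\<^sup>2"
  proof -
    define B where "B = - (3/4) * q - 15/8 * (9/16 + 7/32 * q)"
    define C where "C = 3 * q\<^sup>2 / 64 + (3/4 + 3/8 * q)\<^sup>2 - (9/16 + 7/32 * q)\<^sup>2"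
    have qq: "q\<^sup>2 \<le> 1" using assms by (simp add: power_le_one)
    have "4 * (543/256) * C - B\<^sup>2 = (4 * (543/256) * (3/64 + 9/64 - 49/1024) - (297/256)\<^sup>2) * q\<^sup>2
        + (4 * (543/256) * (9/16 - 63/256) - 2 * (297/256) * (135/128)) * q + (4 * (543/256) * (63/256) - (135/128)\<^sup>2)"
      by (simp add: B_def C_def power2_eq_square algebra_simps)
    also have "\<dots> \<ge> 0" using qq assms(3) zero_le_power2[of q] by (simp add: power2_eq_square)
    finally have "0 \<le> 543/256 * a\<^sup>2 + B * a + C" by (intro quadratic_nonneg) auto
    then show ?thesis by (simp add: B_def C_def power2_eq_square algebra_simps)
  qed
  finally show ?thesis .
qed

text \<open>The same at the points \<open>(x, 1 + x)\<close> of the ray from the vertex through the centroid. In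
  the variable \<open>d = a - x\<close> the claim is \<open>A d\<^sup>2 + B d + C \<ge> 0\<close>, and the discriminant is estimated by way of
  \<open>- B \<le> 22/5 a - 7/5\<close>, \<open>A \<ge> 3\<close> and \<open>1 + a + R \<ge> 31/12\<close>.\<close>

lemma ray_inequality:
  fixes a x :: real
  assumes "1/3 \<le> a" "a \<le> 1/2"
  shows "(3/2 * a + 3/4 * (1 - a) * (15/16 + 2 * x))\<^sup>2 \<le> 3 * (a - x)\<^sup>2 + (1 + x)\<^sup>2"
proof -
  define d where "d = a - x"
  define R where "R = 45/64 + 147/64 * a - 3/2 * a\<^sup>2"
  define A where "A = 4 - 9/4 * (1 - a)\<^sup>2"
  define B where "B = 3 * (1 - a) * R - 2 * (1 + a)"
  define C where "C = (1 + a)\<^sup>2 - R\<^sup>2"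
  (* P1 bounds the cubic below: on [1/3, 1/2] it lies above its chord by this product. *)
  have P: "0 \<le> (a - 1/3) * (1/2 - a)" using assms by simp
  have P1: "0 \<le> (a - 1/3) * (1/2 - a) * (489/64 - 9/2 * a)" using P assms by (intro mult_nonneg_nonneg) auto
  have "(1 - a)\<^sup>2 \<le> (2/3)\<^sup>2" using assms by (intro power_mono) auto
  then have A: "3 \<le> A" by (simp add: A_def power2_eq_square)
  have B1: "- B \<le> 22/5 * a - 7/5"
  proof -
    have "22/5 * a - 7/5 + B = (a - 1/3) * (1/2 - a) * (489/64 - 9/2 * a) + (41/640 * a - 11/640)"
      unfolding B_def R_def by (simp add: power2_eq_square field_simps)
    then show ?thesis using P1 assms by linarith
  qed
  have B2: "B \<le> 0"
  proof -
    define U where "U = 53/16 * (a - 1/3)"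
    define V where "V = (a - 1/3)\<^sup>2 * (441/64 - 9/2 * (a - 1/3))"
    (* Taylor expansion of the cubic B at 1/3. *)
    have "B = - (1/16) - U - V"
      unfolding B_def R_def U_def V_def by (simp add: power2_eq_square field_simps)
    moreover have "0 \<le> V" unfolding V_def using assms by (intro mult_nonneg_nonneg) auto
    moreover have "0 \<le> U" unfolding U_def using assms by simp
    ultimately show ?thesis by linarith
  qed
  have "B\<^sup>2 \<le> (22/5 * a - 7/5)\<^sup>2" using power_mono[of "- B" "22/5 * a - 7/5" 2] B1 B2 by simp
  also have "\<dots> \<le> 31 * (19/64 - 83/64 * a + 3/2 * a\<^sup>2)"
  proof -
    have "0 \<le> (31 * 3/2 - 484/25) * a\<^sup>2 + (2 * 22/5 * 7/5 - 31 * 83/64) * a + (31 * 19/64 - 49/25)"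
      by (rule quadratic_nonneg) (simp_all add: power2_eq_square)
    then show ?thesis by (simp add: power2_eq_square algebra_simps)
  qed
  also have "\<dots> \<le> 12 * C"
  proof -
    have 1: "0 \<le> 19/64 - 83/64 * a + 3/2 * a\<^sup>2"
      using quadratic_nonneg[of "3/2" "- 83/64" "19/64" a] by (simp add: power2_eq_square algebra_simps)
    have 2: "31/12 \<le> 1 + a + R"
    proof -
      define W where "W = (a - 1/3) * (1/2 - a)"
      have "1 + a + R - 31/12 = 3/2 * W + 131/64 * a - 121/192"
        by (simp add: R_def W_def power2_eq_square algebra_simps)
      then show ?thesis using P[folded W_def] assms by linarith
    qed
    have "C = (19/64 - 83/64 * a + 3/2 * a\<^sup>2) * (1 + a + R)" by (simp add: C_def R_def power2_eq_square algebra_simps)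
    moreover have "(19/64 - 83/64 * a + 3/2 * a\<^sup>2) * (31/12) \<le> (19/64 - 83/64 * a + 3/2 * a\<^sup>2) * (1 + a + R)"
      by (rule mult_left_mono[OF 2 1])
    ultimately show ?thesis by simp
  qed
  finally have BC: "B\<^sup>2 \<le> 4 * 3 * C" by simp
  then have "0 \<le> C" using zero_le_power2[of B] by linarith
  then have "4 * 3 * C \<le> 4 * A * C" using A by (intro mult_right_mono) auto
  then have "0 \<le> A * d\<^sup>2 + B * d + C" using BC A by (intro quadratic_nonneg) auto
  moreover have "A * d\<^sup>2 + B * d + C = 3 * (a - x)\<^sup>2 + (1 + x)\<^sup>2 - (3/2 * a + 3/4 * (1 - a) * (15/16 + 2 * x))\<^sup>2"
  proof -
    have 1: "3/2 * a + 3/4 * (1 - a) * (15/16 + 2 * x) = R - 3/2 * (1 - a) * d" by (simp add: R_def d_def power2_eq_square field_simps)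
    have 2: "1 + x = 1 + a - d" by (simp add: d_def)
    show ?thesis unfolding A_def B_def C_def 1 2 d_def[symmetric] by (simp add: power2_eq_square field_simps)
  qed
  ultimately show ?thesis by linarith
qed

text \<open>Beyond the end of the base the ball stays above the edge.\<close>

lemma ray_inequality_far:
  fixes a x :: real
  assumes "1/3 \<le> a" "a \<le> 1/2" "a \<le> x"
  shows "3/2 * a + 3/4 * (1 - a) * (15/16 + 2 * x) \<le> 1 + x"
proof -
  have "0 \<le> (3/2 * a - 1/2) * (x - a)" using assms by (intro mult_nonneg_nonneg) auto
  moreover have "0 \<le> 3/2 * a\<^sup>2 + (-83/64) * a + 19/64"
    by (rule quadratic_nonneg) (simp_all add: power2_eq_square)
  moreover have "1 + x - (3/2 * a + 3/4 * (1 - a) * (15/16 + 2 * x)) = (3/2 * a - 1/2) * (x - a) + (3/2 * a\<^sup>2 + (-83/64) * a + 19/64)"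
    by (simp add: power2_eq_square field_simps)
  ultimately show ?thesis by linarith
qed

section \<open>The John curve\<close>

context john_parameter
begin

lemma c_ge: "2 \<le> c" "4 \<le> 3 * c * (1 - a)"
proof -
  show "2 \<le> c" by (simp add: c_def)
  have "4 / (3 * (1 - a)) \<le> c" by (simp add: c_def)
  then show "4 \<le> 3 * c * (1 - a)" using a_le_half by (simp add: pos_divide_le_eq algebra_simps)
qed

lemma c_small: "a \<le> 1/3 \<Longrightarrow> c = 2"
  using a_le_half by (simp add: c_def max_def field_simps)

lemma c_big: "1/3 \<le> a \<Longrightarrow> 3 * c * (1 - a) = 4" "1/3 \<le> a \<Longrightarrow> x / c = 3/4 * (1 - a) * x"
proof -
  assume "1/3 \<le> a"
  then have "2 \<le> 4 / (3 * (1 - a))" using a_le_half by (simp add: pos_le_divide_eq)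
  then have c: "c = 4 / (3 * (1 - a))" by (simp add: c_def max_def)
  then show "3 * c * (1 - a) = 4" using a_le_half unfolding c by (simp add: field_simps)
  show "x / c = 3/4 * (1 - a) * x" using a_le_half by (simp add: c)
qed

text \<open>A segment is appended to the curve in the frame of an edge; all lengths are in units of the
  inradius of the triangle on this edge, which is \<open>k * inradius\<close>.\<close>

lemma mesh_step:
  assumes r: "reaches c (koch_snowflake a) x (f (mesh_pt \<xi>0 y0)) (k * (inradius * T))" and f: "similarity k f"
    and R: "in_stage a (f ` R)" and L: "0 \<le> L" "3 * (\<xi>1 - \<xi>0)\<^sup>2 + (y1 - y0)\<^sup>2 \<le> L\<^sup>2"
    and b: "\<And>s \<xi> y. 0 \<le> s \<Longrightarrow> s \<le> 1 \<Longrightarrow> 0 < (T + s * L) / c \<Longrightarrow>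
       3 * (\<xi> - (\<xi>0 + s * (\<xi>1 - \<xi>0)))\<^sup>2 + (y - (y0 + s * (y1 - y0)))\<^sup>2 < ((T + s * L) / c)\<^sup>2 \<Longrightarrow> mesh_pt \<xi> y \<in> R"
    and T': "k * (inradius * (T + L)) \<le> T'"
  shows "reaches c (koch_snowflake a) x (f (mesh_pt \<xi>1 y1)) T'"
proof -
  have k: "0 < k" and dist: "\<And>x y. dist (f x) (f y) = k * dist x y"
    and aff: "\<And>x y s. f (x + s *\<^sub>R (y - x)) = f x + s *\<^sub>R (f y - f x)" using f by (auto simp: similarity_def)
  have ki: "0 \<le> k * inradius" using k inradius_pos by simp
  define D where "D = dist (f (mesh_pt \<xi>0 y0)) (f (mesh_pt \<xi>1 y1))"
  have "(dist (mesh_pt \<xi>0 y0) (mesh_pt \<xi>1 y1))\<^sup>2 \<le> (inradius * L)\<^sup>2"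
    unfolding dist_mesh_pt power_mult_distrib using L(2) inradius_pos
    by (intro mult_left_mono) (simp_all add: power2_commute)
  then have "dist (mesh_pt \<xi>0 y0) (mesh_pt \<xi>1 y1) \<le> inradius * L"
    by (rule power2_le_imp_le) (use L inradius_pos in simp)
  then have D: "D \<le> k * inradius * L" using k by (simp add: D_def dist)
  show ?thesis
  proof (rule reaches_segment[OF r])
    show "0 < c" using c_ge by simp
    show "k * (inradius * T) + dist (f (mesh_pt \<xi>0 y0)) (f (mesh_pt \<xi>1 y1)) \<le> T'"
      using D T' by (simp add: D_def algebra_simps)
    fix s :: real assume s: "0 \<le> s" "s \<le> 1"
    define \<rho> where "\<rho> = (T + s * L) / c"
    define p where "p = mesh_pt (\<xi>0 + s * (\<xi>1 - \<xi>0)) (y0 + s * (y1 - y0))"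
    have "s * D \<le> s * (k * inradius * L)" using D s by (intro mult_left_mono)
    then have "k * (inradius * T) + s * D \<le> k * inradius * (T + s * L)" by (simp add: algebra_simps)
    then have "(k * (inradius * T) + s * D) / c \<le> k * inradius * (T + s * L) / c" using c_ge by (intro divide_right_mono) auto
    also have "\<dots> = k * (inradius * \<rho>)" by (simp add: \<rho>_def)
    finally have rad: "(k * (inradius * T) + s * D) / c \<le> k * (inradius * \<rho>)" .
    have pt: "f (mesh_pt \<xi>0 y0) + s *\<^sub>R (f (mesh_pt \<xi>1 y1) - f (mesh_pt \<xi>0 y0)) = f p"
      unfolding aff[symmetric] mesh_pt_segment p_def ..
    have "ball p (inradius * \<rho>) \<subseteq> R"
    proof
      fix z assume z: "z \<in> ball p (inradius * \<rho>)"
      then have \<rho>: "0 < \<rho>" using inradius_pos by (metis mem_ball zero_le_dist le_less_trans zero_less_mult_pos)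
      define \<xi> y where "\<xi> = 2 * Re z - 1" and "y = 6 * ht z"
      have z_eq: "z = mesh_pt \<xi> y" unfolding \<xi>_def y_def by (rule mesh_pt_eq)
      have "(dist z p)\<^sup>2 < (inradius * \<rho>)\<^sup>2" using z by (intro power_strict_mono) (auto simp: dist_commute)
      then have "3 * (\<xi> - (\<xi>0 + s * (\<xi>1 - \<xi>0)))\<^sup>2 + (y - (y0 + s * (y1 - y0)))\<^sup>2 < \<rho>\<^sup>2"
        unfolding z_eq p_def dist_mesh_pt power_mult_distrib using inradius_pos by (simp only: mult_less_cancel_left_pos zero_less_power)
      then show "z \<in> R" unfolding z_eq using b[OF s] \<rho> unfolding \<rho>_def by blast
    qed
    then have "in_stage a (ball (f p) (k * (inradius * \<rho>)))"
      using R unfolding similarity_ball[OF f] by (meson image_mono in_stage_subset)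
    then have "ball (f p) (k * (inradius * \<rho>)) \<subseteq> koch_snowflake a" by (intro open_in_stage) auto
    then show "ball (f (mesh_pt \<xi>0 y0) + s *\<^sub>R (f (mesh_pt \<xi>1 y1) - f (mesh_pt \<xi>0 y0)))
        ((k * (inradius * T) + s * dist (f (mesh_pt \<xi>0 y0)) (f (mesh_pt \<xi>1 y1))) / c) \<subseteq> koch_snowflake a"
      unfolding pt D_def[symmetric] using rad subset_ball by blast
  qed
qed

text \<open>The two ways in which a curve may arrive at an edge: at the centroid of its triangle, having stayed short,
  or at its midpoint, coming out of the bump.\<close>

definition edge_state :: "real \<Rightarrow> (complex \<Rightarrow> complex) \<Rightarrow> complex \<Rightarrow> bool" where
  "edge_state k f x \<longleftrightarrow> reaches c (koch_snowflake a) x (f (mesh_pt 0 1)) (k * (inradius * c)) \<or>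
     reaches c (koch_snowflake a) x (f (mesh_pt 0 0)) (k * (inradius * (3/2 * c * a)))"

lemma edge_state_flip: "edge_state k (f \<circ> flip) x \<longleftrightarrow> edge_state k f x"
  by (simp add: edge_state_def flip_mesh_pt)

text \<open>From any point of a triangle the ball grows linearly towards the inscribed one; the circumradius is
  twice the inradius.\<close>

lemma edge_state_start:
  assumes x: "x \<in> f ` tri" "x \<in> koch_snowflake a" and f: "similarity k f" "in_stage a (f ` tri)"
  shows "edge_state k f x"
proof -
  obtain z where z: "x = f z" "z \<in> tri" using x by auto
  define \<xi> y where "\<xi> = 2 * Re z - 1" and "y = 6 * ht z"
  have z_eq: "z = mesh_pt \<xi> y" unfolding \<xi>_def y_def by (rule mesh_pt_eq)
  have t: "0 \<le> y" "y \<le> 3 * (1 + \<xi>)" "y \<le> 3 * (1 - \<xi>)" using z(2) by (auto simp: z_eq mesh_pt_tri)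
  have "reaches c (koch_snowflake a) x (f (mesh_pt 0 1)) (k * (inradius * c))"
  proof (rule mesh_step[OF _ f, of x \<xi> y 0 2 0 1])
    show "reaches c (koch_snowflake a) x (f (mesh_pt \<xi> y)) (k * (inradius * 0))"
      using reaches_refl[OF x(2)] by (simp add: z(1) z_eq)
    have "\<bar>\<xi>\<bar> \<le> 1 - y / 3" using t by (simp add: abs_if)
    then have "\<xi>\<^sup>2 \<le> (1 - y / 3)\<^sup>2" by (metis abs_ge_zero power2_abs power_mono)
    moreover have "0 \<le> y * (3 - y)" using t by (intro mult_nonneg_nonneg) auto
    moreover have "3 * (1 - y / 3)\<^sup>2 + (1 - y)\<^sup>2 = 4 - 4/3 * (y * (3 - y))" by (simp add: power2_eq_square field_simps)
    ultimately show "3 * (0 - \<xi>)\<^sup>2 + (1 - y)\<^sup>2 \<le> 2\<^sup>2" by simp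
    show "k * (inradius * (0 + 2)) \<le> k * (inradius * c)"
      using f c_ge inradius_pos by (intro mult_left_mono) (auto simp: similarity_def)
    fix s \<xi>' y' :: real assume s: "0 \<le> s" "s \<le> 1" and \<rho>: "0 < (0 + s * 2) / c"
      and d: "3 * (\<xi>' - (\<xi> + s * (0 - \<xi>)))\<^sup>2 + (y' - (y + s * (1 - y)))\<^sup>2 < ((0 + s * 2) / c)\<^sup>2"
    have \<rho>s: "(0 + s * 2) / c \<le> s" using c_ge s by (simp add: pos_divide_le_eq mult_left_mono)
    have 1: "0 \<le> (1 - s) * y" "0 \<le> (1 - s) * (3 * (1 + \<xi>) - y)" "0 \<le> (1 - s) * (3 * (1 - \<xi>) - y)"
      using s t by (auto intro!: mult_nonneg_nonneg)
    define r where "r = (0 + s * 2) / c"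
    show "mesh_pt \<xi>' y' \<in> tri"
      by (rule ball_in_tri[OF _ _ _ \<rho>[folded r_def] d[folded r_def]]; use \<rho>s[folded r_def] 1 in \<open>simp add: algebra_simps\<close>)
  qed simp
  then show ?thesis by (simp add: edge_state_def)
qed

text \<open>From the midpoint of an edge into the triangle. The end of this segment may be too close to the
  other sides for its length, so their bumps are needed too.\<close>

lemma axis_step:
  assumes r: "reaches c (koch_snowflake a) x (f (mesh_pt 0 0)) (k * (inradius * (3/2 * c * a)))" and f: "similarity k f"
    and R: "in_stage a (f ` (tri \<union> bump a \<union> mirror ` bump a \<union> flip ` mirror ` bump a))"
  shows "reaches c (koch_snowflake a) x (f (mesh_pt 0 1)) (k * (inradius * (3/2 * c * a + 1)))"
proof (rule mesh_step[OF r f R, of 1])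
  fix s \<xi> y :: real assume s: "0 \<le> s" "s \<le> 1" and \<rho>: "0 < (3/2 * c * a + s * 1) / c"
    and d: "3 * (\<xi> - (0 + s * (0 - 0)))\<^sup>2 + (y - (0 + s * (1 - 0)))\<^sup>2 < ((3/2 * c * a + s * 1) / c)\<^sup>2"
  have e: "(3/2 * c * a + s * 1) / c = 3/2 * a + s / c" using c_ge by (simp add: field_simps)
  have "s / c \<le> s / 2" using s c_ge by (intro divide_left_mono) auto
  moreover have "2 * (3/2 * a + q) - s \<le> 3 * a" if "q \<le> s / 2" for q using that by simp
  ultimately have "2 * (3/2 * a + s / c) - s \<le> 3 * a" by blast
  then have "bump_below a ((3/2 * c * a + s * 1) / c) 0 s"
    using \<rho> unfolding e by (intro bump_below_axis)
  then show "mesh_pt \<xi> y \<in> tri \<union> bump a \<union> mirror ` bump a \<union> flip ` mirror ` bump a"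
    using d s by (intro ball_in_star) simp_all
qed simp_all

lemma axis_step_rhomb:
  assumes r: "reaches c (koch_snowflake a) x (f (mesh_pt 0 0)) (k * (inradius * (3/2 * c * a)))" and f: "similarity k f"
    and R: "in_stage a (f ` (rhomb \<union> bump a \<union> mirror ` bump a))" and L: "0 \<le> L" "L \<le> 1"
  shows "reaches c (koch_snowflake a) x (f (mesh_pt 0 L)) (k * (inradius * (3/2 * c * a + L)))"
proof (rule mesh_step[OF r f R, of L])
  fix s \<xi> y :: real assume s: "0 \<le> s" "s \<le> 1" and \<rho>: "0 < (3/2 * c * a + s * L) / c"
    and d: "3 * (\<xi> - (0 + s * (0 - 0)))\<^sup>2 + (y - (0 + s * (L - 0)))\<^sup>2 < ((3/2 * c * a + s * L) / c)\<^sup>2"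
  have e: "(3/2 * c * a + s * L) / c = 3/2 * a + s * L / c" using c_ge by (simp add: field_simps)
  have sL: "0 \<le> s * L" "s * L \<le> 1" using s L mult_mono[of s 1 L 1] by auto
  have "s * L / c \<le> s * L / 2" using sL c_ge by (intro divide_left_mono) auto
  then have rr: "(3/2 * c * a + s * L) / c \<le> 3/2 * a + s * L / 2" unfolding e by (rule add_left_mono)
  define r where "r = (3/2 * c * a + s * L) / c"
  note r = rr[folded r_def] \<rho>[folded r_def]
  have "bump_below a r 0 (s * L)"
    using r by (intro bump_below_axis) simp_all
  then show "mesh_pt \<xi> y \<in> rhomb \<union> bump a \<union> mirror ` bump a"
    by (rule ball_in_rhomb) (use d[folded r_def] r sL a_le_half in simp_all)
qed (use L in simp_all)

text \<open>On the ray from the vertex \<open>0\<close> the ball that touches both sides has the radius \<open>1 + x\<close> at distance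
  \<open>2 x\<close> from the centroid.\<close>

lemma ray_step:
  assumes r: "reaches c (koch_snowflake a) x (f (mesh_pt 0 1)) (k * (inradius * c))" and f: "similarity k f"
    and R: "in_stage a (f ` (rhomb \<union> bump a \<union> mirror ` bump a))"
  shows "reaches c (koch_snowflake a) x (f (mesh_pt (1/2) (3/2))) (k * (inradius * (3/2 * c)))"
proof (rule mesh_step[OF r f R, of 1])
  show "k * (inradius * (c + 1)) \<le> k * (inradius * (3/2 * c))"
    using f c_ge inradius_pos by (intro mult_left_mono) (auto simp: similarity_def)
  show "3 * (1/2 - 0)\<^sup>2 + (3/2 - 1)\<^sup>2 \<le> (1::real)\<^sup>2" by (simp add: power2_eq_square)
  fix s \<xi> y :: real assume s: "0 \<le> s" "s \<le> 1" and \<rho>: "0 < (c + s * 1) / c"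
    and d: "3 * (\<xi> - (0 + s * (1/2 - 0)))\<^sup>2 + (y - (1 + s * (3/2 - 1)))\<^sup>2 < ((c + s * 1) / c)\<^sup>2"
  have e: "(c + s * 1) / c = 1 + s / c" using c_ge by (simp add: field_simps)
  have "s / c \<le> s / 2" using s c_ge by (intro divide_left_mono) auto
  then have rr: "(c + s * 1) / c \<le> 1 + s / 2" unfolding e by (rule add_left_mono)
  define r where "r = (c + s * 1) / c"
  note r = rr[folded r_def] \<rho>[folded r_def]
  have "bump_below a r (0 + s * (1/2 - 0)) (1 + s * (3/2 - 1))"
    using r by (intro bump_below_high) simp_all
  then show "mesh_pt \<xi> y \<in> rhomb \<union> bump a \<union> mirror ` bump a"
    by (rule ball_in_rhomb) (use d[folded r_def] r s in simp_all)
qed simp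

text \<open>For \<open>a \<le> 1/3\<close> the way along the axis is short enough to count as an arrival at the centroid.\<close>

lemma corner_step_small:
  assumes r: "reaches c (koch_snowflake a) x (f (mesh_pt 0 0)) (k * (inradius * (3/2 * c * a)))" and f: "similarity k f"
    and R: "in_stage a (f ` (rhomb \<union> bump a \<union> mirror ` bump a))" and small: "a \<le> 1/3"
  shows "reaches c (koch_snowflake a) x (f (mesh_pt (1/2) (3/2))) (k * (inradius * (3/2 * c)))"
proof (rule ray_step[OF _ f R], rule reaches_mono)
  show "reaches c (koch_snowflake a) x (f (mesh_pt 0 1)) (k * (inradius * (3/2 * c * a + 1)))"
    by (rule axis_step_rhomb[OF r f R]) auto
  show "k * (inradius * (3/2 * c * a + 1)) \<le> k * (inradius * c)"
    using f small c_small[OF small] inradius_pos by (intro mult_left_mono) (auto simp: similarity_def)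
qed

text \<open>The axis is left at height \<open>3/4\<close> for the point of the ray at \<open>\<xi> = 1/8\<close>. This chord has length
  \<open>sqrt 3 / 4 \<le> 7/16\<close>, in place of \<open>1/4 + 1/4\<close> through the centroid. The saving of \<open>1/16\<close> is
  needed where the ray passes the end of the base of the bump.\<close>

lemma corner_step_big:
  assumes r: "reaches c (koch_snowflake a) x (f (mesh_pt 0 0)) (k * (inradius * (3/2 * c * a)))" and f: "similarity k f"
    and R: "in_stage a (f ` (rhomb \<union> bump a \<union> mirror ` bump a))" and big: "1/3 \<le> a"
  shows "reaches c (koch_snowflake a) x (f (mesh_pt (1/2) (3/2))) (k * (inradius * (3/2 * c)))"
proof -
  have e: "(3/2 * c * a + t) / c = 3/2 * a + 3/4 * (1 - a) * t" for t
  proof -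
    have "(3/2 * c * a + t) / c = 3/2 * a + t / c" using c_ge by (simp add: field_simps)
    then show ?thesis by (simp only: c_big(2)[OF big])
  qed
  have k: "0 \<le> k" using f by (simp add: similarity_def)
  have tt: "3/4 * (1 - a) * t \<le> 1/2 * t" if "0 \<le> t" for t using big that by (intro mult_right_mono) auto
  have 1: "reaches c (koch_snowflake a) x (f (mesh_pt 0 (3/4))) (k * (inradius * (3/2 * c * a + 3/4)))"
    by (rule axis_step_rhomb[OF r f R]) auto
  have 2: "reaches c (koch_snowflake a) x (f (mesh_pt (1/8) (9/8))) (k * (inradius * (3/2 * c * a + 3/4 + 7/16)))"
  proof (rule mesh_step[OF 1 f R, of "7/16"])
    show "3 * (1/8 - 0)\<^sup>2 + (9/8 - 3/4)\<^sup>2 \<le> (7/16::real)\<^sup>2" by (simp add: power2_eq_square)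
    fix s \<xi> y :: real assume s: "0 \<le> s" "s \<le> 1" and \<rho>: "0 < (3/2 * c * a + 3/4 + s * (7/16)) / c"
      and d: "3 * (\<xi> - (0 + s * (1/8 - 0)))\<^sup>2 + (y - (3/4 + s * (9/8 - 3/4)))\<^sup>2 < ((3/2 * c * a + 3/4 + s * (7/16)) / c)\<^sup>2"
    have e2: "(3/2 * c * a + 3/4 + s * (7/16)) / c = 3/2 * a + 3/4 * (1 - a) * (3/4 + s * (7/16))"
      using e[of "3/4 + s * (7/16)"] by (simp add: add.assoc)
    define r where "r = 3/2 * a + 3/4 * (1 - a) * (3/4 + s * (7/16))"
    have "r \<le> 3/2 * a + 1/2 * (3/4 + s * (7/16))" using tt[of "3/4 + s * (7/16)"] s by (simp add: r_def)
    then have "r \<le> 3/2" using s a_le_half by (simp add: algebra_simps)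
    moreover have "bump_below a r (s / 8) (3/4 + s * (3/8))"
      unfolding r_def using cut_inequality[OF big a_le_half s] s big a_le_half by (intro bump_below_corner) simp_all
    ultimately show "mesh_pt \<xi> y \<in> rhomb \<union> bump a \<union> mirror ` bump a"
      using d[unfolded e2, folded r_def] \<rho>[unfolded e2, folded r_def] s
      by (intro ball_in_rhomb[of a r "s / 8" "3/4 + s * (3/8)"]) simp_all
  qed simp_all
  show ?thesis
  proof (rule mesh_step[OF 2 f R, of "3/4"])
    show "3 * (1/2 - 1/8)\<^sup>2 + (3/2 - 9/8)\<^sup>2 \<le> (3/4::real)\<^sup>2" by (simp add: power2_eq_square)
    show "k * (inradius * (3/2 * c * a + 3/4 + 7/16 + 3/4)) \<le> k * (inradius * (3/2 * c))"
      using k inradius_pos c_big(1)[OF big] by (intro mult_left_mono) (auto simp: algebra_simps)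
    fix s \<xi> y :: real assume s: "0 \<le> s" "s \<le> 1" and \<rho>: "0 < (3/2 * c * a + 3/4 + 7/16 + s * (3/4)) / c"
      and d: "3 * (\<xi> - (1/8 + s * (1/2 - 1/8)))\<^sup>2 + (y - (9/8 + s * (3/2 - 9/8)))\<^sup>2 < ((3/2 * c * a + 3/4 + 7/16 + s * (3/4)) / c)\<^sup>2"
    (* 15/16 + 2 * w bounds the length from the midpoint to the point (w, 1 + w) of the ray. *)
    define w where "w = 1/8 + s * (3/8)"
    have w: "1/8 \<le> w" "w \<le> 1/2" using s by (auto simp: w_def)
    have e2: "(3/2 * c * a + 3/4 + 7/16 + s * (3/4)) / c = 3/2 * a + 3/4 * (1 - a) * (15/16 + 2 * w)"
      using e[of "3/4 + 7/16 + s * (3/4)"] by (simp add: add.assoc w_def)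
    have "bump_below a (3/2 * a + 3/4 * (1 - a) * (15/16 + 2 * w)) w (1 + w)"
    proof (cases "w \<le> a")
      case True
      then show ?thesis using ray_inequality[OF big a_le_half, of w] w a_le_half by (intro bump_below_corner) simp_all
    next
      case False
      then show ?thesis using ray_inequality_far[OF big a_le_half, of w] \<rho>[unfolded e2] by (intro bump_below_high) simp_all
    qed
    then show "mesh_pt \<xi> y \<in> rhomb \<union> bump a \<union> mirror ` bump a"
    proof (rule ball_in_rhomb)
      show "3 * (\<xi> - w)\<^sup>2 + (y - (1 + w))\<^sup>2 < (3/2 * a + 3/4 * (1 - a) * (15/16 + 2 * w))\<^sup>2"
        using d unfolding e2 by (simp add: w_def)
      have "3/4 * (1 - a) * (15/16 + 2 * w) \<le> 3/4 * (1 - a) * 2" using a_le_half w by (intro mult_left_mono) auto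
      also have "\<dots> = 3/2 - 3/2 * a" by (simp add: field_simps)
      finally have "3/2 * a + 3/4 * (1 - a) * (15/16 + 2 * w) \<le> 3/2 * a + (3/2 - 3/2 * a)" by (rule add_left_mono)
      then have "3/2 * a + 3/4 * (1 - a) * (15/16 + 2 * w) \<le> 3/2" by simp
      moreover have "R \<le> 3 - (1 + w)" "2 * R \<le> 1 + w + 3 - 3 * w" if "R \<le> 3/2" for R using that w by simp_all
      ultimately show "3/2 * a + 3/4 * (1 - a) * (15/16 + 2 * w) \<le> 3 - (1 + w)"
        "2 * (3/2 * a + 3/4 * (1 - a) * (15/16 + 2 * w)) \<le> 1 + w + 3 - 3 * w" by blast+
    qed (use \<rho>[unfolded e2] in simp_all)
  qed simp
qed

lemma corner_step:
  assumes "edge_state k f x" "similarity k f" "in_stage a (f ` (rhomb \<union> bump a \<union> mirror ` bump a))"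
  shows "reaches c (koch_snowflake a) x (f (mesh_pt (1/2) (3/2))) (k * (inradius * (3/2 * c)))"
  using assms ray_step corner_step_small corner_step_big unfolding edge_state_def by (meson linear)

end

context koch_parameter
begin

lemma framed_pockets:
  assumes "framed a f"
  shows "in_stage a (f ` bump a)" "in_stage a (f ` mirror ` bump a)" "in_stage a (f ` flip ` mirror ` bump a)"
proof -
  have "in_stage a (f ` flank a (Suc 0))" using assms unfolding framed_def by blast
  then show "in_stage a (f ` bump a)" by (rule in_stage_subset) (auto intro: image_mono)
  have "in_stage a ((\<lambda>z. f (mirror ((1/2 - a/2) ^ 0 *\<^sub>R z))) ` bump a)"
    "in_stage a ((\<lambda>z. f (flip (mirror ((1/2 - a/2) ^ 0 *\<^sub>R z)))) ` bump a)" using assms unfolding framed_def by blast+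
  then show "in_stage a (f ` mirror ` bump a)" "in_stage a (f ` flip ` mirror ` bump a)" by (simp_all add: image_image)
qed

lemma framed_tri: "framed a f \<Longrightarrow> in_stage a (f ` tri)"
  unfolding framed_def by blast

lemma child1_rhomb: "child1 a ` rhomb \<subseteq> tri"
proof (rule image_subsetI)
  fix z assume "z \<in> rhomb"
  then have z: "0 \<le> ht z" "ht z \<le> 1/2" "ht z \<le> Re z" "Re z - 1 \<le> ht z" by (auto simp: rhomb_def)
  define l where "l = 1/2 - a/2"
  have l: "0 \<le> l" "l \<le> 1/2" using a_pos a_le_half by (auto simp: l_def)
  have "0 \<le> l * ht z" "l * ht z \<le> l * Re z" using l z by (auto intro: mult_left_mono)
  moreover have "l * (Re z + ht z) \<le> 1/2 * 2" using l z by (intro mult_mono) auto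
  ultimately show "child1 a z \<in> tri" unfolding tri_def mem_Collect_eq child_coords l_def[symmetric]
    by (simp add: distrib_left)
qed

lemma child3_rhomb: "child3 a ` rhomb \<subseteq> tri \<union> bump a"
proof (rule image_subsetI)
  fix z assume "z \<in> rhomb"
  then have z: "0 \<le> ht z" "ht z \<le> 1/2" "ht z \<le> Re z" "Re z - 1 \<le> ht z" by (auto simp: rhomb_def)
  show "child3 a z \<in> tri \<union> bump a"
  proof (cases "Re z + ht z \<le> 1")
    case True
    then have "z \<in> tri" using z by (auto simp: tri_def)
    then show ?thesis using bump_eq_child3 by auto
  next
    case False
    have 1: "0 \<le> a * (Re z + ht z - 1)" "a * (Re z - ht z) \<le> a * 1" using a_pos z False by (auto intro: mult_left_mono)
    have 2: "a * (4 * ht z) \<le> 1/2 * 2" using a_pos a_le_half z by (intro mult_mono) auto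
    have "child3 a z \<in> tri" unfolding tri_def mem_Collect_eq child_coords using 1 2 a_pos a_le_half by (simp add: field_simps)
    then show ?thesis by simp
  qed
qed

lemma similarity_child1: "similarity (1/2 - a/2) (child1 a)"
proof -
  have "cmod (foot1 a - 0) = 1/2 - a/2"
    by (rule power2_eq_imp_eq) (use a_le_half in \<open>simp_all add: norm_ht foot1_def\<close>)
  then show ?thesis using similarity_edge_map[OF foot_apex_distinct(1)] unfolding child1_def by simp
qed

lemma similarity_child3: "similarity a (child3 a)"
proof -
  have "cmod (foot2 a - apex a) = a"
    by (rule power2_eq_imp_eq, unfold norm_ht) (use a_pos in \<open>simp_all add: foot2_def apex_def power2_eq_square\<close>)
  then show ?thesis using similarity_edge_map[OF foot_apex_distinct(3)] unfolding child3_def by simp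
qed

lemma similarity_rot: "similarity 1 (\<lambda>z. z)" "similarity 1 (edge_map 1 tri_top)" "similarity 1 (edge_map tri_top 0)"
proof -
  have "surj (\<lambda>z::complex. z)" using surj_id by (simp add: id_def)
  then show "similarity 1 (\<lambda>z. z)" by (simp add: similarity_def)
  have "cmod (tri_top - 1) = 1" "cmod (0 - tri_top) = 1"
    by (rule power2_eq_imp_eq, unfold norm_ht, simp add: tri_top_def power2_eq_square, simp, simp)+
  then show "similarity 1 (edge_map 1 tri_top)" "similarity 1 (edge_map tri_top 0)"
    using similarity_edge_map[OF rot_distinct(1)] similarity_edge_map[OF rot_distinct(2)] by simp_all
qed

lemma interior_tri_snowflake: "interior tri \<subseteq> koch_snowflake a"
proof -
  have "tri \<subseteq> koch_region a 0" by (auto simp: koch_region_def)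
  then have "interior tri \<subseteq> interior (koch_region a 0)" by (rule interior_mono)
  then show ?thesis unfolding koch_snowflake_eq by blast
qed

lemma bounded_snowflake: "bounded (koch_snowflake a)"
proof -
  have "envelope a \<subseteq> cball 0 2"
  proof
    fix z assume "z \<in> envelope a"
    then have "\<bar>Re z\<bar> \<le> 1" "\<bar>ht z\<bar> \<le> 1/2" using a_le_half by (auto simp: envelope_def)
    then have "(Re z)\<^sup>2 \<le> 1\<^sup>2" "(ht z)\<^sup>2 \<le> (1/2)\<^sup>2"
      by (metis abs_le_square_iff abs_one abs_numeral abs_divide)+
    then have "(cmod z)\<^sup>2 \<le> 2\<^sup>2" unfolding norm_ht by (simp add: power_divide)
    then have "cmod z \<le> 2" by (rule power2_le_imp_le) simp
    then show "z \<in> cball 0 2" by simp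
  qed
  then have fl: "flank a n \<subseteq> cball 0 2" for n using flank_envelope by (meson order_trans)
  have "bounded (tri \<union> cball 0 2 \<union> edge_map 1 tri_top ` cball 0 2 \<union> edge_map tri_top 0 ` cball 0 2)"
    by (intro bounded_Un[THEN iffD2] conjI compact_imp_bounded compact_convex_tri compact_continuous_image continuous_on_edge_map compact_cball)
  moreover have "koch_region a n \<subseteq> tri \<union> cball 0 2 \<union> edge_map 1 tri_top ` cball 0 2 \<union> edge_map tri_top 0 ` cball 0 2" for n
    unfolding koch_region_def by (intro Un_mono image_mono fl order_refl)
  then have "koch_snowflake a \<subseteq> tri \<union> cball 0 2 \<union> edge_map 1 tri_top ` cball 0 2 \<union> edge_map tri_top 0 ` cball 0 2"
    unfolding koch_snowflake_eq using interior_subset by blast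
  ultimately show ?thesis by (rule bounded_subset)
qed

lemma open_snowflake: "open (koch_snowflake a)"
  unfolding koch_snowflake_def by blast

end

context john_parameter
begin

text \<open>In the triangle of a side of the bump, the side opposite to the apex is the base of the bump, whose midpoint is the
  midpoint of the parent edge.\<close>

lemma edge_state_child3:
  assumes "framed a f" "similarity k f" "edge_state (k * a) (f \<circ> child3 a) x"
  shows "edge_state k f x"
proof -
  have fr: "framed a (f \<circ> child3 a)" by (rule framed_child3[OF assms(1)])
  have "in_stage a ((f \<circ> child3 a) ` rhomb)"
  proof (rule in_stage_subset)
    show "in_stage a (f ` tri \<union> f ` bump a)"
      by (rule in_stage_Un[OF framed_tri[OF assms(1)] framed_pockets(1)[OF assms(1)]])
    show "(f \<circ> child3 a) ` rhomb \<subseteq> f ` tri \<union> f ` bump a"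
      unfolding image_comp[symmetric] image_Un[symmetric] by (intro image_mono child3_rhomb)
  qed
  then have "in_stage a ((f \<circ> child3 a) ` (rhomb \<union> bump a \<union> mirror ` bump a))"
    unfolding image_Un by (intro in_stage_Un framed_pockets[OF fr])
  from corner_step[OF assms(3) similarity_comp[OF assms(2) similarity_child3] this]
  have "reaches c (koch_snowflake a) x (f (child3 a (mesh_pt (1/2) (3/2)))) (k * a * (inradius * (3/2 * c)))" by (simp only: o_apply)
  moreover have "child3 a (mesh_pt (1/2) (3/2)) = mesh_pt 0 0"
    by (simp add: complex_eq_ht_iff child_coords)
  moreover have "k * a * (inradius * (3/2 * c)) = k * (inradius * (3/2 * c * a))" by simp
  ultimately have "reaches c (koch_snowflake a) x (f (mesh_pt 0 0)) (k * (inradius * (3/2 * c * a)))" by (simp only:)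
  then show ?thesis unfolding edge_state_def by (rule disjI2)
qed

text \<open>Here the ray from the common vertex also passes through the centroid of the parent triangle. From the midpoint of the
  opposite side on, the inscribed balls of the homothetic triangles suffice.\<close>

lemma edge_state_child1:
  assumes "framed a f" "similarity k f" "edge_state (k * (1/2 - a/2)) (f \<circ> child1 a) x"
  shows "edge_state k f x"
proof -
  define l where "l = 1/2 - a/2"
  have l: "0 < l" "l < 1/2" using a_pos a_le_half by (auto simp: l_def)
  have k: "0 \<le> k" using assms(2) by (simp add: similarity_def)
  have fr: "framed a (f \<circ> child1 a)" by (rule framed_child1[OF assms(1)])
  have tri: "in_stage a (f ` tri)" by (rule framed_tri[OF assms(1)])
  have "in_stage a ((f \<circ> child1 a) ` rhomb)"
    unfolding image_comp[symmetric] by (rule in_stage_subset[OF tri]) (intro image_mono child1_rhomb)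
  then have "in_stage a ((f \<circ> child1 a) ` (rhomb \<union> bump a \<union> mirror ` bump a))"
    unfolding image_Un by (intro in_stage_Un framed_pockets[OF fr])
  from corner_step[OF assms(3) similarity_comp[OF assms(2) similarity_child1] this]
  have "reaches c (koch_snowflake a) x (f (child1 a (mesh_pt (1/2) (3/2)))) (k * l * (inradius * (3/2 * c)))" by (simp only: o_apply l_def)
  moreover have "child1 a (mesh_pt (1/2) (3/2)) = mesh_pt (3/2 * l - 1) (3/2 * l)"
    by (simp add: complex_eq_ht_iff child_coords l_def field_simps)
  moreover have "k * l * (inradius * (3/2 * c)) = k * (inradius * (3/2 * c * l))" by simp
  ultimately have r: "reaches c (koch_snowflake a) x (f (mesh_pt (3/2 * l - 1) (3/2 * l))) (k * (inradius * (3/2 * c * l)))" by (simp only:)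
  have c2: "2 \<le> c" by (rule c_ge)
  have "reaches c (koch_snowflake a) x (f (mesh_pt 0 1)) (k * (inradius * c))"
  proof (rule mesh_step[OF r assms(2) tri, of "2 - 3 * l"])
    show "3 * (0 - (3/2 * l - 1))\<^sup>2 + (1 - 3/2 * l)\<^sup>2 \<le> (2 - 3 * l)\<^sup>2" by (simp add: power2_eq_square field_simps)
    have "2 * (1 - 3/2 * l) \<le> c * (1 - 3/2 * l)" using c2 l by (intro mult_right_mono) auto
    then have "3/2 * c * l + (2 - 3 * l) \<le> c" by (simp add: algebra_simps)
    then show "k * (inradius * (3/2 * c * l + (2 - 3 * l))) \<le> k * (inradius * c)"
      using k inradius_pos by (intro mult_left_mono) auto
    fix s \<xi> y :: real assume s: "0 \<le> s" "s \<le> 1" and \<rho>: "0 < (3/2 * c * l + s * (2 - 3 * l)) / c"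
      and d: "3 * (\<xi> - (3/2 * l - 1 + s * (0 - (3/2 * l - 1))))\<^sup>2 + (y - (3/2 * l + s * (1 - 3/2 * l)))\<^sup>2 < ((3/2 * c * l + s * (2 - 3 * l)) / c)\<^sup>2"
    (* w is the inradius of the triangle with vertex 0 whose inscribed ball is used. *)
    define w where "w = 3/2 * l + s * (1 - 3/2 * l)"
    define r where "r = (3/2 * c * l + s * (2 - 3 * l)) / c"
    have "s * (1 - 3/2 * l) \<le> 1 * (1 - 3/2 * l)" using s l by (intro mult_right_mono) auto
    then have w: "w \<le> 1" by (simp add: w_def)
    have "2 * (s * (1 - 3/2 * l)) \<le> c * (s * (1 - 3/2 * l))" using c2 l s by (intro mult_right_mono mult_nonneg_nonneg) auto
    then have "3/2 * c * l + s * (2 - 3 * l) \<le> w * c" by (simp add: w_def algebra_simps)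
    then have rw: "r \<le> w" using c2 unfolding r_def by (simp add: pos_divide_le_eq)
    have eq: "3/2 * l - 1 + s * (0 - (3/2 * l - 1)) = w - 1" by (simp add: w_def algebra_simps)
    have "3 * (\<xi> - (w - 1))\<^sup>2 + (y - w)\<^sup>2 < r\<^sup>2" using d unfolding eq w_def[symmetric] r_def[symmetric] .
    then show "mesh_pt \<xi> y \<in> tri"
      using rw w \<rho>[folded r_def] by (intro ball_in_tri[of r w "w - 1"]) simp_all
  qed (use l in simp)
  then show ?thesis unfolding edge_state_def by (rule disjI1)
qed

text \<open>Only the first and the third child are treated directly; the others are their images under \<open>flip\<close>.\<close>

lemma edge_state_flank:
  assumes "framed a f" "similarity k f" "x \<in> f ` (tri \<union> flank a n)" "x \<in> koch_snowflake a"
  shows "edge_state k f x"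
  using assms
proof (induction n arbitrary: f k)
  case 0
  have "tri \<union> flank a 0 = tri" using segment_subset_tri by auto
  then show ?case using 0 edge_state_start[of x f k] framed_tri[OF 0(1)] by simp
next
  case (Suc n)
  have c3: "edge_state k g x" if g: "framed a g" "similarity k g" "x \<in> g ` child3 a ` (tri \<union> flank a n)" for g
  proof (rule edge_state_child3[OF g(1,2)])
    show "edge_state (k * a) (g \<circ> child3 a) x"
      using g(3) by (intro Suc.IH framed_child3[OF g(1)] similarity_comp[OF g(2) similarity_child3] Suc.prems(4))
        (simp only: image_comp)
  qed
  have c1: "edge_state k g x" if g: "framed a g" "similarity k g" "x \<in> g ` child1 a ` (tri \<union> flank a n)" for g
  proof (rule edge_state_child1[OF g(1,2)])
    show "edge_state (k * (1/2 - a/2)) (g \<circ> child1 a) x"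
      using g(3) by (intro Suc.IH framed_child1[OF g(1)] similarity_comp[OF g(2) similarity_child1] Suc.prems(4))
        (simp only: image_comp)
  qed
  have ff: "framed a (f \<circ> flip)" "similarity k (f \<circ> flip)"
    using framed_flip[OF Suc.prems(1)] similarity_comp[OF Suc.prems(2) similarity_flip] by simp_all
  obtain z where z: "x = f z" "z \<in> tri \<union> flank a (Suc n)" using Suc.prems(3) by auto
  consider "z \<in> tri" | "z \<in> child3 a ` (tri \<union> flank a n)" | "z \<in> child1 a ` (tri \<union> flank a n)"
    | "z \<in> flip ` child3 a ` (tri \<union> flank a n)" | "z \<in> flip ` child1 a ` (tri \<union> flank a n)"
  proof -
    have e: "child2 a ` flank a n = flip ` child3 a ` flank a n" "child4 a ` flank a n = flip ` child1 a ` flank a n"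
      unfolding child34_flip[OF flip_flank[of a n]] by (simp_all add: image_image)
    have "z \<in> tri \<union> (child3 a ` tri \<union> child1 a ` flank a n \<union> flip ` child3 a ` flank a n \<union> child3 a ` flank a n \<union> flip ` child1 a ` flank a n)"
      using z(2) unfolding flank.simps(2) e bump_eq_child3[symmetric] .
    then show ?thesis
    proof (elim UnE)
      assume "z \<in> child3 a ` tri" then show ?thesis using that(2) by (simp only: image_Un Un_iff simp_thms)
    next
      assume "z \<in> child1 a ` flank a n" then show ?thesis using that(3) by (simp only: image_Un Un_iff simp_thms)
    next
      assume "z \<in> flip ` child3 a ` flank a n" then show ?thesis using that(4) by (simp only: image_Un Un_iff simp_thms)
    next
      assume "z \<in> child3 a ` flank a n" then show ?thesis using that(2) by (simp only: image_Un Un_iff simp_thms)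
    next
      assume "z \<in> flip ` child1 a ` flank a n" then show ?thesis using that(5) by (simp only: image_Un Un_iff simp_thms)
    qed (rule that(1))
  qed
  then show ?case
  proof cases
    case 1
    then show ?thesis using z(1) Suc.prems edge_state_start[of x f k] framed_tri[OF Suc.prems(1)] by blast
  next
    case 2
    then show ?thesis using c3[OF Suc.prems(1,2)] z(1) by blast
  next
    case 3
    then show ?thesis using c1[OF Suc.prems(1,2)] z(1) by blast
  next
    case 4
    then have "x \<in> (f \<circ> flip) ` child3 a ` (tri \<union> flank a n)" unfolding z(1) by auto
    from c3[OF ff this] show ?thesis by (simp add: edge_state_flip)
  next
    case 5
    then have "x \<in> (f \<circ> flip) ` child1 a ` (tri \<union> flank a n)" unfolding z(1) by auto
    from c1[OF ff this] show ?thesis by (simp add: edge_state_flip)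
  qed
qed

lemma john_snowflake: "john_domain c (koch_snowflake a)"
proof (rule john_domainI)
  have c2: "2 \<le> c" by (rule c_ge)
  then show "1 \<le> c" by simp
  show "mesh_pt 0 1 \<in> koch_snowflake a"
    by (rule subsetD[OF interior_tri_snowflake], rule interior_tri) simp_all
  fix x assume x: "x \<in> koch_snowflake a"
  have centre: "\<exists>T. reaches c (koch_snowflake a) x (f (mesh_pt 0 1)) T" if f: "framed a f" "similarity 1 f" "x \<in> f ` (tri \<union> flank a n)" for f n
  proof -
    have "edge_state 1 f x" by (rule edge_state_flank[OF f x])
    moreover have "in_stage a (f ` (tri \<union> bump a \<union> mirror ` bump a \<union> flip ` mirror ` bump a))"
      unfolding image_Un by (intro in_stage_Un framed_pockets[OF f(1)] framed_tri[OF f(1)])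
    ultimately show ?thesis unfolding edge_state_def using axis_step[OF _ f(2)] by blast
  qed
  obtain n where "x \<in> koch_region a n" using x interior_subset unfolding koch_snowflake_eq by blast
  then consider "x \<in> (\<lambda>z. z) ` (tri \<union> flank a n)" | "x \<in> edge_map 1 tri_top ` (tri \<union> flank a n)" | "x \<in> edge_map tri_top 0 ` (tri \<union> flank a n)"
    unfolding koch_region_def by auto
  then show "\<exists>T. reaches c (koch_snowflake a) x (mesh_pt 0 1) T"
  proof cases
    case 1
    then show ?thesis using centre[OF framed_id similarity_rot(1)] by blast
  next
    case 2
    have "edge_map 1 tri_top (mesh_pt 0 1) = mesh_pt 0 1" by (simp add: complex_eq_ht_iff rot_coords)
    then show ?thesis using centre[OF framed_rot(1) similarity_rot(2) 2] by simp
  next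
    case 3
    have "edge_map tri_top 0 (mesh_pt 0 1) = mesh_pt 0 1" by (simp add: complex_eq_ht_iff rot_coords)
    then show ?thesis using centre[OF framed_rot(2) similarity_rot(3) 3] by simp
  qed
qed (rule open_snowflake bounded_snowflake)+

end

section \<open>Sharpness of the constant 2\<close>

lemma isometric_involution_interior:
  fixes g :: "complex \<Rightarrow> complex"
  assumes "\<And>x y. dist (g x) (g y) = dist x y" "\<And>x. g (g x) = x" "\<And>x. x \<in> X \<Longrightarrow> g x \<in> X" "z \<in> interior X"
  shows "g z \<in> interior X"
proof -
  obtain e where e: "0 < e" "ball z e \<subseteq> X" using assms(4) by (auto simp: mem_interior)
  have "ball (g z) e \<subseteq> X"
  proof
    fix y assume y: "y \<in> ball (g z) e"
    have "dist z (g y) = dist (g z) y" using assms(1)[of z "g y"] by (simp add: assms(2))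
    then have "g y \<in> X" using y e(2) by auto
    then show "y \<in> X" using assms(3)[of "g y"] by (simp add: assms(2))
  qed
  then show ?thesis using e(1) by (auto simp: mem_interior)
qed

lemma dist_flip: "dist (flip x) (flip y) = dist x y"
  using similarity_flip by (simp add: similarity_def)

lemma norm_mirror: "cmod (mirror x) = cmod x"
proof -
  have "cmod tri_top = 1" by (rule power2_eq_imp_eq, unfold norm_ht) (simp_all add: tri_top_def power2_eq_square)
  then show ?thesis by (simp add: mirror_def norm_mult)
qed

lemma dist_mirror: "dist (mirror x) (mirror y) = dist x y"
proof -
  have "mirror x - mirror y = mirror (x - y)" by (simp add: mirror_def algebra_simps)
  then show ?thesis by (simp add: dist_norm norm_mirror)
qed

lemma mirror_tri: "z \<in> tri \<Longrightarrow> mirror z \<in> tri"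
  by (auto simp: tri_def mirror_coords field_simps)

lemma mirror_rot: "mirror z = edge_map tri_top 0 (flip z)" "mirror (edge_map 1 tri_top z) = edge_map 1 tri_top (flip z)"
  "mirror (edge_map tri_top 0 z) = flip z"
  "flip (edge_map 1 tri_top z) = edge_map tri_top 0 (flip z)" "flip (edge_map tri_top 0 z) = edge_map 1 tri_top (flip z)"
  by (simp_all add: complex_eq_ht_iff mirror_coords rot_coords field_simps)

lemma mirror_region: assumes "z \<in> koch_region a n" shows "mirror z \<in> koch_region a n"
proof -
  have fl: "flip y \<in> flank a n" if "y \<in> flank a n" for y using flip_flank[of a n] that by blast
  from assms show ?thesis unfolding koch_region_def
  proof (elim UnE)
    assume "z \<in> tri" then show "mirror z \<in> tri \<union> flank a n \<union> edge_map 1 tri_top ` flank a n \<union> edge_map tri_top 0 ` flank a n"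
      using mirror_tri by simp
  next
    assume "z \<in> flank a n" then show "mirror z \<in> tri \<union> flank a n \<union> edge_map 1 tri_top ` flank a n \<union> edge_map tri_top 0 ` flank a n"
      using fl by (simp add: mirror_rot(1))
  next
    assume "z \<in> edge_map 1 tri_top ` flank a n" 
    then obtain y where "z = edge_map 1 tri_top y" "y \<in> flank a n" by auto
    then show "mirror z \<in> tri \<union> flank a n \<union> edge_map 1 tri_top ` flank a n \<union> edge_map tri_top 0 ` flank a n"
      using fl by (simp add: mirror_rot(2))
  next
    assume "z \<in> edge_map tri_top 0 ` flank a n" 
    then obtain y where "z = edge_map tri_top 0 y" "y \<in> flank a n" by auto
    then show "mirror z \<in> tri \<union> flank a n \<union> edge_map 1 tri_top ` flank a n \<union> edge_map tri_top 0 ` flank a n"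
      using fl by (simp add: mirror_rot(3))
  qed
qed

lemma flip_region: assumes "z \<in> koch_region a n" shows "flip z \<in> koch_region a n"
proof -
  have fl: "flip y \<in> flank a n" if "y \<in> flank a n" for y using flip_flank[of a n] that by blast
  from assms show ?thesis unfolding koch_region_def
  proof (elim UnE)
    assume "z \<in> tri" then show "flip z \<in> tri \<union> flank a n \<union> edge_map 1 tri_top ` flank a n \<union> edge_map tri_top 0 ` flank a n"
      using flip_tri by blast
  next
    assume "z \<in> flank a n" then show "flip z \<in> tri \<union> flank a n \<union> edge_map 1 tri_top ` flank a n \<union> edge_map tri_top 0 ` flank a n"
      using fl by simp
  next
    assume "z \<in> edge_map 1 tri_top ` flank a n" 
    then obtain y where "z = edge_map 1 tri_top y" "y \<in> flank a n" by auto
    then show "flip z \<in> tri \<union> flank a n \<union> edge_map 1 tri_top ` flank a n \<union> edge_map tri_top 0 ` flank a n"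
      using fl by (simp add: mirror_rot(4))
  next
    assume "z \<in> edge_map tri_top 0 ` flank a n" 
    then obtain y where "z = edge_map tri_top 0 y" "y \<in> flank a n" by auto
    then show "flip z \<in> tri \<union> flank a n \<union> edge_map 1 tri_top ` flank a n \<union> edge_map tri_top 0 ` flank a n"
      using fl by (simp add: mirror_rot(5))
  qed
qed

lemma closed_half_open_limit:
  fixes z :: complex
  assumes "closed C" "0 < e" "\<And>t. 0 < t \<Longrightarrow> t < e \<Longrightarrow> z + of_real (\<sigma> * t) \<in> C" "\<bar>\<sigma>\<bar> = 1"
  shows "z \<in> C"
proof -
  have "z \<in> closure C"
    unfolding closure_approachable
  proof (intro allI impI)
    fix d :: real assume "0 < d"
    define t where "t = min d e / 2"
    have t: "0 < t" "t < e" "t < d" using \<open>0 < d\<close> assms(2) by (auto simp: t_def)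
    have "dist (z + of_real (\<sigma> * t)) z = t" using t assms(4) by (simp add: dist_norm norm_mult)
    then show "\<exists>y\<in>C. dist y z < d" using assms(3)[OF t(1,2)] t(3) by (intro bexI[of _ "z + of_real (\<sigma> * t)"]) simp_all
  qed
  then show ?thesis using assms(1) by simp
qed

context koch_parameter
begin

lemma flip_snowflake: "z \<in> koch_snowflake a \<Longrightarrow> flip z \<in> koch_snowflake a"
  unfolding koch_snowflake_eq
  using isometric_involution_interior[of flip, OF dist_flip flip_flip flip_region] by blast

lemma mirror_snowflake: "z \<in> koch_snowflake a \<Longrightarrow> mirror z \<in> koch_snowflake a"
  unfolding koch_snowflake_eq
  using isometric_involution_interior[of mirror, OF dist_mirror mirror_mirror mirror_region] by blast

lemma region_below: "z \<in> koch_region a n \<Longrightarrow> ht z < 0 \<Longrightarrow> z \<in> flank a n"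
proof -
  assume z: "z \<in> koch_region a n" and h: "ht z < 0"
  have env: "flank a n \<subseteq> envelope a" by (rule flank_envelope)
  have "z \<notin> tri" using h by (auto simp: tri_def)
  moreover have "z \<notin> edge_map 1 tri_top ` flank a n" "z \<notin> edge_map tri_top 0 ` flank a n"
  proof -
    have "0 \<le> ht (edge_map 1 tri_top y)" "0 \<le> ht (edge_map tri_top 0 y)" if "y \<in> flank a n" for y
    proof -
      have "y \<in> envelope a" using env that by blast
      then show "0 \<le> ht (edge_map 1 tri_top y)" "0 \<le> ht (edge_map tri_top 0 y)" by (auto simp: envelope_def rot_coords)
    qed
    then show "z \<notin> edge_map 1 tri_top ` flank a n" "z \<notin> edge_map tri_top 0 ` flank a n" using h by force+
  qed
  ultimately show ?thesis using z by (simp add: koch_region_def)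
qed

text \<open>The slit is the line that bisects the exterior angle at the first foot. The first child lies on one of its
  sides, the rest of the flank on the other. A point of the slit in the
  interior of the stage would be a limit from both sides, thus common to both parts.\<close>

lemma slit_not_interior:
  assumes "ht z < 0" "Re z - ht z = 1/2 - a/2" shows "z \<notin> interior (koch_region a (Suc n))"
proof
  assume "z \<in> interior (koch_region a (Suc n))"
  then obtain e where e: "0 < e" "ball z e \<subseteq> koch_region a (Suc n)" by (auto simp: mem_interior)
  let ?L = "child1 a ` flank a n" and ?R = "bump a \<union> child2 a ` flank a n \<union> child3 a ` flank a n \<union> child4 a ` flank a n"
  note env = child_env_subset[of n]
  have L: "Re w - ht w \<le> 1/2 - a/2" if "w \<in> ?L" for w using child1_side[of w] env that by blast
  have R: "1/2 - a/2 \<le> Re w - ht w" if w: "w \<in> ?R" for w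
  proof -
    consider "w \<in> bump a" | "w \<in> child2 a ` envelope a" | "w \<in> child3 a ` envelope a" | "w \<in> child4 a ` envelope a"
      using w env by blast
    then show ?thesis
    proof cases
      case 1 then show ?thesis by (auto simp: bump_def)
    next
      case 2 then show ?thesis using child2_side by blast
    next
      case 3 then show ?thesis using child3_side[of w] a_pos by linarith
    next
      case 4 then show ?thesis using child4_side[of w] a_pos by linarith
    qed
  qed
  (* Close to z the stage consists of the flank only; z is approached along a horizontal line from both sides. *)
  have near: "z + of_real (\<sigma> * t) \<in> ?L \<union> ?R" if "0 < t" "t < e" "\<bar>\<sigma>\<bar> = 1" for \<sigma> t
  proof -
    have "z + of_real (\<sigma> * t) \<in> ball z e" using that by (simp add: dist_norm norm_mult)
    then have "z + of_real (\<sigma> * t) \<in> koch_region a (Suc n)" using e(2) by blast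
    moreover have "ht (z + of_real (\<sigma> * t)) < 0" using assms(1) by (simp del: of_real_mult)
    ultimately have "z + of_real (\<sigma> * t) \<in> flank a (Suc n)" by (rule region_below)
    then show ?thesis by (simp del: of_real_mult) blast
  qed
  have cc: "compact (child1 a ` flank a n)" "compact (child2 a ` flank a n)" "compact (child3 a ` flank a n)" "compact (child4 a ` flank a n)"
    unfolding child_defs by (intro compact_continuous_image continuous_on_edge_map compact_flank)+
  have "z \<in> ?L"
  proof (rule closed_half_open_limit[OF _ e(1), of _ _ "-1"])
    show "closed ?L" using cc(1) by (rule compact_imp_closed)
    fix t assume t: "0 < t" "t < e"
    have "z + of_real (- 1 * t) \<notin> ?R"
    proof
      assume "z + of_real (- 1 * t) \<in> ?R"
      from R[OF this] show False using assms(2) t by (simp del: of_real_mult of_real_minus)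
    qed
    moreover have "z + of_real (- 1 * t) \<in> ?L \<union> ?R" by (rule near[OF t]) simp
    ultimately show "z + of_real (- 1 * t) \<in> ?L" by blast
  qed simp
  moreover have "z \<in> ?R"
  proof (rule closed_half_open_limit[OF _ e(1), of _ _ 1])
    show "closed ?R" using cc compact_convex_bump(1) by (intro closed_Un compact_imp_closed)
    fix t assume t: "0 < t" "t < e"
    have "z + of_real (1 * t) \<notin> ?L"
    proof
      assume "z + of_real (1 * t) \<in> ?L"
      from L[OF this] show False using assms(2) t by simp
    qed
    moreover have "z + of_real (1 * t) \<in> ?L \<union> ?R" by (rule near[OF t]) simp
    ultimately show "z + of_real (1 * t) \<in> ?R" by blast
  qed simp
  ultimately have zL: "z \<in> child1 a ` envelope a" and
    "z \<in> bump a \<or> z \<in> child2 a ` envelope a \<or> z \<in> child3 a ` envelope a \<or> z \<in> child4 a ` envelope a"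
    using env by blast+
  then show False
  proof (elim disjE)
    assume "z \<in> bump a" then show False using assms by (auto simp: bump_def)
  next
    assume "z \<in> child2 a ` envelope a"
    from child12_Int[OF zL this] show False using assms(1) by (simp add: foot1_def)
  next
    assume "z \<in> child3 a ` envelope a"
    then show False using child3_side[of z] assms a_pos by linarith
  next
    assume "z \<in> child4 a ` envelope a"
    then show False using child4_side[of z] assms a_pos by linarith
  qed
qed

lemma slit_not_in_snowflake:
  assumes "ht z \<le> 0" "Re z - ht z = 1/2 - a/2" shows "z \<notin> koch_snowflake a"
proof
  assume "z \<in> koch_snowflake a"
  then obtain n where "z \<in> interior (koch_region a n)" unfolding koch_snowflake_eq by blast
  then have z: "z \<in> interior (koch_region a (Suc n))"
    using interior_mono[OF koch_region_mono[of n "Suc n"]] by auto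
  then obtain e where e: "0 < e" "ball z e \<subseteq> interior (koch_region a (Suc n))"
    using open_contains_ball open_interior by blast
  define w where "w = z + tri_pt (- (e / 4)) (- (e / 4))"
  have "dist z w = e / 2"
    by (rule power2_eq_imp_eq, unfold dist_ht) (use e in \<open>simp_all add: w_def power2_eq_square\<close>)
  then have "w \<in> interior (koch_region a (Suc n))" using e by auto
  moreover have "ht w < 0" "Re w - ht w = 1/2 - a/2" using assms e(1) by (simp_all add: w_def)
  ultimately show False using slit_not_interior by blast
qed

lemma foot1_not_in_snowflake: "foot1 a \<notin> koch_snowflake a"
  by (rule slit_not_in_snowflake) (simp_all add: foot1_def)

text \<open>The points with real part \<open>(1 - a) / 2\<close> form the perpendicular at the foot. Within the angle \<open>\<pi>/6\<close> at
  the vertex \<open>0\<close>, a point on it is at most half as far from the foot as from the vertex.\<close>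

lemma cut_point:
  assumes "z \<in> koch_snowflake a" "Re z \<le> 1/2 - a/2" "Re z - ht z \<le> 1/2 - a/2" "Re (mirror z) \<le> 1/2 - a/2"
    "Re z = 1/2 - a/2 \<or> Re z - ht z = 1/2 - a/2"
  shows "1/2 - a/2 \<le> cmod z \<and> dist z (foot1 a) \<le> cmod z / 2"
proof -
  define l where "l = 1/2 - a/2"
  have l: "0 \<le> l" using a_le_half by (simp add: l_def)
  have "Re z - ht z \<noteq> l"
    using slit_not_in_snowflake[of z] assms unfolding l_def by auto
  then have z: "Re z = l" "0 \<le> ht z" using assms unfolding l_def by auto
  have h: "3 * ht z \<le> l" using assms(4) z unfolding l_def[symmetric] by (simp add: mirror_coords)
  have "(3 * ht z)\<^sup>2 \<le> l\<^sup>2" using h z by (intro power_mono) auto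
  then have 1: "9 * (ht z)\<^sup>2 \<le> l\<^sup>2" by (simp add: power_mult_distrib)
  have n: "(cmod z)\<^sup>2 = l\<^sup>2 + 3 * (ht z)\<^sup>2" by (simp add: norm_ht z)
  have "l\<^sup>2 \<le> (cmod z)\<^sup>2" by (simp add: n)
  then have "l \<le> cmod z" by (rule power2_le_imp_le) simp
  moreover have "(dist z (foot1 a))\<^sup>2 = 3 * (ht z)\<^sup>2" using z by (simp add: dist_ht foot1_def l_def)
  then have "(dist z (foot1 a))\<^sup>2 \<le> (cmod z / 2)\<^sup>2" unfolding power_divide n using 1 by simp
  then have "dist z (foot1 a) \<le> cmod z / 2" by (rule power2_le_imp_le) simp
  ultimately show ?thesis by (simp add: l_def)
qed

text \<open>The region around the vertex \<open>0\<close> is cut out by four half planes: two for the perpendicular at the foot and the slit,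
  and two for their mirror images. Its frontier meets the snowflake only in the two
  perpendiculars.\<close>

lemma neck_crossing:
  assumes C: "connected C" "C \<subseteq> koch_snowflake a" and x: "x \<in> C" "Re x < 1/2 - a/2" "Re x - ht x < 1/2 - a/2"
    "Re (mirror x) < 1/2 - a/2" "Re (mirror x) - ht (mirror x) < 1/2 - a/2" and y: "y \<in> C" "1/2 \<le> Re y"
  shows "\<exists>z\<in>C. \<exists>b. b \<notin> koch_snowflake a \<and> 1/2 - a/2 \<le> cmod z \<and> dist z b \<le> cmod z / 2"
proof -
  define l where "l = 1/2 - a/2"
  let ?A = "{z. Re z < l \<and> Re z - ht z < l \<and> Re (mirror z) < l \<and> Re (mirror z) - ht (mirror z) < l}"
  let ?B = "{z. Re z \<le> l \<and> Re z - ht z \<le> l \<and> Re (mirror z) \<le> l \<and> Re (mirror z) - ht (mirror z) \<le> l}"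
  have cm: "continuous_on UNIV mirror" unfolding mirror_def by (intro continuous_intros)
  have "open ?A" by (intro open_Collect_conj open_Collect_less continuous_intros continuous_on_compose2[OF cm]) auto
  moreover have "closed ?B" by (intro closed_Collect_conj closed_Collect_le continuous_intros continuous_on_compose2[OF cm]) auto
  then have "closure ?A \<subseteq> ?B" by (intro closure_minimal) auto
  ultimately have fr: "frontier ?A \<subseteq> ?B - ?A" by (auto simp: frontier_def interior_open)
  have "C \<inter> frontier ?A \<noteq> {}"
  proof (rule connected_Int_frontier[OF C(1)])
    show "C \<inter> ?A \<noteq> {}" using x by (auto simp: l_def)
    have "y \<notin> ?A" using y(2) a_pos by (simp add: l_def)
    then show "C - ?A \<noteq> {}" using y(1) by blast
  qed
  then obtain z where zC: "z \<in> C" and zf: "z \<in> ?B - ?A" using fr by blast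
  have z: "Re z \<le> l" "Re z - ht z \<le> l" "Re (mirror z) \<le> l" "Re (mirror z) - ht (mirror z) \<le> l"
    "(Re z = l \<or> Re z - ht z = l) \<or> (Re (mirror z) = l \<or> Re (mirror z) - ht (mirror z) = l)"
    using zf by auto
  have zS: "z \<in> koch_snowflake a" using zC C(2) by blast
  from z(5) show ?thesis
  proof (elim disjE[of "Re z = l \<or> Re z - ht z = l"])
    assume "Re z = l \<or> Re z - ht z = l"
    then show ?thesis using cut_point[OF zS] z zC foot1_not_in_snowflake unfolding l_def by blast
  next
    assume h: "Re (mirror z) = l \<or> Re (mirror z) - ht (mirror z) = l"
    have "1/2 - a/2 \<le> cmod (mirror z) \<and> dist (mirror z) (foot1 a) \<le> cmod (mirror z) / 2"
      using cut_point[OF mirror_snowflake[OF zS]] z h unfolding l_def by simp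
    then have "1/2 - a/2 \<le> cmod z \<and> dist z (mirror (foot1 a)) \<le> cmod z / 2"
      using dist_mirror[of z "mirror (foot1 a)"] by (simp add: norm_mirror)
    moreover have "mirror (foot1 a) \<notin> koch_snowflake a"
      using mirror_snowflake[of "mirror (foot1 a)"] foot1_not_in_snowflake by auto
    ultimately show ?thesis using zC by blast
  qed
qed

text \<open>Of the two vertices \<open>0\<close> and \<open>1\<close> one is far from the centre; \<open>flip\<close> exchanges them. The starting point is
  chosen on the bisector, so close to the vertex that its distance to the vertex is negligible.\<close>

lemma not_john_below_2:
  assumes "c' < 2" shows "\<not> john_domain c' (koch_snowflake a)"
proof
  assume "john_domain c' (koch_snowflake a)"
  then obtain x0 where c1: "1 \<le> c'" and x0: "x0 \<in> koch_snowflake a" and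
    J: "\<And>x. x \<in> koch_snowflake a \<Longrightarrow> \<exists>\<gamma> l. arclength_parametrized \<gamma> l \<and> \<gamma> ` {0..l} \<subseteq> koch_snowflake a \<and> \<gamma> 0 = x \<and> \<gamma> l = x0 \<and>
        (\<forall>t\<in>{0..l}. infdist (\<gamma> t) (frontier (koch_snowflake a)) \<ge> 1 / c' * t)"
    unfolding john_domain_def by blast
  obtain g where g: "g = (\<lambda>z. z) \<or> g = flip" "1/2 \<le> Re (g x0)"
  proof (cases "1/2 \<le> Re x0")
    case True then show ?thesis using that[of "\<lambda>z. z"] by simp
  next
    case False then show ?thesis using that[of flip] by simp
  qed
  have gg: "g (g z) = z" "dist (g z) (g w) = dist z w" "z \<in> koch_snowflake a \<Longrightarrow> g z \<in> koch_snowflake a" for z w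
    using g(1) flip_snowflake dist_flip by auto
  have gc: "continuous_on S g" for S using g(1) by (auto simp: flip_def intro!: continuous_intros)
  define l where "l = 1/2 - a/2"
  have l: "1/4 \<le> l" "l < 1/2" using a_pos a_le_half by (auto simp: l_def)
  (* The starting point has distance at most 2 * \<delta> from the vertex, the crossing of the neck at least l. *)
  define \<delta> where "\<delta> = l * (1 - c' / 2) / 4"
  have \<delta>: "0 < \<delta>" "\<delta> < l"
  proof -
    show "0 < \<delta>" using l assms by (simp add: \<delta>_def)
    have "l * (1 - c' / 2) \<le> l * 1" using l c1 by (intro mult_left_mono) auto
    then show "\<delta> < l" using l by (simp add: \<delta>_def)
  qed
  define x where "x = tri_pt \<delta> (\<delta> / 3)"
  have "x \<in> koch_snowflake a"
    by (rule subsetD[OF interior_tri_snowflake], rule interior_tri) (use \<delta> l in \<open>simp_all add: x_def\<close>)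
  then have "g x \<in> koch_snowflake a" by (rule gg(3))
  from J[OF this] obtain \<gamma> L where \<gamma>: "arclength_parametrized \<gamma> L" "\<gamma> ` {0..L} \<subseteq> koch_snowflake a" "\<gamma> 0 = g x" "\<gamma> L = x0"
    "\<And>t. t \<in> {0..L} \<Longrightarrow> infdist (\<gamma> t) (frontier (koch_snowflake a)) \<ge> 1 / c' * t" by blast
  have L: "0 \<le> L" "continuous_on {0..L} \<gamma>" using \<gamma>(1) by (auto simp: arclength_parametrized_def)
  have "\<exists>z\<in>g ` \<gamma> ` {0..L}. \<exists>b. b \<notin> koch_snowflake a \<and> 1/2 - a/2 \<le> cmod z \<and> dist z b \<le> cmod z / 2"
  proof (rule neck_crossing)
    show "connected (g ` \<gamma> ` {0..L})" using L(2) by (intro connected_continuous_image gc) auto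
    show "g ` \<gamma> ` {0..L} \<subseteq> koch_snowflake a" using \<gamma>(2) gg(3) by blast
    have "g (\<gamma> 0) \<in> g ` \<gamma> ` {0..L}" using L(1) by (intro imageI) simp
    then show "x \<in> g ` \<gamma> ` {0..L}" by (simp add: \<gamma>(3) gg(1))
    have "g (\<gamma> L) \<in> g ` \<gamma> ` {0..L}" using L(1) by (intro imageI) simp
    then show "g x0 \<in> g ` \<gamma> ` {0..L}" by (simp add: \<gamma>(4))
    show "1/2 \<le> Re (g x0)" by (rule g(2))
    show "Re x < 1/2 - a/2" "Re x - ht x < 1/2 - a/2" "Re (mirror x) < 1/2 - a/2" "Re (mirror x) - ht (mirror x) < 1/2 - a/2"
      unfolding l_def[symmetric] mirror_coords using \<delta> by (simp_all add: x_def)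
  qed
  then obtain t b where t: "t \<in> {0..L}" and b: "b \<notin> koch_snowflake a" "l \<le> cmod (g (\<gamma> t))" "dist (g (\<gamma> t)) b \<le> cmod (g (\<gamma> t)) / 2"
    unfolding l_def by blast
  define z where "z = g (\<gamma> t)"
  have "g b \<notin> koch_snowflake a" using gg(3)[of "g b"] b(1) by (auto simp: gg(1))
  moreover have "\<gamma> t \<in> koch_snowflake a" using t \<gamma>(2) by blast
  ultimately have "infdist (\<gamma> t) (frontier (koch_snowflake a)) \<le> dist (\<gamma> t) (g b)" by (intro infdist_frontier_le)
  also have "\<dots> = dist z b" using gg(2)[of "\<gamma> t" "g b"] by (simp add: z_def gg(1))
  also have "\<dots> \<le> cmod z / 2" using b by (simp add: z_def)
  finally have "1 / c' * t \<le> cmod z / 2" using \<gamma>(5)[OF t] by linarith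
  then have tz: "t \<le> c' * (cmod z / 2)" using c1 by (simp add: pos_divide_le_eq mult.commute)
  have "dist (g (\<gamma> 0)) z \<le> t"
    using arclength_lipschitz[OF \<gamma>(1), of 0 t] t by (simp add: z_def gg(2))
  then have "dist x z \<le> t" by (simp add: \<gamma>(3) gg(1))
  moreover have "cmod z \<le> cmod x + dist x z" by (metis dist_norm norm_minus_commute norm_triangle_sub)
  moreover have "cmod x \<le> 2 * \<delta>"
    by (rule power2_le_imp_le, unfold norm_ht) (use \<delta> in \<open>simp_all add: x_def power2_eq_square\<close>)
  ultimately have "cmod z - 2 * \<delta> \<le> c' * (cmod z / 2)" using tz by linarith
  then have "cmod z * (1 - c' / 2) \<le> 2 * \<delta>" by (simp add: algebra_simps)
  also have "\<dots> < l * (1 - c' / 2)" using l assms by (simp add: \<delta>_def)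
  also have "\<dots> \<le> cmod z * (1 - c' / 2)" using b(2) assms by (intro mult_right_mono) (auto simp: z_def)
  finally show False by simp
qed

end

theorem theorem4p5:
  fixes a :: real
  assumes "0 < a" and "a \<le> 1 / 2"
  shows "john_domain (max 2 (4 / (3 * (1 - a)))) (koch_snowflake a)
    \<and> (\<forall>c'<2. \<not> john_domain c' (koch_snowflake a))"
proof -
  interpret koch_parameter a by unfold_locales (fact assms)+
  interpret john_parameter a "max 2 (4 / (3 * (1 - a)))" by unfold_locales (rule refl)
  show ?thesis using john_snowflake not_john_below_2 by blast
qed

end
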